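(* Let $H=H_B+H_{\rm err}$ be a time-independent noise Hamiltonian with $H_B=\mathbb I\otimes B_0$, $H_{\rm err}=\sum_\alpha S_\alpha\otimes B_\alpha$, $\|H_B\|\le\beta$, $\|H_{\rm err}\|\le J$, $\epsilon=\beta+J$. Let $p_1$ be a cyclic sequence of $R\ge2$ ideal zero-width pulses with pulse interval $\tau_0$ that achieves first-order decoupling, such that each pulse either commutes or anticommutes with each $S_\alpha$, and let $p_k$ be the level-$k$ concatenated sequence, of duration $T^{(k)}=R^k\tau_0$. Define recursively $\beta^{(0)}=\beta$, $J^{(0)}=J$, $\epsilon^{(k)}=\beta^{(k)}+J^{(k)}$, $x_k=\epsilon^{(k-1)}T^{(k)}$, and for $k\ge1$ $$c_3^{(k)}=\tfrac29+\tfrac{11}{9}x_k+9.43\,x_k^2,\qquad c_2^{(k)}=\tfrac12+2\left[\tfrac29x_k+\tfrac{11}{9}x_k^2+9.43\,x_k^3\right],$$ $$\beta^{(k)}=\beta^{(k-1)}+c_3^{(k)}J^{(k-1)}x_k^2,\qquad J^{(k)}=c_2^{(k)}J^{(k-1)}x_k.$$ Let $\ell\ge0$ and suppose that for all $1\le k\le\ell$ we have $x_k\le0.54$ and $c_2^{(k)}\epsilon^{(k-1)}\le\bar c\,\epsilon$ for a constant $\bar c>0$. Then for every $0\le k\le\ell$ the level-$k$ effective Hamiltonian $H^{(k)}=H_B^{(k)}+H_{\rm err}^{(k)}$ satisfies $\|H_B^{(k)}\|\le\beta^{(k)}$, $\|H_{\rm err}^{(k)}\|\le J^{(k)}$, and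 the effective noise strength $\eta_{\rm DD}^{(k)}=\|H_{\rm err}^{(k)}\|T^{(k)}$ satisfies $$\eta_{\rm DD}^{(k)}\le R^{k(k+3)/2}(\bar c\,\epsilon\tau_0)^k(J\tau_0).$$ Moreover, if $\bar c\,\epsilon\tau_0\le 1/R$ and these hypotheses hold with $\ell=k_{\max}=\lfloor\log_R(1/\bar c\epsilon\tau_0)-1\rfloor$, then the effective noise strength at level $k_{\max}$ satisfies $$\eta_{\rm DD}^{(k_{\max})}/(J\tau_0)\le R^{-1}(\bar c\,\epsilon\tau_0)^{\frac12\log_R(1/\bar c\epsilon\tau_0)-\frac32}.$$
   Context: The system Hilbert space is finite dimensional, operators are bounded, $\|\cdot\|$ is the operator norm. $\{S_\alpha\}$ is a Hermitian basis of the traceless operators on the system, with ${\rm tr}(S_\alpha S_\beta)=0$ for $\alpha\ne\beta$. Level-0 sequence $p_0$: idle evolution under $H$ for time $\tau_0$. Level-1: pulses $P_1,\dots,P_R$ (instantaneous system unitaries, possibly the identity), $P_R\cdots P_1=\mathbb I$ up to a phase; $p_1$ is: evolve for $\tau_0$, apply $P_1$, evolve for $\tau_0$, apply $P_2$, …, evolve for $\tau_0$, apply $P_R$. Level $k$: $p_k=P_R\,p_{k-1}\,P_{R-1}\,p_{k-1}\cdots P_1\,p_{k-1}$ (operations applied right to left). First-order decoupling: with $Q_j=P_j\cdots P_1$, $Q_0=\mathbb I$, $\sum_{j=0}^{R-1}Q_j^\dagger S_\alpha Q_j=0$ for every $\alpha$. Effective Hamiltonians: $H^{(0)}=H$. Given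 $H^{(k-1)}$, the level-$k$ toggling-frame Hamiltonian is the piecewise constant function equal to $Q_j^\dagger H^{(k-1)}Q_j$ on $[jT^{(k-1)},(j+1)T^{(k-1)})$, $j=0,\dots,R-1$; let $\Omega^{(k)}$ be the sum of its Magnus expansion over $[0,T^{(k)}]$, and define $H^{(k)}$ by $\Omega^{(k)}=-iT^{(k)}H^{(k)}$. Thus $\exp(-iT^{(k)}H^{(k)})$ is (up to a phase) the evolution operator of the full level-$k$ sequence. Decompose uniquely $H^{(k)}=H_B^{(k)}+H_{\rm err}^{(k)}$ with $H_B^{(k)}=\mathbb I\otimes B_0^{(k)}$ and $H_{\rm err}^{(k)}=\sum_\alpha S_\alpha\otimes B_\alpha^{(k)}$. Magnus expansion: the Magnus terms $\Omega_n$ of a Hamiltonian $K(t)$ on $[0,T]$ are the coefficients in $U_\lambda(T)=\exp(\sum_n\lambda^n\Omega_n)$, where $U_\lambda$ is the evolution operator generated by $\lambda K(t)$; the Magnus expansion is $\sum_n\Omega_n$. *)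

theory Defs
  imports "HOL-Analysis.Analysis"
begin

class complex_vector = real_vector +
  fixes scaleC :: "complex \<Rightarrow> 'a \<Rightarrow> 'a"  (infixr \<open>*\<^sub>C\<close> 75)
  assumes scaleC_add_right: "a *\<^sub>C (x + y) = a *\<^sub>C x + a *\<^sub>C y"
    and scaleC_add_left: "(a + b) *\<^sub>C x = a *\<^sub>C x + b *\<^sub>C x"
    and scaleC_scaleC: "a *\<^sub>C b *\<^sub>C x = (a * b) *\<^sub>C x"
    and scaleR_scaleC: "scaleR r x = complex_of_real r *\<^sub>C x"

global_interpretation complex_vector:
  vector_space "scaleC :: complex \<Rightarrow> 'a \<Rightarrow> 'a::complex_vector"
proof
  fix a b :: complex and x y :: 'a
  show "a *\<^sub>C (x + y) = a *\<^sub>C x + a *\<^sub>C y" by (rule scaleC_add_right)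
  show "(a + b) *\<^sub>C x = a *\<^sub>C x + b *\<^sub>C x" by (rule scaleC_add_left)
  show "a *\<^sub>C b *\<^sub>C x = (a * b) *\<^sub>C x" by (rule scaleC_scaleC)
  show "1 *\<^sub>C x = x" using scaleR_scaleC[of 1 x] by simp
qed

text \<open>The inner product is linear in the second argument.  Hilbert spaces are required to be
  nonzero, so that the identity operator has norm 1.\<close>

class complex_hilbert = complex_vector + real_inner + banach +
  fixes cinner :: "'a \<Rightarrow> 'a \<Rightarrow> complex"
  assumes cinner_add_right: "cinner x (y + z) = cinner x y + cinner x z"
    and cinner_scaleC_right: "cinner x (c *\<^sub>C y) = c * cinner x y"
    and cinner_commute: "cinner y x = cnj (cinner x y)"
    and inner_Re_cinner: "inner x y = Re (cinner x y)"
    and nontrivial: "\<exists>x::'a. x \<noteq> 0"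

lemma norm_scaleC: "norm (c *\<^sub>C x) = cmod c * norm (x::'a::complex_hilbert)"
proof -
  have eq: "cinner (c *\<^sub>C x) (c *\<^sub>C x) = of_real ((cmod c)\<^sup>2) * cinner x x"
  proof -
    have "cinner (c *\<^sub>C x) x = cnj c * cinner x x"
      using cinner_commute[of "c *\<^sub>C x" x] cinner_commute[of x x]
      by (metis cinner_scaleC_right complex_cnj_mult)
    then show ?thesis
      by (simp add: cinner_scaleC_right complex_norm_square mult.assoc del: of_real_power)
  qed
  have "(norm (c *\<^sub>C x))\<^sup>2 = (cmod c * norm x)\<^sup>2"
    unfolding power_mult_distrib power2_norm_eq_inner inner_Re_cinner eq by simp
  then show ?thesis by simp
qed

lemma bounded_linear_scaleC: "bounded_linear (\<lambda>y::'a::complex_hilbert. c *\<^sub>C y)"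
  by (rule bounded_linear_intro[where K = "cmod c"])
    (simp_all add: scaleC_add_right norm_scaleC scaleR_scaleC scaleC_scaleC mult.commute)

instantiation complex :: complex_hilbert
begin
definition scaleC_complex :: "complex \<Rightarrow> complex \<Rightarrow> complex" where
  "scaleC_complex c x = c * x"
definition cinner_complex :: "complex \<Rightarrow> complex \<Rightarrow> complex" where
  "cinner_complex x y = cnj x * y"
instance
proof
  show "\<exists>x::complex. x \<noteq> 0" by (rule exI[of _ 1]) simp
qed (simp_all add: scaleC_complex_def cinner_complex_def inner_complex_def algebra_simps
      scaleR_conv_of_real)
end

instantiation vec :: (complex_vector, finite) complex_vector
begin
definition scaleC_vec :: "complex \<Rightarrow> 'a ^ 'b \<Rightarrow> 'a ^ 'b" where
  "scaleC_vec c x = (\<chi> i. c *\<^sub>C x $ i)"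
instance
  by standard
    (simp_all add: scaleC_vec_def vec_eq_iff scaleC_add_right scaleC_add_left scaleC_scaleC
      scaleR_scaleC)
end

instantiation vec :: (complex_hilbert, finite) complex_hilbert
begin
definition cinner_vec :: "'a ^ 'b \<Rightarrow> 'a ^ 'b \<Rightarrow> complex" where
  "cinner_vec x y = (\<Sum>i\<in>UNIV. cinner (x $ i) (y $ i))"
instance
proof
  fix x y z :: "'a ^ 'b" and c
  show "cinner x (y + z) = cinner x y + cinner x z"
    by (simp add: cinner_vec_def cinner_add_right sum.distrib)
  show "cinner x (c *\<^sub>C y) = c * cinner x y"
    by (simp add: cinner_vec_def scaleC_vec_def cinner_scaleC_right sum_distrib_left)
  show "cinner y x = cnj (cinner x y)"
    unfolding cinner_vec_def cnj_sum by (intro sum.cong refl cinner_commute)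
  show "inner x y = Re (cinner x y)"
    by (simp add: cinner_vec_def inner_vec_def inner_Re_cinner)
  obtain a :: 'a where "a \<noteq> 0" using nontrivial by blast
  then show "\<exists>x::'a ^ 'b. x \<noteq> 0"
    by (intro exI[of _ "\<chi> i. a"]) (simp add: vec_eq_iff)
qed
end

typedef (overloaded) 'a bop =
  "{f :: 'a::complex_hilbert \<Rightarrow>\<^sub>L 'a. \<forall>c x. blinfun_apply f (c *\<^sub>C x) = c *\<^sub>C blinfun_apply f x}"
  morphisms blinfun_of_bop Bop
  by (rule exI[of _ 0]) simp

setup_lifting type_definition_bop

instantiation bop :: (complex_hilbert) real_normed_vector
begin
lift_definition zero_bop :: "'a bop" is 0 by simp
lift_definition plus_bop :: "'a bop \<Rightarrow> 'a bop \<Rightarrow> 'a bop" is "(+)"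
  by (simp add: blinfun.add_left scaleC_add_right)
lift_definition minus_bop :: "'a bop \<Rightarrow> 'a bop \<Rightarrow> 'a bop" is "(-)"
  by (simp add: blinfun.diff_left complex_vector.scale_right_diff_distrib)
lift_definition uminus_bop :: "'a bop \<Rightarrow> 'a bop" is uminus
  by (simp add: blinfun.minus_left)
lift_definition scaleR_bop :: "real \<Rightarrow> 'a bop \<Rightarrow> 'a bop" is scaleR
  by (simp add: blinfun.scaleR_left scaleR_scaleC scaleC_scaleC mult.commute)
lift_definition norm_bop :: "'a bop \<Rightarrow> real" is norm .
definition dist_bop :: "'a bop \<Rightarrow> 'a bop \<Rightarrow> real" where "dist_bop A B = norm (A - B)"
definition sgn_bop :: "'a bop \<Rightarrow> 'a bop" where "sgn_bop A = scaleR (inverse (norm A)) A"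
definition uniformity_bop :: "('a bop \<times> 'a bop) filter" where
  "uniformity_bop = (INF e\<in>{0 <..}. principal {(x, y). dist x y < e})"
definition open_bop :: "'a bop set \<Rightarrow> bool" where
  "open_bop U = (\<forall>x\<in>U. \<forall>\<^sub>F (x', y) in uniformity. x' = x \<longrightarrow> y \<in> U)"
instance
proof
  fix A B C :: "'a bop" and r s :: real
  show "dist A B = norm (A - B)" by (rule dist_bop_def)
  show "sgn A = scaleR (inverse (norm A)) A" by (rule sgn_bop_def)
  show "uniformity = (INF e\<in>{0 <..}. principal {(x, y :: 'a bop). dist x y < e})"
    by (rule uniformity_bop_def)
  show "open U = (\<forall>x\<in>U. \<forall>\<^sub>F (x', y) in uniformity. x' = x \<longrightarrow> y \<in> U)" for U :: "'a bop set"
    by (rule open_bop_def)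
  show "A + B + C = A + (B + C)" by transfer simp
  show "A + B = B + A" by transfer simp
  show "0 + A = A" by transfer simp
  show "- A + A = 0" by transfer simp
  show "A - B = A + - B" by transfer simp
  show "scaleR r (A + B) = scaleR r A + scaleR r B" by transfer (rule scaleR_add_right)
  show "scaleR (r + s) A = scaleR r A + scaleR s A" by transfer (rule scaleR_add_left)
  show "scaleR r (scaleR s A) = scaleR (r * s) A" by transfer simp
  show "scaleR 1 A = A" by transfer simp
  show "(norm A = 0) = (A = 0)" by transfer simp
  show "norm (A + B) \<le> norm A + norm B" by transfer (rule norm_triangle_ineq)
  show "norm (scaleR r A) = \<bar>r\<bar> * norm A" by transfer simp
qed
end

instantiation bop :: (complex_hilbert) complex_vector
begin
lift_definition scaleC_bop :: "complex \<Rightarrow> 'a bop \<Rightarrow> 'a bop"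
  is "\<lambda>c f. Blinfun (\<lambda>x. c *\<^sub>C blinfun_apply f x)"
proof -
  fix c d and f :: "'a \<Rightarrow>\<^sub>L 'a" and x
  assume f: "\<And>c x. blinfun_apply f (c *\<^sub>C x) = c *\<^sub>C blinfun_apply f x"
  have "bounded_linear (\<lambda>x. c *\<^sub>C blinfun_apply f x)"
    by (rule bounded_linear_compose[OF bounded_linear_scaleC blinfun.bounded_linear_right])
  then show "blinfun_apply (Blinfun (\<lambda>x. c *\<^sub>C blinfun_apply f x)) (d *\<^sub>C x)
      = d *\<^sub>C blinfun_apply (Blinfun (\<lambda>x. c *\<^sub>C blinfun_apply f x)) x"
    by (simp add: bounded_linear_Blinfun_apply f scaleC_scaleC mult.commute)
qed

lemma bop_apply_scaleC:
  "blinfun_apply (blinfun_of_bop (c *\<^sub>C A)) x = c *\<^sub>C blinfun_apply (blinfun_of_bop A) x"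
proof -
  have "bounded_linear (\<lambda>x. c *\<^sub>C blinfun_apply (blinfun_of_bop A) x)"
    by (rule bounded_linear_compose[OF bounded_linear_scaleC blinfun.bounded_linear_right])
  then show ?thesis by (simp add: scaleC_bop.rep_eq bounded_linear_Blinfun_apply)
qed

instance
proof
  fix a b :: complex and A B :: "'a bop" and r :: real
  have eqI: "X = Y"
    if "\<And>x. blinfun_apply (blinfun_of_bop X) x = blinfun_apply (blinfun_of_bop Y) x"
    for X Y :: "'a bop"
    using that by (metis blinfun_eqI blinfun_of_bop_inject)
  show "a *\<^sub>C (A + B) = a *\<^sub>C A + a *\<^sub>C B"
    by (rule eqI) (simp add: bop_apply_scaleC plus_bop.rep_eq blinfun.add_left scaleC_add_right)
  show "(a + b) *\<^sub>C A = a *\<^sub>C A + b *\<^sub>C A"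
    by (rule eqI) (simp add: bop_apply_scaleC plus_bop.rep_eq blinfun.add_left scaleC_add_left)
  show "a *\<^sub>C b *\<^sub>C A = (a * b) *\<^sub>C A"
    by (rule eqI) (simp add: bop_apply_scaleC scaleC_scaleC)
  show "scaleR r A = complex_of_real r *\<^sub>C A"
    by (rule eqI) (simp add: bop_apply_scaleC scaleR_bop.rep_eq blinfun.scaleR_left scaleR_scaleC)
qed
end

instance bop :: (complex_hilbert) banach
proof
  fix X :: "nat \<Rightarrow> 'a bop"
  assume "Cauchy X"
  then have "Cauchy (\<lambda>n. blinfun_of_bop (X n))"
    by (simp add: Cauchy_def dist_norm norm_bop.rep_eq minus_bop.rep_eq)
  then obtain L where L: "(\<lambda>n. blinfun_of_bop (X n)) \<longlonglongrightarrow> L"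
    using Cauchy_convergent convergent_def by blast
  have "blinfun_apply L (c *\<^sub>C x) = c *\<^sub>C blinfun_apply L x" for c x
  proof (rule LIMSEQ_unique)
    show "(\<lambda>n. blinfun_apply (blinfun_of_bop (X n)) (c *\<^sub>C x)) \<longlonglongrightarrow> blinfun_apply L (c *\<^sub>C x)"
      by (intro tendsto_intros L)
    have eq: "blinfun_apply (blinfun_of_bop (X n)) (c *\<^sub>C x)
        = c *\<^sub>C blinfun_apply (blinfun_of_bop (X n)) x" for n
      using blinfun_of_bop[of "X n"] by simp
    have lim: "(\<lambda>n. blinfun_apply (blinfun_of_bop (X n)) x) \<longlonglongrightarrow> blinfun_apply L x"
      by (intro tendsto_intros L)
    show "(\<lambda>n. blinfun_apply (blinfun_of_bop (X n)) (c *\<^sub>C x)) \<longlonglongrightarrow> c *\<^sub>C blinfun_apply L x"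
      unfolding eq by (rule bounded_linear.tendsto[OF bounded_linear_scaleC lim])
  qed
  then have rep: "blinfun_of_bop (Bop L) = L" by (simp add: Bop_inverse)
  have "X \<longlonglongrightarrow> Bop L"
    using L by (simp add: tendsto_iff dist_norm norm_bop.rep_eq minus_bop.rep_eq rep)
  then show "convergent X" by (rule convergentI)
qed

instantiation bop :: (complex_hilbert) real_normed_algebra_1
begin
lift_definition times_bop :: "'a bop \<Rightarrow> 'a bop \<Rightarrow> 'a bop" is "(o\<^sub>L)" by simp
lift_definition one_bop :: "'a bop" is id_blinfun by simp
instance
proof
  fix A B C :: "'a bop" and r :: real
  show "A * B * C = A * (B * C)" by transfer (rule blinfun_eqI, simp)
  show "(A + B) * C = A * C + B * C"
    by transfer
      (rule blinfun_eqI, simp add: blinfun.add_left blinfun.add_right blinfun.scaleR_left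
        blinfun.scaleR_right)
  show "A * (B + C) = A * B + A * C"
    by transfer
      (rule blinfun_eqI, simp add: blinfun.add_left blinfun.add_right blinfun.scaleR_left
        blinfun.scaleR_right)
  show "scaleR r A * B = scaleR r (A * B)"
    by transfer
      (rule blinfun_eqI, simp add: blinfun.add_left blinfun.add_right blinfun.scaleR_left
        blinfun.scaleR_right)
  show "A * scaleR r B = scaleR r (A * B)"
    by transfer
      (rule blinfun_eqI, simp add: blinfun.add_left blinfun.add_right blinfun.scaleR_left
        blinfun.scaleR_right)
  show "1 * A = A" by transfer (rule blinfun_eqI, simp)
  show "A * 1 = A" by transfer (rule blinfun_eqI, simp)
  obtain a :: 'a where a: "a \<noteq> 0" using nontrivial by blast
  show "(0::'a bop) \<noteq> 1"
    by transfer (metis a blinfun.zero_left blinfun_apply_id_blinfun id_apply)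
  show "norm (A * B) \<le> norm A * norm B" by transfer (rule norm_blinfun_compose)
  show "norm (1::'a bop) = 1"
  proof transfer
    show "norm (id_blinfun :: 'a \<Rightarrow>\<^sub>L 'a) = 1"
    proof (rule antisym)
      show "norm (id_blinfun :: 'a \<Rightarrow>\<^sub>L 'a) \<le> 1" by (rule norm_blinfun_bound) simp_all
      show "1 \<le> norm (id_blinfun :: 'a \<Rightarrow>\<^sub>L 'a)"
        using norm_blinfun[of "id_blinfun :: 'a \<Rightarrow>\<^sub>L 'a" a] a by simp
    qed
  qed
qed
end

definition self_adjoint :: "'a::complex_hilbert bop \<Rightarrow> bool" where
  "self_adjoint A \<longleftrightarrow> (\<forall>x y. cinner (blinfun_apply (blinfun_of_bop A) x) y
     = cinner x (blinfun_apply (blinfun_of_bop A) y))"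

definition adj :: "complex ^ 'n ^ 'n \<Rightarrow> complex ^ 'n ^ 'n" where
  "adj M = (\<chi> i j. cnj (M $ j $ i))"

definition unitary :: "complex ^ 'n ^ 'n \<Rightarrow> bool" where
  "unitary U \<longleftrightarrow> adj U ** U = mat 1 \<and> U ** adj U = mat 1"

lemma bounded_linear_tensor:
  fixes M :: "complex ^ 'n ^ 'n" and B :: "'b::complex_hilbert \<Rightarrow>\<^sub>L 'b"
  shows "bounded_linear (\<lambda>v. \<chi> i. \<Sum>j\<in>UNIV. M $ i $ j *\<^sub>C blinfun_apply B (v $ j))"
    (is "bounded_linear ?f")
proof -
  have comp: "bounded_linear (\<lambda>v. ?f v $ i)" for i
    unfolding vec_lambda_beta
    by (intro bounded_linear_sum bounded_linear_compose[OF bounded_linear_scaleC]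
        bounded_linear_compose[OF blinfun.bounded_linear_right] bounded_linear_vec_nth)
  show ?thesis
  proof (rule bounded_linear_intro[where K = "\<Sum>i\<in>UNIV. onorm (\<lambda>v. ?f v $ i)"])
    fix v w :: "'b ^ 'n" and r :: real
    show "?f (v + w) = ?f v + ?f w"
      by (simp add: vec_eq_iff blinfun.add_right scaleC_add_right sum.distrib)
    show "?f (r *\<^sub>R v) = r *\<^sub>R ?f v"
      by (simp add: vec_eq_iff blinfun.scaleR_right scaleR_sum_right)
        (simp add: scaleR_scaleC scaleC_scaleC mult.commute)
    have "norm (?f v) \<le> (\<Sum>i\<in>UNIV. norm (?f v $ i))"
      unfolding norm_vec_def by (rule L2_set_le_sum) simp
    also have "\<dots> \<le> (\<Sum>i\<in>UNIV. onorm (\<lambda>v. ?f v $ i) * norm v)"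
      by (intro sum_mono onorm[OF comp])
    finally show "norm (?f v) \<le> norm v * (\<Sum>i\<in>UNIV. onorm (\<lambda>v. ?f v $ i))"
      by (simp add: sum_distrib_left mult.commute)
  qed
qed

text \<open>The system is \<open>complex ^ 'n\<close>, the bath any complex Hilbert space \<open>'b\<close>, possibly infinite
  dimensional; their Hilbert tensor product is \<open>'b ^ 'n\<close>, with \<open>e\<^sub>i \<otimes> \<phi>\<close> the vector having
  \<open>\<phi>\<close> in position \<open>i\<close> and \<open>0\<close> elsewhere.\<close>

lift_definition tensor_op :: "complex ^ 'n ^ 'n \<Rightarrow> 'b::complex_hilbert bop \<Rightarrow> ('b ^ 'n) bop"
    (infixr \<open>\<otimes>\<^sub>o\<close> 75)
  is "\<lambda>M B. Blinfun (\<lambda>v. \<chi> i. \<Sum>j\<in>UNIV. M $ i $ j *\<^sub>C blinfun_apply B (v $ j))"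
  by (simp add: bounded_linear_Blinfun_apply[OF bounded_linear_tensor] vec_eq_iff scaleC_vec_def
      complex_vector.scale_sum_right scaleC_scaleC mult.commute)

lemma tensor_op_apply:
  "blinfun_apply (blinfun_of_bop (M \<otimes>\<^sub>o B)) v
     = (\<chi> i. \<Sum>j\<in>UNIV. M $ i $ j *\<^sub>C blinfun_apply (blinfun_of_bop B) (v $ j))"
  by (simp add: tensor_op.rep_eq bounded_linear_Blinfun_apply[OF bounded_linear_tensor])

text \<open>Linear (in)dependence and span are over the complex numbers.\<close>

definition hermitian_traceless_basis :: "('a \<Rightarrow> complex ^ 'n ^ 'n) \<Rightarrow> 'a set \<Rightarrow> bool" where
  "hermitian_traceless_basis S A \<longleftrightarrow>
     finite A \<and> inj_on S A \<and> (\<forall>\<alpha>\<in>A. adj (S \<alpha>) = S \<alpha>) \<and>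
     complex_vector.independent (S ` A) \<and> complex_vector.span (S ` A) = {M. trace M = 0}"

text \<open>The two components in the unique decomposition
  \<open>X = I \<otimes> B\<^sub>0 + (\<Sum>\<alpha>. S \<alpha> \<otimes> B \<alpha>)\<close>.\<close>

definition bath_part ::
    "('a \<Rightarrow> complex ^ 'n ^ 'n) \<Rightarrow> 'a set \<Rightarrow> ('b::complex_hilbert ^ 'n) bop \<Rightarrow> ('b ^ 'n) bop" where
  "bath_part S A X = (THE Y. \<exists>B\<^sub>0 B.
     Y = mat 1 \<otimes>\<^sub>o B\<^sub>0 \<and> X = mat 1 \<otimes>\<^sub>o B\<^sub>0 + (\<Sum>\<alpha>\<in>A. S \<alpha> \<otimes>\<^sub>o B \<alpha>))"

definition err_part ::
    "('a \<Rightarrow> complex ^ 'n ^ 'n) \<Rightarrow> 'a set \<Rightarrow> ('b::complex_hilbert ^ 'n) bop \<Rightarrow> ('b ^ 'n) bop" where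
  "err_part S A X = (THE Y. \<exists>B\<^sub>0 B.
     Y = (\<Sum>\<alpha>\<in>A. S \<alpha> \<otimes>\<^sub>o B \<alpha>) \<and> X = mat 1 \<otimes>\<^sub>o B\<^sub>0 + (\<Sum>\<alpha>\<in>A. S \<alpha> \<otimes>\<^sub>o B \<alpha>))"

text \<open>\<open>U\<close> solves \<open>U' = -i K U\<close>, \<open>U(0) = 1\<close> on \<open>[0, T]\<close>; finitely many exceptional times are
  allowed because \<open>K\<close> is only piecewise continuous.\<close>

definition evolves ::
    "(real \<Rightarrow> 'a::complex_hilbert bop) \<Rightarrow> real \<Rightarrow> (real \<Rightarrow> 'a bop) \<Rightarrow> bool" where
  "evolves K T U \<longleftrightarrow> U 0 = 1 \<and> continuous_on {0..T} U \<and>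
     (\<exists>F. finite F \<and> (\<forall>t\<in>{0<..<T} - F.
        (U has_vector_derivative (- \<i>) *\<^sub>C (K t * U t)) (at t)))"

definition evolution_op :: "(real \<Rightarrow> 'a::complex_hilbert bop) \<Rightarrow> real \<Rightarrow> 'a bop" where
  "evolution_op K T = (THE V. \<exists>U. evolves K T U \<and> V = U T)"

text \<open>The Magnus terms are the coefficients in
  \<open>U\<^sub>\<lambda>(T) = exp (\<Sum>n\<ge>1. \<lambda>^n \<Omega>\<^sub>n)\<close>, an identity between convergent series for all
  sufficiently small real \<open>\<lambda>\<close>, which determines them uniquely.\<close>

definition magnus_coeffs ::
    "(real \<Rightarrow> 'a::complex_hilbert bop) \<Rightarrow> real \<Rightarrow> (nat \<Rightarrow> 'a bop) \<Rightarrow> bool" where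
  "magnus_coeffs K T \<Omega> \<longleftrightarrow> \<Omega> 0 = 0 \<and>
     (\<exists>r>0. \<forall>l::real. \<bar>l\<bar> < r \<longrightarrow>
        summable (\<lambda>n. l ^ n *\<^sub>R \<Omega> n) \<and>
        evolution_op (\<lambda>t. l *\<^sub>R K t) T = exp (\<Sum>n. l ^ n *\<^sub>R \<Omega> n))"

definition magnus_term ::
    "(real \<Rightarrow> 'a::complex_hilbert bop) \<Rightarrow> real \<Rightarrow> nat \<Rightarrow> 'a bop" where
  "magnus_term K T = (THE \<Omega>. magnus_coeffs K T \<Omega>)"

definition magnus_sum :: "(real \<Rightarrow> 'a::complex_hilbert bop) \<Rightarrow> real \<Rightarrow> 'a bop" where
  "magnus_sum K T = (\<Sum>n. magnus_term K T n)"

text \<open>A pulse sequence lists its elementary operations in temporal order.\<close>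

datatype ('n::finite) seq_op = Idle real | Pulse "complex ^ 'n ^ 'n"

primrec op_time :: "'n::finite seq_op \<Rightarrow> real" where
  "op_time (Idle t) = t"
| "op_time (Pulse U) = 0"

primrec cdd_seq ::
    "(nat \<Rightarrow> complex ^ 'n ^ 'n) \<Rightarrow> nat \<Rightarrow> real \<Rightarrow> nat \<Rightarrow> 'n seq_op list" where
  "cdd_seq P R \<tau> 0 = [Idle \<tau>]"
| "cdd_seq P R \<tau> (Suc k) = concat (map (\<lambda>j. cdd_seq P R \<tau> k @ [Pulse (P j)]) [1..<Suc R])"

definition cdd_time :: "(nat \<Rightarrow> complex ^ 'n ^ 'n) \<Rightarrow> nat \<Rightarrow> real \<Rightarrow> nat \<Rightarrow> real" where
  "cdd_time P R \<tau> k = sum_list (map op_time (cdd_seq P R \<tau> k))"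

lemma cdd_time_eq: "cdd_time P R \<tau> k = real R ^ k * \<tau>"
proof (induction k)
  case (Suc k)
  have "sum_list (map op_time (concat (map (\<lambda>j. cdd_seq P R \<tau> k @ [Pulse (P j)]) js)))
      = real (length js) * cdd_time P R \<tau> k" for js
    by (induction js) (simp_all add: cdd_time_def algebra_simps)
  from this[of "[1..<Suc R]"] show ?case
    using Suc by (simp add: cdd_time_def del: upt_Suc)
qed (simp add: cdd_time_def)

primrec Q_op :: "(nat \<Rightarrow> complex ^ 'n ^ 'n) \<Rightarrow> nat \<Rightarrow> complex ^ 'n ^ 'n" where
  "Q_op P 0 = mat 1"
| "Q_op P (Suc j) = P (Suc j) ** Q_op P j"

text \<open>Equals \<open>Q\<^sub>j\<^sup>\<dagger> G Q\<^sub>j\<close> for \<open>t\<close> in \<open>[j T, (j+1) T)\<close>.\<close>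

definition toggling ::
    "(nat \<Rightarrow> complex ^ 'n ^ 'n) \<Rightarrow> real \<Rightarrow> ('b::complex_hilbert ^ 'n) bop \<Rightarrow> real \<Rightarrow> ('b ^ 'n) bop"
  where
  "toggling P T G t = (let j = nat \<lfloor>t / T\<rfloor> in
     (adj (Q_op P j) \<otimes>\<^sub>o 1) * G * (Q_op P j \<otimes>\<^sub>o 1))"

text \<open>\<open>\<i> / T *\<^sub>C \<Omega>\<close> solves \<open>\<Omega> = -\<i> T H\<close> for \<open>H\<close>.\<close>

primrec H_eff ::
    "(nat \<Rightarrow> complex ^ 'n ^ 'n) \<Rightarrow> nat \<Rightarrow> real \<Rightarrow> ('b::complex_hilbert ^ 'n) bop \<Rightarrow> nat \<Rightarrow> ('b ^ 'n) bop"
  where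
  "H_eff P R \<tau> H 0 = H"
| "H_eff P R \<tau> H (Suc k) = (\<i> / complex_of_real (cdd_time P R \<tau> (Suc k))) *\<^sub>C
     magnus_sum (toggling P (cdd_time P R \<tau> k) (H_eff P R \<tau> H k)) (cdd_time P R \<tau> (Suc k))"

definition cyclic :: "(nat \<Rightarrow> complex ^ 'n ^ 'n) \<Rightarrow> nat \<Rightarrow> bool" where
  "cyclic P R \<longleftrightarrow> (\<exists>c. cmod c = 1 \<and> Q_op P R = c *\<^sub>C mat 1)"

definition first_order_decoupling ::
    "(nat \<Rightarrow> complex ^ 'n ^ 'n) \<Rightarrow> nat \<Rightarrow> ('a \<Rightarrow> complex ^ 'n ^ 'n) \<Rightarrow> 'a set \<Rightarrow> bool" where
  "first_order_decoupling P R S A \<longleftrightarrow>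
     (\<forall>\<alpha>\<in>A. (\<Sum>j<R. adj (Q_op P j) ** S \<alpha> ** Q_op P j) = 0)"

end

theory Submission
  imports Defs "HOL-Computational_Algebra.Formal_Power_Series"
begin

text \<open>Let \<open>1 + X(t)\<close> be the evolution generated by \<open>\<lambda> A(t)\<close>.  Then
  \<open>log (1 + X) = \<integral>\<^sub>0\<^sup>1 Y\<^sub>s ds\<close> with \<open>Y\<^sub>s = X (1 + s X)\<^sup>-\<^sup>1\<close>, and \<open>Y\<^sub>s\<close> solves the Riccati equation
  \<open>Y' = \<lambda> (1 - s Y) A (1 + (1 - s) Y)\<close>.  Since \<open>s (1 - s) \<le> 1/4\<close>, its \<open>\<lambda>\<close>-coefficients are dominated
  by those of \<open>k / (1 - k/2)\<close>, \<open>k = \<lambda> e t\<close> for \<open>\<parallel>A\<parallel> \<le> e\<close>, so that the Magnus series of a generator converges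
  for \<open>e T < 2\<close>.  Comparing \<open>A = B + E\<close> with the constant generator \<open>B\<close>, whose Magnus terms of order
  \<open>n \<ge> 2\<close> vanish, bounds the terms of order \<open>n \<ge> 4\<close> linearly in \<open>\<parallel>E\<parallel>\<close>, with room to spare.
  The terms of order 2 and 3 are computed explicitly.  They are expressed through \<open>F = \<integral> E\<close>, which
  vanishes at both ends by first-order decoupling; this gives the constants \<open>1/2\<close> and \<open>2/9\<close>.

  The bath part \<open>I \<otimes> tr\<^sub>S(X)/d\<close> is a contraction, whence the factor 2 for the error part.  The pulses
  only change the signs of the \<open>S\<^sub>\<alpha>\<close>, so by orthogonality \<open>E(t) E(r)\<close> and \<open>E(r) E(t)\<close> have the same bath
  part, and the second-order term has none.\<close>

section \<open>The exponential in a Banach algebra\<close>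

text \<open>The defining identity of the Magnus terms concerns small \<lambda> only, while
  \<open>magnus_sum\<close> adds the terms at \<lambda> = 1. The two meet in the coefficients: for
  |\<lambda>| e T \<le> 1/2 the series is a logarithm of the evolution, uniqueness of such series
  identifies its coefficients, and the norm bound for each coefficient then gives convergence at
  \<lambda> = 1. The majorant y = k / (1 - k/2) is the solution of y' = (1 + y/2)^2 with y(0) = 0,
  and (1 + y/2)^2 dominates (1 + s y) (1 + (1 - s) y) for every s in [0, 1]. One bound thus serves
  all s and survives the integral over s; no nested commutators have to be counted. The resulting
  estimate at order n is n J T (x/2)^(n - 1) with x = e T. At orders 2 and 3 it would give the
  coefficients 1 and 3/4 where 1/2 and 2/9 are wanted, because it ignores that the error averages to
  zero; this is why those two orders need their explicit form.\<close>

lemma norm_mult_mono: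
  fixes x y :: "'a::real_normed_algebra"
  assumes "norm x \<le> u" "norm y \<le> v"
  shows "norm (x * y) \<le> u * v"
proof -
  have "0 \<le> u" using assms(1) norm_ge_zero[of x] by linarith
  then show ?thesis using assms by (intro order_trans[OF norm_mult_ineq] mult_mono) auto
qed

lemma has_vector_derivative_const_mult:
  fixes f :: "real \<Rightarrow> 'a::real_normed_algebra"
  assumes "(f has_vector_derivative d) X"
  shows "((\<lambda>t. C * f t) has_vector_derivative C * d) X"
    and "((\<lambda>t. f t * C) has_vector_derivative d * C) X"
  using bounded_linear.has_vector_derivative[OF bounded_linear_mult_right assms]
    bounded_linear.has_vector_derivative[OF bounded_linear_mult_left assms] .

text \<open>The mean value inequality in the form used throughout: generators jump at the pulse
  times, so derivatives exist only off a finite set. A comparison function \<open>g\<close> in place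
  of a constant turns each bound on a derivative into a polynomial bound by one integration.\<close>

lemma norm_diff_le_if_derivative_le:
  fixes f :: "real \<Rightarrow> 'a::banach" and g :: "real \<Rightarrow> real"
  assumes "u \<le> v" "finite S" "continuous_on {u..v} f" "continuous_on {u..v} g"
    and f: "\<And>x. x \<in> {u<..<v} - S \<Longrightarrow> (f has_vector_derivative f' x) (at x)"
    and g: "\<And>x. x \<in> {u<..<v} - S \<Longrightarrow> (g has_real_derivative g' x) (at x)"
    and le: "\<And>x. x \<in> {u<..<v} - S \<Longrightarrow> norm (f' x) \<le> g' x"
  shows "norm (f v - f u) \<le> g v - g u"
proof -
  \<comment> \<open>Nothing is known about the derivatives at the endpoints either. Both are
    replaced by 0 on \<open>?S\<close>, so that the pointwise inequality holds on the whole closed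
    interval.\<close>
  let ?S = "insert u (insert v S)"
  have "(f' has_integral (f v - f u)) {u..v}"
    by (rule fundamental_theorem_of_calculus_interior_strong[of S])
      (use assms in \<open>auto\<close>)
  then have f': "((\<lambda>x. if x \<in> ?S then 0 else f' x) has_integral (f v - f u)) {u..v}"
    by (rule has_integral_spike_finite[rotated 2, of _ _ _ ?S]) (use assms in auto)
  have "(g' has_integral (g v - g u)) {u..v}"
    by (rule fundamental_theorem_of_calculus_interior_strong[of S])
      (use assms in \<open>auto simp: has_real_derivative_iff_has_vector_derivative\<close>)
  then have g': "((\<lambda>x. if x \<in> ?S then 0 else g' x) has_integral (g v - g u)) {u..v}"
    by (rule has_integral_spike_finite[rotated 2, of _ _ _ ?S]) (use assms in auto)
  have "norm (integral {u..v} (\<lambda>x. if x \<in> ?S then 0 else f' x))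
      \<le> integral {u..v} (\<lambda>x. if x \<in> ?S then 0 else g' x)"
    by (rule integral_norm_bound_integral)
      (use f' g' le in \<open>auto simp: integrable_on_def\<close>)
  then show ?thesis using f' g' by (simp add: integral_unique)
qed

lemma eq_if_derivative_eq:
  fixes f :: "real \<Rightarrow> 'a::banach"
  assumes "u \<le> v" "finite S" "continuous_on {u..v} f" "continuous_on {u..v} g"
    and "\<And>x. x \<in> {u<..<v} - S \<Longrightarrow> (f has_vector_derivative h x) (at x)"
    and "\<And>x. x \<in> {u<..<v} - S \<Longrightarrow> (g has_vector_derivative h x) (at x)"
    and "f u = g u"
  shows "f v = g v"
proof -
  have "norm ((\<lambda>x. f x - g x) v - (\<lambda>x. f x - g x) u) \<le> (\<lambda>_. 0) v - (\<lambda>_. 0) u"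
  proof (rule norm_diff_le_if_derivative_le[where S = S and f' = "\<lambda>_. 0" and g' = "\<lambda>_. 0"])
    show "((\<lambda>x. f x - g x) has_vector_derivative 0) (at x)" if "x \<in> {u<..<v} - S" for x
      using has_vector_derivative_diff[OF assms(5)[OF that] assms(6)[OF that]] by simp
  qed (use assms in \<open>auto intro: continuous_on_diff\<close>)
  then show ?thesis using assms(7) by simp
qed

text \<open>The tail of the series is geometric because (n + 2)! \<ge> 2^(n + 1). A quadratic
  remainder is all that the derivative of \<open>exp\<close> at 0 needs.\<close>

lemma exp_first_order_bound:
  fixes x :: "'a::{real_normed_algebra_1,banach}"
  assumes "norm x \<le> 1"
  shows "norm (exp x - 1 - x) \<le> (norm x)\<^sup>2"
proof -
  have "exp x = (\<Sum>n. inverse (fact (n+2)) *\<^sub>R x ^ (n+2)) + (\<Sum>i<2. inverse (fact i) *\<^sub>R x ^ i)"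
    unfolding exp_def by (rule suminf_split_initial_segment[OF summable_exp_generic])
  then have "exp x - 1 - x = (\<Sum>n. inverse (fact (n+2)) *\<^sub>R x ^ (n+2))"
    by (simp add: eval_nat_numeral)
  moreover have "norm (\<Sum>n. inverse (fact (n+2)) *\<^sub>R x ^ (n+2)) \<le> (\<Sum>n. (norm x)\<^sup>2 * (1/2)^(Suc n))"
  proof (rule norm_suminf_le)
    fix n
    have "norm (inverse (fact (n+2)) *\<^sub>R x ^ (n+2)) \<le> inverse (fact (n+2)) * norm x ^ (n+2)"
      using norm_power_ineq[of x "n+2"] by (simp add: mult_left_mono del: power_Suc power_Suc2)
    also have "\<dots> \<le> inverse (2 ^ Suc n) * norm x ^ (n+2)"
    proof -
      have "(2::real) ^ Suc n \<le> fact (n+2)"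
      proof (induction n)
        case (Suc n)
        have "(2::real) * 2 ^ Suc n \<le> real (n+3) * fact (n+2)"
          using Suc by (intro mult_mono) auto
        also have "\<dots> = fact (Suc n + 2)"
          by (simp only: add_Suc add_2_eq_Suc' fact_Suc eval_nat_numeral) simp
        finally show ?case by (simp only: power_Suc)
      qed simp
      then show ?thesis by (intro mult_right_mono le_imp_inverse_le) auto
    qed
    also have "\<dots> \<le> inverse (2 ^ Suc n) * norm x ^ 2"
      using assms by (intro mult_left_mono power_decreasing) auto
    finally show "norm (inverse (fact (n+2)) *\<^sub>R x ^ (n+2)) \<le> (norm x)\<^sup>2 * (1/2)^(Suc n)"
      by (simp add: field_simps power_one_over)
  qed (intro summable_mult, use summable_geometric[of "1/2::real"] in \<open>simp only: summable_Suc_iff\<close>, simp)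
  moreover have "(\<Sum>n. (norm x)\<^sup>2 * (1/2)^(Suc n)) = (norm x)\<^sup>2"
    using sums_unique[OF sums_mult[OF power_half_series, of "(norm x)\<^sup>2"]] by simp
  ultimately show ?thesis by simp
qed

lemma exp_has_derivative_zero:
  "(exp has_derivative (\<lambda>h. h)) (at (0::'a::{real_normed_algebra_1,banach}))"
proof -
  have "((\<lambda>h. norm (exp h - 1 - h) / norm h) \<longlongrightarrow> 0) (at (0::'a))"
  proof (rule Lim_null_comparison)
    show "\<forall>\<^sub>F h in at (0::'a). norm (norm (exp h - 1 - h) / norm h) \<le> norm h"
      unfolding eventually_at
    proof (intro exI[of _ 1] conjI ballI impI)
      fix h :: 'a assume "h \<noteq> 0 \<and> dist h 0 < 1"
      then show "norm (norm (exp h - 1 - h) / norm h) \<le> norm h"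
        using exp_first_order_bound[of h] by (simp add: field_simps power2_eq_square)
    qed simp
  qed (intro tendsto_eq_intros refl; simp)
  then show ?thesis by (simp add: has_derivative_at)
qed

text \<open>Without commutativity the chain rule fails for \<open>exp\<close>. If \<open>f x\<close>
  commutes with the values of \<open>f\<close> on \<open>U\<close>, then exp (f y) = exp (f x) exp
  (f y - f x), and only the derivative of \<open>exp\<close> at 0 is needed.\<close>

lemma commuting_exp_has_vector_derivative:
  fixes f :: "real \<Rightarrow> 'a::{real_normed_algebra_1,banach}"
  assumes f: "(f has_vector_derivative d) (at x within U)"
    and x: "x \<in> U" and comm: "\<And>y. y \<in> U \<Longrightarrow> f x * f y = f y * f x"
  shows "((\<lambda>y. exp (f y)) has_vector_derivative exp (f x) * d) (at x within U)"
proof -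
  have g: "((\<lambda>y. f y - f x) has_derivative (\<lambda>h. h *\<^sub>R d)) (at x within U)"
    using f unfolding has_vector_derivative_def
    by (auto intro: derivative_eq_intros)
  have "((\<lambda>y. exp (f y - f x)) has_derivative (\<lambda>h. h *\<^sub>R d)) (at x within U)"
    using has_derivative_compose[OF g, of exp "\<lambda>h. h"] exp_has_derivative_zero by simp
  from has_derivative_mult_right[OF this, of "exp (f x)"]
  have "((\<lambda>y. exp (f x) * exp (f y - f x)) has_vector_derivative exp (f x) * d) (at x within U)"
    by (simp add: has_vector_derivative_def)
  moreover have "exp (f x) * exp (f y - f x) = exp (f y)" if "y = x \<or> y \<in> U" for y
  proof -
    have "f x * (f y - f x) = (f y - f x) * f x" using comm that by (auto simp: algebra_simps)
    from exp_add_commuting[OF this] show ?thesis by simp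
  qed
  ultimately show ?thesis
    unfolding has_vector_derivative_def
    by (rule has_derivative_transform_within[OF _ zero_less_one x]) simp
qed

text \<open>\<open>Z s\<close> plays the role of \<open>X (1 + s X)\<^sup>-\<^sup>1\<close>, the \<open>s\<close>-derivative of \<open>log (1 + s X)\<close>.\<close>

lemma exp_integral_resolvent:
  fixes X :: "'a::{real_normed_algebra_1,banach}"
  assumes Z: "\<And>s. s \<in> {0..1} \<Longrightarrow> Z s + s *\<^sub>R (Z s * X) = X"
    and cont: "continuous_on {0..1} Z" and X: "norm X < 1"
  shows "exp (integral {0..1} Z) = 1 + X"
proof -
  \<comment> \<open>Right multiplication by 1 + s X is injective since the norm of s X is below 1.
    This stands in for an inverse: the commutation relations below are checked after multiplying by
    1 + s X.\<close>
  have zero: "C = 0" if "C + s *\<^sub>R (C * X) = 0" "s \<in> {0..1}" for C :: 'a and s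
  proof (rule ccontr)
    assume "C \<noteq> 0"
    have "C = - (s *\<^sub>R (C * X))" using that by (simp only: add_eq_0_iff2)
    from arg_cong[OF this, of norm] have "norm C = s * norm (C * X)"
      using that by simp
    also have "\<dots> \<le> 1 * norm (C * X)" using that by (intro mult_right_mono) auto
    also have "\<dots> \<le> norm C * norm X" by (simp add: norm_mult_ineq)
    also have "\<dots> < norm C * 1" using X \<open>C \<noteq> 0\<close> by (intro mult_strict_left_mono) auto
    finally show False by simp
  qed
  have ZX: "Z s * X = X * Z s" if s: "s \<in> {0..1}" for s
  proof -
    have "(Z s * X - X * Z s) + s *\<^sub>R ((Z s * X - X * Z s) * X)
        = (Z s + s *\<^sub>R (Z s * X)) * X - X * (Z s + s *\<^sub>R (Z s * X))"
      by (simp add: algebra_simps)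
    also have "\<dots> = 0" using Z[OF s] by simp
    finally show ?thesis using zero[OF _ s] by (metis right_minus_eq)
  qed
  have ZZ: "Z s * Z r = Z r * Z s" if s: "s \<in> {0..1}" and r: "r \<in> {0..1}" for s r
  proof -
    have "(Z s * Z r - Z r * Z s) + s *\<^sub>R ((Z s * Z r - Z r * Z s) * X)
       = Z s * Z r + s *\<^sub>R (Z s * (Z r * X)) - Z r * (Z s + s *\<^sub>R (Z s * X))"
      by (simp add: algebra_simps)
    also have "\<dots> = (Z s + s *\<^sub>R (Z s * X)) * Z r - Z r * (Z s + s *\<^sub>R (Z s * X))"
      by (simp add: ZX[OF r] algebra_simps)
    also have "\<dots> = 0" using Z[OF s] ZX[OF r] by simp
    finally show ?thesis using zero[OF _ s] by (metis right_minus_eq)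
  qed
  define G where "G \<theta> = integral {0..\<theta>} Z" for \<theta>
  have int: "Z integrable_on {0..\<theta>}" if "\<theta> \<in> {0..1}" for \<theta>
    using that cont by (intro integrable_continuous_real) (auto intro: continuous_on_subset)
  have ZG: "Z s * G \<theta> = G \<theta> * Z s" if s: "s \<in> {0..1}" and t: "\<theta> \<in> {0..1}" for s \<theta>
  proof -
    have "Z s * G \<theta> = integral {0..\<theta>} (\<lambda>r. Z s * Z r)"
      unfolding G_def using integral_linear[OF int[OF t] bounded_linear_mult_right[of "Z s"]]
      by (simp add: o_def)
    also have "\<dots> = integral {0..\<theta>} (\<lambda>r. Z r * Z s)"
      by (rule integral_cong) (use s t ZZ in auto)
    also have "\<dots> = G \<theta> * Z s"
      unfolding G_def using integral_linear[OF int[OF t] bounded_linear_mult_left[of "Z s"]]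
      by (simp add: o_def)
    finally show ?thesis .
  qed
  have GG: "G \<phi> * G \<theta> = G \<theta> * G \<phi>" if s: "\<phi> \<in> {0..1}" and t: "\<theta> \<in> {0..1}" for \<phi> \<theta>
  proof -
    have "G \<phi> * G \<theta> = integral {0..\<theta>} (\<lambda>r. G \<phi> * Z r)"
      unfolding G_def[of \<theta>] using integral_linear[OF int[OF t] bounded_linear_mult_right[of "G \<phi>"]]
      by (simp add: o_def)
    also have "\<dots> = integral {0..\<theta>} (\<lambda>r. Z r * G \<phi>)"
      by (rule integral_cong) (use s t ZG in auto)
    also have "\<dots> = G \<theta> * G \<phi>"
      unfolding G_def[of \<theta>] using integral_linear[OF int[OF t] bounded_linear_mult_left[of "G \<phi>"]]
      by (simp add: o_def)
    finally show ?thesis .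
  qed
  have dG: "(G has_vector_derivative Z x) (at x within {0..1})" if "x \<in> {0..1}" for x
    unfolding G_def using integral_has_vector_derivative[OF cont that] .
  \<comment> \<open>Here \<open>G\<close> is the candidate logarithm. The derivative of exp (- G x)
    (1 + x X) is exp (- G x) times the defect of the equation for \<open>Z\<close>, hence 0, and the
    value at 0 is 1.\<close>
  have "\<exists>c. \<forall>x\<in>{0..1}. exp (- G x) * (1 + x *\<^sub>R X) = c"
  proof (rule has_derivative_zero_constant)
    fix x :: real assume x: "x \<in> {0..1}"
    have "((\<lambda>y. exp (- G y)) has_vector_derivative exp (- G x) * (- Z x)) (at x within {0..1})"
      by (rule commuting_exp_has_vector_derivative)
        (use dG x GG in \<open>auto intro!: derivative_eq_intros\<close>)
    moreover have "((\<lambda>y. 1 + y *\<^sub>R X) has_vector_derivative X) (at x within {0..1})"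
      by (auto intro!: derivative_eq_intros)
    ultimately have "((\<lambda>x. exp (- G x) * (1 + x *\<^sub>R X)) has_vector_derivative
        exp (- G x) * X + exp (- G x) * (- Z x) * (1 + x *\<^sub>R X)) (at x within {0..1})"
      by (rule has_vector_derivative_mult)
    moreover have "exp (- G x) * X + exp (- G x) * (- Z x) * (1 + x *\<^sub>R X)
       = exp (- G x) * (X - (Z x + x *\<^sub>R (Z x * X)))" by (simp add: algebra_simps)
    ultimately show "((\<lambda>x. exp (- G x) * (1 + x *\<^sub>R X)) has_derivative (\<lambda>h. 0)) (at x within {0..1})"
      using Z[OF x] by (simp add: has_vector_derivative_def)
  qed simp
  then obtain c where c: "\<And>x. x \<in> {0..1} \<Longrightarrow> exp (- G x) * (1 + x *\<^sub>R X) = c" by blast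
  have "exp (- G 1) * (1 + 1 *\<^sub>R X) = exp (- G 0) * (1 + 0 *\<^sub>R X)"
    using c[of 0] c[of 1] by simp
  then have "exp (- G 1) * (1 + X) = 1" by (simp add: G_def)
  then have "exp (G 1) * (exp (- G 1) * (1 + X)) = exp (G 1)" by simp
  then show ?thesis
    using exp_minus_inverse[of "G 1"] by (simp add: G_def mult.assoc[symmetric])
qed

lemma norm_power_diff_le:
  fixes x y :: "'a::real_normed_algebra_1"
  assumes "norm x \<le> \<rho>" "norm y \<le> \<rho>"
  shows "norm (x ^ n - y ^ n) \<le> n * \<rho> ^ (n - 1) * norm (x - y)"
proof (induction n)
  case (Suc n)
  have \<rho>: "0 \<le> \<rho>" using assms norm_ge_zero order_trans by blast
  have "x ^ Suc n - y ^ Suc n = x * (x ^ n - y ^ n) + (x - y) * y ^ n" by (simp add: algebra_simps)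
  also have "norm \<dots> \<le> norm x * norm (x ^ n - y ^ n) + norm (x - y) * norm (y ^ n)"
    by (intro norm_triangle_le add_mono norm_mult_ineq)
  also have "\<dots> \<le> \<rho> * (n * \<rho> ^ (n - 1) * norm (x - y)) + norm (x - y) * \<rho> ^ n"
    using assms \<rho> by (intro add_mono mult_mono Suc order_trans[OF norm_power_ineq] power_mono) auto
  also have "\<dots> = Suc n * \<rho> ^ (Suc n - 1) * norm (x - y)"
    by (cases n) (auto simp: algebra_simps)
  finally show ?case .
qed simp

text \<open>On the ball of radius 1/4 the map exp z - 1 - z has Lipschitz constant at most the sum
  of (1/4)^(n + 1), which is 1/3. The linear part z therefore keeps distinct points apart.\<close>

lemma exp_inj_near_zero:
  fixes x y :: "'a::{real_normed_algebra_1,banach}"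
  assumes "norm x \<le> 1/4" "norm y \<le> 1/4" "exp x = exp y"
  shows "x = y"
proof (rule ccontr)
  assume ne: "x \<noteq> y"
  have split: "exp z = (\<Sum>n. inverse (fact (n+2)) *\<^sub>R z ^ (n+2)) + (1 + z)" for z :: 'a
    using suminf_split_initial_segment[OF summable_exp_generic, of z 2]
    by (simp add: exp_def eval_nat_numeral)
  have sum: "summable (\<lambda>n. inverse (fact (n+2)) *\<^sub>R z ^ (n+2))" for z :: 'a
    using summable_exp_generic[of z] by (rule summable_ignore_initial_segment)
  have "y - x = (\<Sum>n. inverse (fact (n+2)) *\<^sub>R x ^ (n+2)) - (\<Sum>n. inverse (fact (n+2)) *\<^sub>R y ^ (n+2))"
    using split[of x] split[of y] assms(3) by (simp add: algebra_simps)
  also have "\<dots> = (\<Sum>n. inverse (fact (n+2)) *\<^sub>R (x ^ (n+2) - y ^ (n+2)))"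
    by (subst suminf_diff[OF sum sum]) (simp add: scaleR_diff_right)
  also have "norm \<dots> \<le> (\<Sum>n. norm (x - y) * (1/4) * (1/4)^n)"
  proof (rule norm_suminf_le)
    fix n
    have "norm (inverse (fact (n+2)) *\<^sub>R (x ^ (n+2) - y ^ (n+2)))
        \<le> inverse (fact (n+2)) * ((n+2) * (1/4) ^ (n+1) * norm (x - y))"
      unfolding norm_scaleR using norm_power_diff_le[OF assms(1,2), of "n+2"]
      by (intro mult_mono) (auto simp del: power_Suc simp: add.commute)
    also have "\<dots> = (inverse (fact (n+2)) * (n+2)) * ((1/4) ^ (n+1) * norm (x - y))"
      by (simp add: mult.assoc add.commute del: power_Suc fact_Suc)
    also have "inverse (fact (n+2)) * (real (n+2)) = inverse (fact (n+1))"
    proof -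
      have "fact (n+2) = real (n+2) * fact (n+1)" by simp
      then show ?thesis by (simp only: inverse_mult_distrib) simp
    qed
    also have "inverse (fact (n+1)) * ((1/4) ^ (n+1) * norm (x - y)) \<le> 1 * ((1/4) ^ (n+1) * norm (x - y))"
      using fact_ge_1[of "n+1", where 'a = real]
      by (intro mult_right_mono) (auto simp: inverse_le_1_iff simp del: fact_Suc)
    finally show "norm (inverse (fact (n+2)) *\<^sub>R (x ^ (n+2) - y ^ (n+2)))
        \<le> norm (x - y) * (1/4) * (1/4)^n" by (simp add: mult_ac)
  qed (simp add: summable_geometric)
  also have "\<dots> = norm (x - y) * (1/4) * (4/3)"
    by (subst suminf_mult) (simp_all add: summable_geometric suminf_geometric)
  also have "\<dots> < norm (x - y)" using ne by simp
  finally show False by (simp add: norm_minus_commute)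
qed

section \<open>The Riccati coefficients of an evolution\<close>

text \<open>At radius \<rho> the terms are bounded, so on half the radius they decay like 2^(-n);
  taking out |l|^m leaves a convergent geometric series.\<close>

lemma powser_bound_of_order:
  fixes a :: "nat \<Rightarrow> 'a::banach"
  assumes "\<rho> > 0" "summable (\<lambda>n. \<rho> ^ n *\<^sub>R a n)" "\<And>i. i < m \<Longrightarrow> a i = 0"
  obtains M where "\<And>l. \<bar>l\<bar> \<le> \<rho> / 2 \<Longrightarrow> norm (\<Sum>n. l ^ n *\<^sub>R a n) \<le> M * \<bar>l\<bar> ^ m"
proof -
  from summable_imp_Bseq[OF assms(2)] obtain M where M: "M > 0" "\<And>n. norm (\<rho> ^ n *\<^sub>R a n) \<le> M"
    by (auto simp: Bseq_def)
  have "norm (\<Sum>n. l ^ n *\<^sub>R a n) \<le> (2 ^ Suc m * M / \<rho> ^ m) * \<bar>l\<bar> ^ m" if l: "\<bar>l\<bar> \<le> \<rho> / 2" for l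
  proof -
    have "norm (\<Sum>n. l ^ n *\<^sub>R a n) \<le> (\<Sum>n. ((\<bar>l\<bar> / \<rho>) ^ m * 2 ^ m * M) * (1/2) ^ n)"
    proof (rule norm_suminf_le)
      fix n
      show "norm (l ^ n *\<^sub>R a n) \<le> (\<bar>l\<bar> / \<rho>) ^ m * 2 ^ m * M * (1/2) ^ n"
      proof (cases "n < m")
        case False
        then have n: "n = m + (n - m)" by simp
        have "norm (l ^ n *\<^sub>R a n) = (\<bar>l\<bar> / \<rho>) ^ n * norm (\<rho> ^ n *\<^sub>R a n)"
          using assms(1) by (simp add: power_divide power_abs)
        also have "\<dots> \<le> (\<bar>l\<bar> / \<rho>) ^ n * M"
          using M assms(1) by (intro mult_left_mono) auto
        also have "(\<bar>l\<bar> / \<rho>) ^ n = (\<bar>l\<bar> / \<rho>) ^ m * (\<bar>l\<bar> / \<rho>) ^ (n - m)"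
          by (subst n) (simp only: power_add)
        also have "\<dots> * M \<le> (\<bar>l\<bar> / \<rho>) ^ m * (1/2) ^ (n - m) * M"
          using l assms(1) M by (intro mult_right_mono mult_left_mono power_mono) (auto simp: field_simps)
        also have "(1/2::real) ^ (n - m) = 2 ^ m * (1/2) ^ n"
          using False by (simp add: power_diff power_one_over)
        finally show ?thesis by (simp add: mult_ac)
      qed (use assms M in auto)
    qed (intro summable_mult summable_geometric, simp)
    also have "\<dots> = (2 ^ Suc m * M / \<rho> ^ m) * \<bar>l\<bar> ^ m"
      by (subst suminf_mult) (simp_all add: summable_geometric suminf_geometric power_divide)
    finally show ?thesis .
  qed
  then show thesis using that by blast
qed

text \<open>The identity theorem on a real interval. Once all lower coefficients vanish, l^m
  \<open>a m\<close> is minus a series of order m + 1, so the norm of \<open>a m\<close> is at most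
  M l for all small l > 0.\<close>

lemma powser_coeffs_eq_0:
  fixes a :: "nat \<Rightarrow> 'a::banach"
  assumes "r > 0" "\<And>l. \<bar>l\<bar> < r \<Longrightarrow> (\<lambda>n. l ^ n *\<^sub>R a n) sums 0"
  shows "a m = 0"
proof (induction m rule: less_induct)
  case (less m)
  define b where "b = a(m := 0)"
  have b: "(\<lambda>n. l ^ n *\<^sub>R b n) sums (- (l ^ m *\<^sub>R a m))" if "\<bar>l\<bar> < r" for l
  proof -
    have "(\<lambda>n. l ^ n *\<^sub>R a n - (if n = m then l ^ m *\<^sub>R a m else 0)) sums (0 - l ^ m *\<^sub>R a m)"
      using that assms(2) by (intro sums_diff sums_If_finite_set[of "{m}", simplified]) auto
    moreover have "(\<lambda>n. l ^ n *\<^sub>R a n - (if n = m then l ^ m *\<^sub>R a m else 0)) = (\<lambda>n. l ^ n *\<^sub>R b n)"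
      by (auto simp: b_def)
    ultimately show ?thesis by simp
  qed
  have "summable (\<lambda>n. (r/2) ^ n *\<^sub>R b n)"
    using b[of "r/2"] assms(1) by (simp add: sums_iff)
  moreover have "b i = 0" if "i < Suc m" for i
    using that less by (auto simp: b_def less_Suc_eq)
  ultimately obtain M where
    M: "\<And>l. \<bar>l\<bar> \<le> r/2/2 \<Longrightarrow> norm (\<Sum>n. l ^ n *\<^sub>R b n) \<le> M * \<bar>l\<bar> ^ Suc m"
    using powser_bound_of_order[of "r/2" b "Suc m"] assms(1) by auto
  have le: "norm (a m) \<le> M * l" if l: "0 < l" "l \<le> r/4" for l
  proof -
    have "l ^ m * norm (a m) = norm (\<Sum>n. l ^ n *\<^sub>R b n)"
      using b[of l] l assms(1) by (simp add: sums_iff)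
    also have "\<dots> \<le> M * l ^ Suc m" using M[of l] l by simp
    finally have "l ^ m * norm (a m) \<le> l ^ m * (M * l)" by (simp add: mult_ac)
    then show ?thesis using l by (simp add: mult_le_cancel_left_pos)
  qed
  have "norm (a m) \<le> 0"
  proof (rule tendsto_lowerbound)
    show "((\<lambda>l. M * l) \<longlongrightarrow> 0) (at_right (0::real))" by (intro tendsto_eq_intros) auto
    show "\<forall>\<^sub>F l in at_right 0. norm (a m) \<le> M * l"
      unfolding eventually_at_right_field using le assms(1) by (intro exI[of _ "r/4"]) auto
  qed simp
  then show ?case by simp
qed

text \<open>The coefficients of \<open>\<lambda>\<^sup>n\<close> in \<open>Y = X (1 + s X)\<^sup>-\<^sup>1\<close> with \<open>1 + X\<close> the evolution generated by
  \<open>\<lambda> A\<close>; they come from the Riccati equation \<open>Y' = (1 - s Y) A (1 + (1 - s) Y)\<close>.  For \<open>s = 0\<close>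
  they are the Dyson coefficients.\<close>

fun riccati :: "(real \<Rightarrow> 'a::{real_normed_algebra_1,banach}) \<Rightarrow> real \<Rightarrow> nat \<Rightarrow> real \<Rightarrow> 'a" where
  "riccati A s 0 = (\<lambda>t. 0)"
| "riccati A s (Suc n) = (\<lambda>t. \<Sum>i\<le>n. integral {0..t} (\<lambda>r.
     ((if i = 0 then 1 else 0) - s *\<^sub>R riccati A s i r) * A r
       * ((if n - i = 0 then 1 else 0) + (1 - s) *\<^sub>R riccati A s (n - i) r)))"

definition left_factor where "left_factor A s i t = (if i = 0 then 1 else 0) - s *\<^sub>R riccati A s i t"
definition right_factor where "right_factor A s i t = (if i = 0 then 1 else 0) + (1 - s) *\<^sub>R riccati A s i t"

text \<open>The index is shifted: this is the time derivative of the coefficient of order n + 1,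
  because the generator supplies one power of \<lambda>.\<close>

definition riccati_deriv where "riccati_deriv A s n t = (\<Sum>i\<le>n. left_factor A s i t * A t * right_factor A s (n - i) t)"

definition dyson where "dyson A n t = (if n = 0 then 1 else 0) + riccati A 0 n t"

text \<open>The integral formula for log (1 + X), read off coefficient by coefficient; by
  \<open>magnus_term_eq_log_coeff\<close> these are the Magnus terms.\<close>

definition log_coeff where "log_coeff A T n = integral {0..1} (\<lambda>s. riccati A s n T)"

lemma riccati_Suc: "riccati A s (Suc n) t
   = (\<Sum>i\<le>n. integral {0..t} (\<lambda>r. left_factor A s i r * A r * right_factor A s (n - i) r))"
  by (simp add: left_factor_def right_factor_def)

lemma riccati_at_0: "riccati A s n 0 = 0"
  by (cases n) simp_all

declare riccati.simps(2) [simp del]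

text \<open>One factor is exchanged at a time. The bound is again a difference of scalar products,
  so the scheme in which majorants dominate norms and their differences dominate differences is
  stable under multiplication. This carries e^n - b^n through the induction.\<close>

lemma triple_product_diff_le:
  fixes a b c a' b' c' :: "'a::real_normed_algebra"
  assumes "norm a' \<le> \<alpha>'" "norm (a - a') \<le> \<alpha> - \<alpha>'" "norm b' \<le> \<beta>'" "norm (b - b') \<le> \<beta> - \<beta>'"
    "norm c' \<le> \<gamma>'" "norm (c - c') \<le> \<gamma> - \<gamma>'"
  shows "norm (a * b * c - a' * b' * c') \<le> \<alpha> * \<beta> * \<gamma> - \<alpha>' * \<beta>' * \<gamma>'"
proof -
  have nn: "0 \<le> \<alpha>'" "0 \<le> \<beta>'" "0 \<le> \<gamma>'" "0 \<le> \<alpha> - \<alpha>'" "0 \<le> \<beta> - \<beta>'" "0 \<le> \<gamma> - \<gamma>'"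
    using assms norm_ge_zero order_trans by blast+
  have b: "norm b \<le> \<beta>" using norm_triangle_ineq[of "b - b'" b'] assms by simp
  have c: "norm c \<le> \<gamma>" using norm_triangle_ineq[of "c - c'" c'] assms by simp
  have "a * b * c - a' * b' * c' = (a - a') * b * c + a' * (b - b') * c + a' * b' * (c - c')"
    by (simp add: algebra_simps)
  also have "norm \<dots> \<le> (\<alpha> - \<alpha>') * \<beta> * \<gamma> + \<alpha>' * (\<beta> - \<beta>') * \<gamma> + \<alpha>' * \<beta>' * (\<gamma> - \<gamma>')"
    by (intro norm_triangle_le add_mono norm_mult_mono b c assms)
  also have "\<dots> = \<alpha> * \<beta> * \<gamma> - \<alpha>' * \<beta>' * \<gamma>'" by (simp add: algebra_simps)
  finally show ?thesis .
qed

text \<open>With k = e t and y = k / (1 - k/2), these are the coefficients of 1 + s y in powers of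
  k/2. The factors 1 - s Y and 1 + (1 - s) Y are measured by the parameters s and 1 - s.\<close>

definition majorant_coeff :: "real \<Rightarrow> nat \<Rightarrow> real" where
  "majorant_coeff s i = (if i = 0 then 1 else 2 * s)"

lemma majorant_coeff_bounds:
  fixes x y :: "'a::real_normed_vector"
  assumes "0 \<le> c" "0 < i" "norm x \<le> 2 * q" "norm (y - x) \<le> 2 * (p - q)"
  shows "norm (c *\<^sub>R x) \<le> majorant_coeff c i * q"
    and "norm (c *\<^sub>R y - c *\<^sub>R x) \<le> majorant_coeff c i * p - majorant_coeff c i * q"
proof -
  have "c * norm x \<le> c * (2 * q)" "c * norm (y - x) \<le> c * (2 * (p - q))"
    using assms by (auto intro: mult_left_mono)
  then show "norm (c *\<^sub>R x) \<le> majorant_coeff c i * q"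
    and "norm (c *\<^sub>R y - c *\<^sub>R x) \<le> majorant_coeff c i * p - majorant_coeff c i * q"
    using assms unfolding scaleR_diff_right[symmetric] by (simp_all add: majorant_coeff_def right_diff_distrib mult.left_commute)
qed

text \<open>n + 1 is the coefficient of (k/2)^n in (1 + y/2)^2 = 1 / (1 - k/2)^2. For n \<ge> 1 the
  two end terms add up to 2, and each of the n - 1 inner ones is 4 s (1 - s) \<le> 1.\<close>

lemma majorant_coeff_convolution_le:
  assumes "0 \<le> s" "s \<le> 1"
  shows "(\<Sum>i\<le>n. majorant_coeff s i * majorant_coeff (1 - s) (n - i)) \<le> real n + 1"
proof (cases n)
  case (Suc m)
  have s: "4 * (s * (1 - s)) \<le> 1"
    using zero_le_power2[of "2 * s - 1"] by (simp add: power2_eq_square algebra_simps)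
  have "(\<Sum>i\<le>n. majorant_coeff s i * majorant_coeff (1 - s) (n - i))
     = majorant_coeff s 0 * majorant_coeff (1 - s) n
       + (\<Sum>i\<le>m. majorant_coeff s (Suc i) * majorant_coeff (1 - s) (m - i))"
    by (simp add: Suc sum.atMost_Suc_shift del: sum.atMost_Suc)
  also have "(\<Sum>i\<le>m. majorant_coeff s (Suc i) * majorant_coeff (1 - s) (m - i))
     = 2 * s + (\<Sum>i<m. majorant_coeff s (Suc i) * majorant_coeff (1 - s) (m - i))"
    by (simp add: lessThan_Suc_atMost[symmetric] majorant_coeff_def)
  also have "(\<Sum>i<m. majorant_coeff s (Suc i) * majorant_coeff (1 - s) (m - i)) \<le> (\<Sum>i<m. 1)"
    using s by (intro sum_mono) (simp add: majorant_coeff_def algebra_simps)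
  finally show ?thesis by (simp add: Suc majorant_coeff_def)
qed (simp add: majorant_coeff_def)

text \<open>What the theory of the logarithm needs of a piecewise constant function. Integrability
  is required in the sandwich form g A h, since the Riccati equation multiplies \<open>A\<close> by
  continuous factors from both sides.\<close>

locale generator =
  fixes A :: "real \<Rightarrow> 'a::{real_normed_algebra_1,banach}" and T e :: real and S :: "real set"
  assumes T: "0 \<le> T" and finite_S: "finite S"
    and norm_A: "\<And>t. t \<in> {0..T} \<Longrightarrow> norm (A t) \<le> e"
    and cont_A: "\<And>t. t \<in> {0<..<T} - S \<Longrightarrow> isCont A t"
    and int_A: "\<And>g h. continuous_on {0..T} g \<Longrightarrow> continuous_on {0..T} h \<Longrightarrow>
       (\<lambda>t. g t * A t * h t) integrable_on {0..T}"
begin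

lemma e_nonneg: "0 \<le> e"
proof -
  have "0 \<le> norm (A 0)" by simp
  also have "\<dots> \<le> e" using T by (intro norm_A) simp
  finally show ?thesis .
qed

lemma
  assumes g: "continuous_on {0..T} g" and h: "continuous_on {0..T} h"
  shows cont_primitive: "continuous_on {0..T} (\<lambda>t. integral {0..t} (\<lambda>r. g r * A r * h r))"
    and deriv_primitive: "t \<in> {0<..<T} - S \<Longrightarrow>
      ((\<lambda>t. integral {0..t} (\<lambda>r. g r * A r * h r)) has_vector_derivative g t * A t * h t) (at t)"
proof -
  note int = int_A[OF g h]
  show "continuous_on {0..T} (\<lambda>t. integral {0..t} (\<lambda>r. g r * A r * h r))"
    by (rule indefinite_integral_continuous_1[OF int])
  assume t: "t \<in> {0<..<T} - S"
  have o: "open ({0<..<T} - S)" by (intro open_Diff finite_imp_closed finite_S) simp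
  have gh: "isCont g t" "isCont h t"
    using continuous_on_interior[OF g, of t] continuous_on_interior[OF h, of t] t by auto
  have "isCont (\<lambda>r. g r * A r * h r) t"
    by (intro continuous_intros gh cont_A t)
  then have "continuous (at t within {0..T} - S) (\<lambda>r. g r * A r * h r)"
    by (rule continuous_at_imp_continuous_at_within)
  from integral_has_vector_derivative_continuous_at[OF int _ finite_S this]
  have d: "((\<lambda>u. integral {0..u} (\<lambda>r. g r * A r * h r)) has_vector_derivative g t * A t * h t)
      (at t within {0..T} - S)" using t by auto
  have "at t within {0..T} - S = at t"
    by (rule at_within_nhd[of _ "{0<..<T} - S"]) (use t o in auto)
  with d show "((\<lambda>t. integral {0..t} (\<lambda>r. g r * A r * h r)) has_vector_derivative g t * A t * h t) (at t)"
    by simp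
qed

lemma cont_riccati: "continuous_on {0..T} (riccati A s n)"
proof (induction n rule: less_induct)
  case (less n)
  show ?case
  proof (cases n)
    case (Suc m)
    have lr: "continuous_on {0..T} (left_factor A s i)" "continuous_on {0..T} (right_factor A s i)" if "i \<le> m" for i
      using that less[of i] Suc unfolding left_factor_def[abs_def] right_factor_def[abs_def]
      by (auto intro!: continuous_intros)
    show ?thesis unfolding Suc riccati_Suc[abs_def]
      by (intro continuous_on_sum cont_primitive lr) auto
  qed simp
qed

lemma cont_left_factor: "continuous_on {0..T} (left_factor A s n)" and cont_right_factor: "continuous_on {0..T} (right_factor A s n)"
  unfolding left_factor_def[abs_def] right_factor_def[abs_def] by (intro continuous_intros cont_riccati)+

lemma cont_dyson: "continuous_on {0..T} (dyson A n)"
  unfolding dyson_def[abs_def] by (intro continuous_intros cont_riccati)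

lemma deriv_riccati_Suc:
  assumes "t \<in> {0<..<T} - S"
  shows "(riccati A s (Suc n) has_vector_derivative riccati_deriv A s n t) (at t)"
  unfolding riccati_deriv_def riccati_Suc[abs_def]
  by (intro has_vector_derivative_sum deriv_primitive cont_left_factor cont_right_factor assms)

text \<open>At s = 0 the Riccati equation is linear, X' = A (1 + X): the evolution equation
  itself.\<close>

lemma riccati_deriv_0: "riccati_deriv A 0 n t = A t * dyson A n t"
proof -
  have "riccati_deriv A 0 n t = (\<Sum>i\<le>n. if i = 0 then A t * dyson A n t else 0)"
    unfolding riccati_deriv_def by (intro sum.cong) (auto simp: left_factor_def right_factor_def dyson_def)
  then show ?thesis by simp
qed

text \<open>Both bounds run in one strong induction, since the difference of two products needs
  norms as well as differences. The scalars 2 (b t / 2)^n are the coefficients of the majorant, and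
  the choice B = A gives the plain bound \<open>norm_riccati_le\<close>.\<close>

lemma norm_riccati_diff_le:
  assumes B: "generator B T b S" and "b \<le> e"
    and AB: "\<And>t. t \<in> {0..T} \<Longrightarrow> norm (A t - B t) \<le> e - b"
    and s: "0 \<le> s" "s \<le> 1" and "t \<in> {0..T}"
  shows "norm (riccati B s n t) \<le> 2 * (b * t / 2) ^ n"
    and "norm (riccati A s n t - riccati B s n t) \<le> 2 * ((e * t / 2) ^ n - (b * t / 2) ^ n)"
proof -
  interpret B: generator B T b S by fact
  have "norm (riccati B s n t) \<le> 2 * (b * t / 2) ^ n \<and>
      norm (riccati A s n t - riccati B s n t) \<le> 2 * ((e * t / 2) ^ n - (b * t / 2) ^ n)"
    if "t \<in> {0..T}" for t
    using that
  proof (induction n arbitrary: t rule: less_induct)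
    case (less n)
    show ?case
    proof (cases n)
      case (Suc m)
      let ?l = "majorant_coeff s" and ?r = "majorant_coeff (1 - s)"
      have l: "norm (left_factor B s i t) \<le> ?l i * (b * t / 2) ^ i"
         "norm (left_factor A s i t - left_factor B s i t) \<le> ?l i * (e * t / 2) ^ i - ?l i * (b * t / 2) ^ i"
        if "i \<le> m" "t \<in> {0..T}" for i t
      proof -
        have "norm (left_factor B s i t) \<le> majorant_coeff (s) i * (b * t / 2) ^ i \<and>
          norm (left_factor A s i t - left_factor B s i t) \<le> majorant_coeff (s) i * (e * t / 2) ^ i
            - majorant_coeff (s) i * (b * t / 2) ^ i"
        \<comment> \<open>At order 0 the factor is exactly 1; the general bound 2 for the
          coefficient of Y would be useless there.\<close>
        proof (cases "i = 0")
          case True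
          then show ?thesis by (simp add: left_factor_def majorant_coeff_def)
        next
          case False
          then show ?thesis
            using majorant_coeff_bounds[of "s" i "riccati B s i t" "(b * t / 2) ^ i" "riccati A s i t" "(e * t / 2) ^ i"]
              less.IH[of i t] that Suc s by (simp add: left_factor_def norm_minus_commute)
        qed
        then show "norm (left_factor B s i t) \<le> majorant_coeff (s) i * (b * t / 2) ^ i"
          "norm (left_factor A s i t - left_factor B s i t) \<le> majorant_coeff (s) i * (e * t / 2) ^ i
            - majorant_coeff (s) i * (b * t / 2) ^ i"
          by blast+
      qed
      have r: "norm (right_factor B s i t) \<le> ?r i * (b * t / 2) ^ i"
         "norm (right_factor A s i t - right_factor B s i t) \<le> ?r i * (e * t / 2) ^ i - ?r i * (b * t / 2) ^ i"
        if "i \<le> m" "t \<in> {0..T}" for i t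
      proof -
        have "norm (right_factor B s i t) \<le> majorant_coeff (1 - s) i * (b * t / 2) ^ i \<and>
          norm (right_factor A s i t - right_factor B s i t) \<le> majorant_coeff (1 - s) i * (e * t / 2) ^ i
            - majorant_coeff (1 - s) i * (b * t / 2) ^ i"
        proof (cases "i = 0")
          case True
          then show ?thesis by (simp add: right_factor_def majorant_coeff_def)
        next
          case False
          then show ?thesis
            using majorant_coeff_bounds[of "1 - s" i "riccati B s i t" "(b * t / 2) ^ i" "riccati A s i t" "(e * t / 2) ^ i"]
              less.IH[of i t] that Suc s by (simp add: right_factor_def norm_minus_commute)
        qed
        then show "norm (right_factor B s i t) \<le> majorant_coeff (1 - s) i * (b * t / 2) ^ i"
          "norm (right_factor A s i t - right_factor B s i t) \<le> majorant_coeff (1 - s) i * (e * t / 2) ^ i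
            - majorant_coeff (1 - s) i * (b * t / 2) ^ i"
          by blast+
      qed
      have bpow: "(b * t / 2) ^ i * b * (b * t / 2) ^ (m - i) = b * (b * t / 2) ^ m"
        if "i \<le> m" for b t :: real and i
        using power_add[of "b * t / 2" i "m - i"] that by (simp add: mult_ac)
      \<comment> \<open>The number m + 1 in this convolution bound is exactly what integrating the
        power t^m cancels, so that the induction reproduces 2 (b t / 2)^(m + 1) without
        loss.\<close>
      have K: "(\<Sum>i\<le>m. ?l i * ?r (m - i)) \<le> real (Suc m)"
        using majorant_coeff_convolution_le[OF s, of m] by (simp add: add.commute)
      have powB: "norm (riccati_deriv B s m t) \<le> real (Suc m) * (b * (b * t / 2) ^ m)"
        if t: "t \<in> {0..T}" for t
      proof -
        have "norm (riccati_deriv B s m t) \<le> (\<Sum>i\<le>m. ?l i * ?r (m - i) * (b * (b * t / 2) ^ m))"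
          unfolding riccati_deriv_def
        proof (rule sum_norm_le)
          fix i assume i: "i \<in> {..m}"
          have "norm (left_factor B s i t * B t * right_factor B s (m - i) t)
              \<le> norm (left_factor B s i t) * norm (B t) * norm (right_factor B s (m - i) t)"
            by (intro order_trans[OF norm_mult_ineq] mult_right_mono norm_mult_ineq) auto
          also have "\<dots> \<le> (?l i * (b * t / 2) ^ i) * b * (?r (m - i) * (b * t / 2) ^ (m - i))"
            using i t l(1)[of i t] r(1)[of "m - i" t] B.norm_A B.e_nonneg s
            by (intro mult_mono) (auto simp: majorant_coeff_def)
          also have "\<dots> = ?l i * ?r (m - i) * ((b * t / 2) ^ i * b * (b * t / 2) ^ (m - i))"
            by (simp add: mult_ac)
          finally show "norm (left_factor B s i t * B t * right_factor B s (m - i) t)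
              \<le> ?l i * ?r (m - i) * (b * (b * t / 2) ^ m)"
            using bpow[of i b t] i by (simp only: atMost_iff)
        qed
        also have "\<dots> \<le> real (Suc m) * (b * (b * t / 2) ^ m)"
          unfolding sum_distrib_right[symmetric] using t B.e_nonneg
          by (intro mult_right_mono K) auto
        finally show ?thesis .
      qed
      have powA: "norm (riccati_deriv A s m t - riccati_deriv B s m t)
          \<le> real (Suc m) * (e * (e * t / 2) ^ m - b * (b * t / 2) ^ m)"
        if t: "t \<in> {0..T}" for t
      proof -
        have "norm (riccati_deriv A s m t - riccati_deriv B s m t)
            \<le> (\<Sum>i\<le>m. ?l i * ?r (m - i) * (e * (e * t / 2) ^ m - b * (b * t / 2) ^ m))"
          unfolding riccati_deriv_def sum_subtractf[symmetric]
        proof (rule sum_norm_le)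
          fix i assume i: "i \<in> {..m}"
          have "norm (left_factor A s i t * A t * right_factor A s (m - i) t - left_factor B s i t * B t * right_factor B s (m - i) t)
              \<le> (?l i * (e * t / 2) ^ i) * e * (?r (m - i) * (e * t / 2) ^ (m - i))
                - (?l i * (b * t / 2) ^ i) * b * (?r (m - i) * (b * t / 2) ^ (m - i))"
            using i t l[of i t] r[of "m - i" t] B.norm_A AB
            by (intro triple_product_diff_le) auto
          also have "\<dots> = ?l i * ?r (m - i) * ((e * t / 2) ^ i * e * (e * t / 2) ^ (m - i)
              - (b * t / 2) ^ i * b * (b * t / 2) ^ (m - i))"
            by (simp add: algebra_simps)
          finally show "norm (left_factor A s i t * A t * right_factor A s (m - i) t - left_factor B s i t * B t * right_factor B s (m - i) t)
              \<le> ?l i * ?r (m - i) * (e * (e * t / 2) ^ m - b * (b * t / 2) ^ m)"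
            using bpow[of i b t] bpow[of i e t] i by (simp only: atMost_iff)
        qed
        also have "\<dots> \<le> real (Suc m) * (e * (e * t / 2) ^ m - b * (b * t / 2) ^ m)"
          unfolding sum_distrib_right[symmetric] using t B.e_nonneg \<open>b \<le> e\<close>
          by (intro mult_right_mono K) (auto intro!: mult_mono power_mono)
        finally show ?thesis .
      qed
      have dpow: "((\<lambda>t. 2 * (b * t / 2) ^ Suc m) has_real_derivative
         real (Suc m) * (b * (b * x / 2) ^ m)) (at x)" for b x
        by (rule derivative_eq_intros refl | simp)+
      have "norm (riccati B s (Suc m) t - riccati B s (Suc m) 0) \<le> 2 * (b * t / 2) ^ Suc m - 2 * (b * 0 / 2) ^ Suc m"
      proof (rule norm_diff_le_if_derivative_le[OF _ finite_S])
        show "continuous_on {0..t} (riccati B s (Suc m))"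
          using B.cont_riccati by (rule continuous_on_subset) (use less.prems in auto)
        show "continuous_on {0..t} (\<lambda>t. 2 * (b * t / 2) ^ Suc m)" by (intro continuous_intros) simp_all
        fix x assume x: "x \<in> {0<..<t} - S"
        then have x': "x \<in> {0<..<T} - S" "x \<in> {0..T}" using less.prems by auto
        show "(riccati B s (Suc m) has_vector_derivative riccati_deriv B s m x) (at x)"
          by (rule B.deriv_riccati_Suc[OF x'(1)])
        show "((\<lambda>t. 2 * (b * t / 2) ^ Suc m) has_real_derivative
           real (Suc m) * (b * (b * x / 2) ^ m)) (at x)" by (rule dpow)
        show "norm (riccati_deriv B s m x) \<le> real (Suc m) * (b * (b * x / 2) ^ m)"
          by (rule powB[OF x'(2)])
      qed (use less.prems in auto)
      moreover have "norm ((\<lambda>t. riccati A s (Suc m) t - riccati B s (Suc m) t) t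
            - (\<lambda>t. riccati A s (Suc m) t - riccati B s (Suc m) t) 0)
          \<le> (2 * (e * t / 2) ^ Suc m - 2 * (b * t / 2) ^ Suc m)
            - (2 * (e * 0 / 2) ^ Suc m - 2 * (b * 0 / 2) ^ Suc m)"
      proof (rule norm_diff_le_if_derivative_le[OF _ finite_S])
        show "continuous_on {0..t} (\<lambda>t. riccati A s (Suc m) t - riccati B s (Suc m) t)"
          using continuous_on_diff[OF cont_riccati B.cont_riccati]
          by (rule continuous_on_subset) (use less.prems in auto)
        show "continuous_on {0..t} (\<lambda>t. 2 * (e * t / 2) ^ Suc m - 2 * (b * t / 2) ^ Suc m)"
          by (intro continuous_intros) simp_all
        fix x assume x: "x \<in> {0<..<t} - S"
        then have x': "x \<in> {0<..<T} - S" "x \<in> {0..T}" using less.prems by auto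
        show "((\<lambda>t. riccati A s (Suc m) t - riccati B s (Suc m) t)
            has_vector_derivative riccati_deriv A s m x - riccati_deriv B s m x) (at x)"
          by (intro has_vector_derivative_diff B.deriv_riccati_Suc deriv_riccati_Suc x')
        show "((\<lambda>t. 2 * (e * t / 2) ^ Suc m - 2 * (b * t / 2) ^ Suc m) has_real_derivative
           real (Suc m) * (e * (e * x / 2) ^ m) - real (Suc m) * (b * (b * x / 2) ^ m)) (at x)"
          by (intro DERIV_diff dpow)
        show "norm (riccati_deriv A s m x - riccati_deriv B s m x)
            \<le> real (Suc m) * (e * (e * x / 2) ^ m) - real (Suc m) * (b * (b * x / 2) ^ m)"
          using powA[OF x'(2)] by (simp only: right_diff_distrib)
      qed (use less.prems in auto)
      ultimately show ?thesis by (simp add: riccati_at_0 Suc algebra_simps)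
    qed simp
  qed
  with assms show "norm (riccati B s n t) \<le> 2 * (b * t / 2) ^ n"
    and "norm (riccati A s n t - riccati B s n t) \<le> 2 * ((e * t / 2) ^ n - (b * t / 2) ^ n)" by auto
qed

lemma norm_riccati_le:
  assumes "0 \<le> s" "s \<le> 1" "t \<in> {0..T}"
  shows "norm (riccati A s n t) \<le> 2 * (e * t / 2) ^ n"
  using norm_riccati_diff_le(1)[OF generator_axioms, of s t n] assms by simp

end

section \<open>Termwise integration and regularity in the parameter \<open>s\<close>\<close>

lemma uniform_limit_sums_integral:
  fixes f :: "nat \<Rightarrow> real \<Rightarrow> 'a::banach"
  assumes "\<And>n x. x \<in> {a..b} \<Longrightarrow> norm (f n x) \<le> M n" "summable M"
    and "\<And>n. continuous_on {a..b} (f n)"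
  shows "(\<lambda>n. integral {a..b} (f n)) sums integral {a..b} (\<lambda>x. \<Sum>n. f n x)"
    and "continuous_on {a..b} (\<lambda>x. \<Sum>n. f n x)"
proof -
  have u: "uniform_limit {a..b} (\<lambda>n x. \<Sum>i<n. f i x) (\<lambda>x. \<Sum>n. f n x) sequentially"
    by (rule Weierstrass_m_test) (use assms in auto)
  have c: "continuous_on {a..b} (\<lambda>x. \<Sum>i<n. f i x)" for n
    by (intro continuous_on_sum assms)
  obtain I K where I: "\<And>n. ((\<lambda>x. \<Sum>i<n. f i x) has_integral I n) {a..b}"
    and K: "((\<lambda>x. \<Sum>n. f n x) has_integral K) {a..b}" and lim: "I \<longlonglongrightarrow> K"
    using uniform_limit_integral[OF u c] by auto
  have I_eq: "I = (\<lambda>n. \<Sum>i<n. integral {a..b} (f i))"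
  proof
    show "I n = (\<Sum>i<n. integral {a..b} (f i))" for n
      using integral_unique[OF I[of n]] assms(3)
      by (subst (asm) integral_sum) (auto intro: integrable_continuous_real)
  qed
  show "(\<lambda>n. integral {a..b} (f n)) sums integral {a..b} (\<lambda>x. \<Sum>n. f n x)"
    using lim unfolding I_eq sums_def integral_unique[OF K] .
  show "continuous_on {a..b} (\<lambda>x. \<Sum>n. f n x)"
    by (rule uniform_limit_theorem[OF _ u]) (auto intro: always_eventually c)
qed

context generator
begin

text \<open>Serves the continuity of the coefficients in \<open>s\<close>, by which they can be
  integrated over \<open>s\<close>. Uniformity in \<open>t\<close> lets the estimate pass through
  time integrals, and bundling a sup bound with the Lipschitz constant makes the class closed under
  products.\<close>

definition lip :: "(real \<Rightarrow> real \<Rightarrow> 'a) \<Rightarrow> bool" where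
  "lip f \<longleftrightarrow> (\<exists>M. \<forall>s\<in>{0..1}. \<forall>s'\<in>{0..1}. \<forall>t\<in>{0..T}.
     norm (f s t) \<le> M \<and> norm (f s t - f s' t) \<le> M * \<bar>s - s'\<bar>)"

lemma lipE:
  assumes "lip f"
  obtains M where "M \<ge> 0" "\<And>s t. s \<in> {0..1} \<Longrightarrow> t \<in> {0..T} \<Longrightarrow> norm (f s t) \<le> M"
    "\<And>s s' t. s \<in> {0..1} \<Longrightarrow> s' \<in> {0..1} \<Longrightarrow> t \<in> {0..T} \<Longrightarrow> norm (f s t - f s' t) \<le> M * \<bar>s - s'\<bar>"
proof -
  obtain M where M: "\<And>s s' t. s \<in> {0..1} \<Longrightarrow> s' \<in> {0..1} \<Longrightarrow> t \<in> {0..T} \<Longrightarrow>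
     norm (f s t) \<le> M \<and> norm (f s t - f s' t) \<le> M * \<bar>s - s'\<bar>"
    using assms unfolding lip_def by blast
  have "norm (f 0 0) \<le> M" using M[of 0 0 0] T by simp
  then have "0 \<le> M" using norm_ge_zero[of "f 0 0"] by linarith
  then show thesis using that M by blast
qed

lemma lip_add:
  assumes "lip f" "lip g"
  shows "lip (\<lambda>s t. f s t + g s t)"
proof -
  from lipE[OF assms(1)] obtain M where M: "M \<ge> 0" "\<And>s t. s \<in> {0..1} \<Longrightarrow> t \<in> {0..T} \<Longrightarrow> norm (f s t) \<le> M"
    "\<And>s s' t. s \<in> {0..1} \<Longrightarrow> s' \<in> {0..1} \<Longrightarrow> t \<in> {0..T} \<Longrightarrow> norm (f s t - f s' t) \<le> M * \<bar>s - s'\<bar>" by metis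
  from lipE[OF assms(2)] obtain N where N: "N \<ge> 0" "\<And>s t. s \<in> {0..1} \<Longrightarrow> t \<in> {0..T} \<Longrightarrow> norm (g s t) \<le> N"
    "\<And>s s' t. s \<in> {0..1} \<Longrightarrow> s' \<in> {0..1} \<Longrightarrow> t \<in> {0..T} \<Longrightarrow> norm (g s t - g s' t) \<le> N * \<bar>s - s'\<bar>" by metis
  show ?thesis unfolding lip_def
  proof (intro exI[of _ "M + N"] ballI conjI)
    fix s s' t :: real assume st: "s \<in> {0..1}" "s' \<in> {0..1}" "t \<in> {0..T}"
    show "norm (f s t + g s t) \<le> M + N"
      using M(2)[OF st(1,3)] N(2)[OF st(1,3)] by (rule norm_triangle_mono)
    show "norm (f s t + g s t - (f s' t + g s' t)) \<le> (M + N) * \<bar>s - s'\<bar>"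
      using norm_triangle_mono[OF M(3)[OF st] N(3)[OF st]] by (simp add: algebra_simps)
  qed
qed

lemma lip_mult:
  assumes "lip f" "lip g"
  shows "lip (\<lambda>s t. f s t * g s t)"
proof -
  from lipE[OF assms(1)] obtain M where M: "M \<ge> 0" "\<And>s t. s \<in> {0..1} \<Longrightarrow> t \<in> {0..T} \<Longrightarrow> norm (f s t) \<le> M"
    "\<And>s s' t. s \<in> {0..1} \<Longrightarrow> s' \<in> {0..1} \<Longrightarrow> t \<in> {0..T} \<Longrightarrow> norm (f s t - f s' t) \<le> M * \<bar>s - s'\<bar>" by metis
  from lipE[OF assms(2)] obtain N where N: "N \<ge> 0" "\<And>s t. s \<in> {0..1} \<Longrightarrow> t \<in> {0..T} \<Longrightarrow> norm (g s t) \<le> N"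
    "\<And>s s' t. s \<in> {0..1} \<Longrightarrow> s' \<in> {0..1} \<Longrightarrow> t \<in> {0..T} \<Longrightarrow> norm (g s t - g s' t) \<le> N * \<bar>s - s'\<bar>" by metis
  show ?thesis unfolding lip_def
  proof (intro exI[of _ "2 * M * N"] ballI conjI)
    fix s s' t :: real assume st: "s \<in> {0..1}" "s' \<in> {0..1}" "t \<in> {0..T}"
    have "norm (f s t * g s t) \<le> M * N"
      using M(1,2) N(1,2) st by (intro order_trans[OF norm_mult_ineq] mult_mono) auto
    also have "\<dots> \<le> 2 * M * N" using M(1) N(1) by simp
    finally show "norm (f s t * g s t) \<le> 2 * M * N" .
    have "f s t * g s t - f s' t * g s' t = f s t * (g s t - g s' t) + (f s t - f s' t) * g s' t"
      by (simp add: algebra_simps)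
    also have "norm \<dots> \<le> M * (N * \<bar>s - s'\<bar>) + (M * \<bar>s - s'\<bar>) * N"
      using M(1) N(1) st
      by (intro norm_triangle_mono order_trans[OF norm_mult_ineq] mult_mono M N) auto
    finally show "norm (f s t * g s t - f s' t * g s' t) \<le> 2 * M * N * \<bar>s - s'\<bar>"
      by (simp add: algebra_simps)
  qed
qed

lemma lip_const: "(\<And>t. t \<in> {0..T} \<Longrightarrow> norm (f t) \<le> M) \<Longrightarrow> lip (\<lambda>s. f)"
  unfolding lip_def
proof (intro exI[of _ M] ballI conjI)
  fix s s' t :: real assume "\<And>t. t \<in> {0..T} \<Longrightarrow> norm (f t) \<le> M" "t \<in> {0..T}"
  then have *: "norm (f t) \<le> M" by blast
  then show "norm (f t) \<le> M" .
  have "0 \<le> M" using * norm_ge_zero[of "f t"] by linarith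
  then show "norm (f t - f t) \<le> M * \<bar>s - s'\<bar>" by simp
qed

lemma lip_scale:
  assumes "lip f"
  shows "lip (\<lambda>s t. s *\<^sub>R f s t)"
proof -
  have "lip (\<lambda>s t. of_real s)"
    unfolding lip_def by (intro exI[of _ 1] ballI conjI) (auto simp flip: of_real_diff)
  from lip_mult[OF this assms] show ?thesis by (simp add: scaleR_conv_of_real)
qed

lemma lip_sum: "(\<And>i. i \<in> I \<Longrightarrow> lip (f i)) \<Longrightarrow> lip (\<lambda>s t. \<Sum>i\<in>I. f i s t)"
  by (induction I rule: infinite_finite_induct) (auto intro: lip_add lip_const[of _ 0])

lemma lip_cmult: "lip f \<Longrightarrow> lip (\<lambda>s t. c *\<^sub>R f s t)"
  using lip_mult[OF lip_const[of "\<lambda>_. of_real c" "\<bar>c\<bar>"]] by (simp add: scaleR_conv_of_real)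

lemma lip_left_factor_right_factor:
  assumes "lip (\<lambda>s. riccati A s n)"
  shows "lip (\<lambda>s. left_factor A s n)" "lip (\<lambda>s. right_factor A s n)"
proof -
  have c: "lip (\<lambda>s t. if n = 0 then 1 else 0)" by (rule lip_const[of _ 1]) simp
  have sr: "lip (\<lambda>s t. (-1) *\<^sub>R (s *\<^sub>R riccati A s n t))"
    by (intro lip_cmult lip_scale assms)
  show "lip (\<lambda>s. left_factor A s n)"
    using lip_add[OF c sr] by (simp add: left_factor_def[abs_def])
  show "lip (\<lambda>s. right_factor A s n)"
    using lip_add[OF lip_add[OF c assms] sr] by (simp add: right_factor_def[abs_def] algebra_simps)
qed

lemma lip_riccati: "lip (\<lambda>s. riccati A s n)"
proof (induction n rule: less_induct)
  case (less n)
  show ?case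
  proof (cases n)
    case 0
    then show ?thesis by (auto intro: lip_const[of _ 0])
  next
    case (Suc m)
    have "lip (\<lambda>s. riccati_deriv A s m)"
      unfolding riccati_deriv_def[abs_def]
      by (intro lip_sum lip_mult lip_left_factor_right_factor lip_const[OF norm_A]) (auto intro: less.IH simp: Suc)
    from lipE[OF this] obtain M where M: "M \<ge> 0" "\<And>s t. s \<in> {0..1} \<Longrightarrow> t \<in> {0..T} \<Longrightarrow> norm (riccati_deriv A s m t) \<le> M"
      "\<And>s s' t. s \<in> {0..1} \<Longrightarrow> s' \<in> {0..1} \<Longrightarrow> t \<in> {0..T} \<Longrightarrow>
        norm (riccati_deriv A s m t - riccati_deriv A s' m t) \<le> M * \<bar>s - s'\<bar>" by metis
    show ?thesis unfolding lip_def
    proof (intro exI[of _ "M * T"] ballI conjI)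
      fix s s' t :: real assume st: "s \<in> {0..1}" "s' \<in> {0..1}" "t \<in> {0..T}"
      have c: "continuous_on {0..t} (riccati A s n)" for s
        using cont_riccati by (rule continuous_on_subset) (use st in auto)
      have "norm (riccati A s n t - riccati A s n 0) \<le> M * t - M * 0"
        by (rule norm_diff_le_if_derivative_le[OF _ finite_S c, where f' = "riccati_deriv A s m" and g' = "\<lambda>_. M"])
          (use st M deriv_riccati_Suc in \<open>auto intro!: continuous_intros derivative_eq_intros simp: Suc\<close>)
      also have "\<dots> \<le> M * T" using st M(1) by (simp add: mult_left_mono)
      finally show "norm (riccati A s n t) \<le> M * T" by (simp add: riccati_at_0)
      have "norm ((\<lambda>t. riccati A s n t - riccati A s' n t) t - (\<lambda>t. riccati A s n t - riccati A s' n t) 0)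
          \<le> (M * \<bar>s - s'\<bar>) * t - (M * \<bar>s - s'\<bar>) * 0"
        by (rule norm_diff_le_if_derivative_le[OF _ finite_S continuous_on_diff[OF c c],
              where f' = "\<lambda>x. riccati_deriv A s m x - riccati_deriv A s' m x" and g' = "\<lambda>_. M * \<bar>s - s'\<bar>"])
          (use st M deriv_riccati_Suc in
            \<open>auto intro!: continuous_intros derivative_eq_intros has_vector_derivative_diff simp: Suc\<close>)
      also have "\<dots> \<le> (M * \<bar>s - s'\<bar>) * T" using st M(1) by (simp add: mult_left_mono)
      finally show "norm (riccati A s n t - riccati A s' n t) \<le> M * T * \<bar>s - s'\<bar>"
        by (simp add: riccati_at_0 mult_ac)
    qed
  qed
qed

lemma cont_riccati_param: "t \<in> {0..T} \<Longrightarrow> continuous_on {0..1} (\<lambda>s. riccati A s n t)"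
proof -
  assume t: "t \<in> {0..T}"
  from lipE[OF lip_riccati[of n]] obtain M where M: "M \<ge> 0"
    "\<And>s s' t. s \<in> {0..1} \<Longrightarrow> s' \<in> {0..1} \<Longrightarrow> t \<in> {0..T} \<Longrightarrow>
        norm (riccati A s n t - riccati A s' n t) \<le> M * \<bar>s - s'\<bar>" by metis
  have "M-lipschitz_on {0..1} (\<lambda>s. riccati A s n t)"
    by (rule lipschitz_onI) (use M t in \<open>auto simp: dist_norm\<close>)
  then show ?thesis by (rule lipschitz_on_continuous_on)
qed

text \<open>The coefficients of \<open>Y + s Y X = X\<close>: the difference of the two sides satisfies
  \<open>E' = (1 - s) (1 - s Y) A E\<close>.\<close>

lemma riccati_resolvent:
  assumes "t \<in> {0..T}"
  shows "riccati A s n t + s *\<^sub>R (\<Sum>i\<le>n. riccati A s i t * riccati A 0 (n - i) t) = riccati A 0 n t"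
  using assms
proof (induction n arbitrary: t rule: less_induct)
  case (less n)
  show ?case
  proof (cases n)
    case (Suc m)
    \<comment> \<open>The coefficient of order 0 is constantly 0; giving it the derivative 0 lets
      the Cauchy products be differentiated over all indices at once.\<close>
    define d where "d s n t = (case n of 0 \<Rightarrow> 0 | Suc m \<Rightarrow> riccati_deriv A s m t)" for s n t
    have d: "(riccati A s n has_vector_derivative d s n t) (at t)" if "t \<in> {0<..<T} - S" for s n t
      using deriv_riccati_Suc[OF that] by (cases n) (auto simp: d_def)
    define E where "E t = riccati A s n t + s *\<^sub>R (\<Sum>i\<le>n. riccati A s i t * riccati A 0 (n - i) t) - riccati A 0 n t" for t
    have "E t = (\<lambda>_. 0) t"
    proof (rule eq_if_derivative_eq[OF _ finite_S, where h = "\<lambda>_. 0"])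
      show "continuous_on {0..t} E" unfolding E_def
        by (intro continuous_intros continuous_on_subset[OF cont_riccati]) (use less.prems in auto)
      fix x assume x: "x \<in> {0<..<t} - S"
      then have x': "x \<in> {0<..<T} - S" and x'': "x \<in> {0..T}" using less.prems by auto
      have dE: "(E has_vector_derivative d s n x + s *\<^sub>R (\<Sum>i\<le>n. riccati A s i x * d 0 (n - i) x
          + d s i x * riccati A 0 (n - i) x) - d 0 n x) (at x)"
        unfolding E_def
        by (intro has_vector_derivative_add has_vector_derivative_diff
            has_vector_derivative_sum has_vector_derivative_mult d x'
            bounded_linear.has_vector_derivative[OF bounded_linear_scaleR_right])
      \<comment> \<open>Formal power series in \<lambda> over the noncommutative algebra: Cauchy
        sums become products, and the differential identity becomes ring algebra.\<close>
      define y z a \<sigma> where "y = Abs_fps (\<lambda>n. riccati A s n x)" and "z = Abs_fps (\<lambda>n. riccati A 0 n x)"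
        and "a = fps_const (A x)" and "\<sigma> = fps_const (of_real s :: 'a)"
      define D D0 \<epsilon> where "D = (1 - \<sigma> * y) * a * (1 + (1 - \<sigma>) * y)" and "D0 = a * (1 + z)"
        and "\<epsilon> = y + \<sigma> * (y * z) - z"
      \<comment> \<open>\<sigma> is a real scalar and therefore central; the ring identities below
        move it past other factors.\<close>
      have central: "u * (\<sigma> * v) = \<sigma> * (u * v)" for u v
      proof -
        have "u * \<sigma> = \<sigma> * u"
          by (rule fps_ext) (simp add: \<sigma>_def of_real_def)
        then show ?thesis by (simp flip: mult.assoc)
      qed
      have left_factor: "fps_nth (1 - \<sigma> * y) i = left_factor A s i x" for i
        by (simp add: y_def \<sigma>_def left_factor_def scaleR_conv_of_real)
      have "fps_nth (1 + (1 - \<sigma>) * y) i = right_factor A s i x" for i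
        by (simp add: y_def \<sigma>_def right_factor_def scaleR_conv_of_real left_diff_distrib)
      then have D: "fps_nth D i = riccati_deriv A s i x" for i
        unfolding D_def riccati_deriv_def fps_mult_nth[of "_ * _"]
        by (simp add: a_def left_factor atLeast0AtMost del: fps_add_nth fps_sub_nth)
      have D0: "fps_nth D0 i = riccati_deriv A 0 i x" for i
        by (simp add: D0_def riccati_deriv_0 a_def z_def dyson_def)
      have \<epsilon>: "fps_nth \<epsilon> i = 0" if "i \<le> m" for i
      proof -
        have "fps_nth (y * z) i = (\<Sum>j\<le>i. riccati A s j x * riccati A 0 (i - j) x)"
          "fps_nth y i = riccati A s i x" "fps_nth z i = riccati A 0 i x"
          by (simp_all add: fps_mult_nth y_def z_def atLeast0AtMost)
        then show ?thesis
          using less.IH[of i x] that Suc x''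
          by (simp add: \<epsilon>_def \<sigma>_def scaleR_conv_of_real)
      qed
      have "D + \<sigma> * (y * D0 + D * z) - D0 = D * (1 + \<sigma> * z) - (1 - \<sigma> * y) * D0"
        using central[of D z] by (simp add: algebra_simps)
      also have "\<dots> = (1 - \<sigma> * y) * a * ((1 + (1 - \<sigma>) * y) * (1 + \<sigma> * z) - (1 + z))"
        unfolding D_def D0_def by (simp add: algebra_simps)
      also have "(1 + (1 - \<sigma>) * y) * (1 + \<sigma> * z) - (1 + z) = (1 - \<sigma>) * \<epsilon>"
        using central[of y z] by (simp add: \<epsilon>_def algebra_simps)
      finally have eq: "D + \<sigma> * (y * D0 + D * z) - D0 = (1 - \<sigma> * y) * a * (1 - \<sigma>) * \<epsilon>"
        by (simp add: mult.assoc)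
      \<comment> \<open>This coefficient is the derivative of the defect of order n = m + 1. As
        \<open>A\<close> supplies one power of \<lambda>, only defects of order at most m enter, and
        these vanish by the induction hypothesis.\<close>
      have "fps_nth (D + \<sigma> * (y * D0 + D * z) - D0) m = 0"
        unfolding eq fps_mult_nth[of _ \<epsilon>] using \<epsilon> by (auto intro!: sum.neutral)
      have "riccati_deriv A s m x + s *\<^sub>R ((\<Sum>i\<le>m. riccati A s i x * riccati_deriv A 0 (m - i) x)
          + (\<Sum>i\<le>m. riccati_deriv A s i x * riccati A 0 (m - i) x)) - riccati_deriv A 0 m x = 0"
      proof -
        have "fps_nth (y * D0) m = (\<Sum>i\<le>m. riccati A s i x * riccati_deriv A 0 (m - i) x)"
          "fps_nth (D * z) m = (\<Sum>i\<le>m. riccati_deriv A s i x * riccati A 0 (m - i) x)"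
          by (simp_all add: fps_mult_nth D D0 y_def z_def atLeast0AtMost)
        with \<open>fps_nth (D + _ - D0) m = 0\<close> show ?thesis
          by (simp add: D D0 \<sigma>_def scaleR_conv_of_real)
      qed
      moreover have "(\<Sum>i\<le>n. riccati A s i x * d 0 (n - i) x)
          = (\<Sum>i\<le>m. riccati A s i x * riccati_deriv A 0 (m - i) x)"
        by (simp add: Suc d_def Suc_diff_le)
      moreover have "(\<Sum>i\<le>n. d s i x * riccati A 0 (n - i) x)
          = (\<Sum>i\<le>m. riccati_deriv A s i x * riccati A 0 (m - i) x)"
        unfolding Suc by (subst sum.atMost_Suc_shift) (simp add: d_def)
      ultimately show "(E has_vector_derivative 0) (at x)"
        using dE by (simp add: Suc d_def sum.distrib)
    qed (use less.prems in \<open>auto simp: E_def riccati_at_0\<close>)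
    then show ?thesis by (simp add: E_def)
  qed simp
qed

text \<open>The threshold 1/2 makes the ratio at most 1/4. The sum of 2 (1/4)^n over n \<ge> 1 is
  then 2/3, below the bound 1 that \<open>exp_integral_resolvent\<close> asks of X.\<close>

lemma summable_riccati:
  assumes l: "\<bar>l\<bar> * e * T \<le> 1/2" and s: "0 \<le> s" "s \<le> 1" and t: "t \<in> {0..T}"
  shows "norm (l ^ n *\<^sub>R riccati A s n t) \<le> (if n = 0 then 0 else 2 * (1/4) ^ n)"
    and "summable (\<lambda>n. norm (l ^ n *\<^sub>R riccati A s n t))"
proof -
  show le: "norm (l ^ n *\<^sub>R riccati A s n t) \<le> (if n = 0 then 0 else 2 * (1/4) ^ n)" for n
  proof (cases n)
    case (Suc m)
    have "norm (l ^ n *\<^sub>R riccati A s n t) \<le> \<bar>l\<bar> ^ n * (2 * (e * t / 2) ^ n)"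
      using norm_riccati_le[OF s t, of n] by (simp add: power_abs mult_left_mono)
    also have "\<dots> = 2 * (\<bar>l\<bar> * e * t / 2) ^ n"
      by (simp add: power_mult_distrib power_divide)
    also have "\<dots> \<le> 2 * (1/4) ^ n"
    proof (intro mult_left_mono power_mono)
      have "\<bar>l\<bar> * e * t \<le> \<bar>l\<bar> * e * T" using t e_nonneg by (intro mult_left_mono) auto
      then show "\<bar>l\<bar> * e * t / 2 \<le> 1/4" using l by linarith
      show "0 \<le> \<bar>l\<bar> * e * t / 2" using t e_nonneg by simp
    qed simp
    finally show ?thesis by (simp add: Suc)
  qed simp
  have "summable (\<lambda>n. 2 * (1/4::real) ^ n)" by (intro summable_mult summable_geometric) simp
  then show "summable (\<lambda>n. norm (l ^ n *\<^sub>R riccati A s n t))"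
  proof (rule summable_comparison_test[rotated], intro exI allI impI)
    show "norm (norm (l ^ n *\<^sub>R riccati A s n t)) \<le> 2 * (1/4) ^ n" for n
      using le[of n] by (cases "n = 0") (simp_all del: norm_scaleR)
  qed
qed

text \<open>\<open>riccati_resolvent\<close> is summed by Cauchy products to the equation Z s (1 + s
  X) = X with X = Z 0, the Dyson series without its leading 1. Integrating over \<open>s\<close>
  then produces the logarithm.\<close>

theorem exp_log_coeff:
  assumes l: "\<bar>l\<bar> * e * T \<le> 1/2"
  shows "summable (\<lambda>n. l ^ n *\<^sub>R log_coeff A T n)"
    and "exp (\<Sum>n. l ^ n *\<^sub>R log_coeff A T n) = (\<Sum>n. l ^ n *\<^sub>R dyson A n T)"
proof -
  have T': "T \<in> {0..T}" using T by simp
  define Z where "Z s = (\<Sum>n. l ^ n *\<^sub>R riccati A s n T)" for s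
  have bound: "norm (l ^ n *\<^sub>R riccati A s n T) \<le> 2 * (1/4) ^ n" if "s \<in> {0..1}" for n s
    using summable_riccati(1)[OF l _ _ T', of s n] that by (auto split: if_splits)
  have geo: "summable (\<lambda>n. 2 * (1/4::real) ^ n)" by (intro summable_mult summable_geometric) simp
  have c: "continuous_on {0..1} (\<lambda>s. l ^ n *\<^sub>R riccati A s n T)" for n
    by (intro continuous_intros cont_riccati_param T')
  have "(\<lambda>n. integral {0..1} (\<lambda>s. l ^ n *\<^sub>R riccati A s n T)) sums integral {0..1} Z"
    and cZ: "continuous_on {0..1} Z"
    unfolding Z_def using uniform_limit_sums_integral[OF bound geo c] by blast+
  moreover have "(\<lambda>n. integral {0..1} (\<lambda>s. l ^ n *\<^sub>R riccati A s n T)) = (\<lambda>n. l ^ n *\<^sub>R log_coeff A T n)"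
    by (simp add: log_coeff_def)
  ultimately have sums: "(\<lambda>n. l ^ n *\<^sub>R log_coeff A T n) sums integral {0..1} Z" by (simp only:)
  then show "summable (\<lambda>n. l ^ n *\<^sub>R log_coeff A T n)" by (simp add: sums_iff)
  have res: "Z s + s *\<^sub>R (Z s * Z 0) = Z 0" if s: "s \<in> {0..1}" for s
  proof -
    have sm: "summable (\<lambda>n. norm (l ^ n *\<^sub>R riccati A s n T))" if "s \<in> {0..1}" for s
      using summable_riccati(2)[OF l _ _ T', of s] that by auto
    let ?c = "\<lambda>n. \<Sum>i\<le>n. (l ^ i *\<^sub>R riccati A s i T) * (l ^ (n - i) *\<^sub>R riccati A 0 (n - i) T)"
    have c: "?c sums (Z s * Z 0)"
      unfolding Z_def using s by (intro Cauchy_product_sums sm) auto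
    have "(\<lambda>n. l ^ n *\<^sub>R riccati A s n T + s *\<^sub>R ?c n) sums (Z s + s *\<^sub>R (Z s * Z 0))"
      using summable_sums[OF summable_norm_cancel[OF sm[OF s]]] c
      by (intro sums_add sums_scaleR_right) (simp_all add: Z_def)
    moreover have "l ^ n *\<^sub>R riccati A s n T + s *\<^sub>R ?c n = l ^ n *\<^sub>R riccati A 0 n T" for n
    proof -
      have "?c n = l ^ n *\<^sub>R (\<Sum>i\<le>n. riccati A s i T * riccati A 0 (n - i) T)"
        unfolding scaleR_sum_right
        by (intro sum.cong) (auto simp: power_add[symmetric])
      then show ?thesis
        using riccati_resolvent[OF T', of s n, symmetric] by (simp add: scaleR_add_right mult.commute)
    qed
    ultimately show ?thesis by (simp add: Z_def sums_iff)
  qed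
  \<comment> \<open>The order 0 term is taken out of the geometric bound: with it the sum would be
    8/3 instead of 2/3, no longer below 1.\<close>
  have "norm (Z 0) \<le> (\<Sum>n. 2 * (1/4) ^ n - (if n = 0 then 2 else 0))"
    unfolding Z_def
  proof (rule norm_suminf_le)
    show "norm (l ^ n *\<^sub>R riccati A 0 n T) \<le> 2 * (1/4) ^ n - (if n = 0 then 2 else 0)" for n
      using summable_riccati(1)[OF l _ _ T', of 0 n] by auto
    show "summable (\<lambda>n. 2 * (1/4) ^ n - (if n = 0 then 2 else 0::real))"
      by (intro summable_diff geo summable_finite[of "{0}"]) auto
  qed
  also have "(\<lambda>n. 2 * (1/4) ^ n - (if n = 0 then 2 else 0::real)) sums (2 * (4/3) - 2)"
    using sums_single[of 0 "\<lambda>_. 2::real"] geometric_sums[of "1/4::real"]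
    by (intro sums_diff sums_mult) (simp_all add: eq_commute)
  then have "(\<Sum>n. 2 * (1/4) ^ n - (if n = 0 then 2 else 0::real)) = 2/3"
    by (simp add: sums_iff)
  finally have "norm (Z 0) < 1" by simp
  from exp_integral_resolvent[OF res cZ this]
  have "exp (\<Sum>n. l ^ n *\<^sub>R log_coeff A T n) = 1 + Z 0"
    using sums by (simp add: sums_iff)
  have "(\<lambda>n. (if n = 0 then 1 else 0) + l ^ n *\<^sub>R riccati A 0 n T) sums (1 + Z 0)"
    using sums_single[of 0 "\<lambda>_. 1::'a"]
      summable_sums[OF summable_norm_cancel[OF summable_riccati(2)[OF l _ _ T', of 0]]]
    by (intro sums_add) (simp_all add: Z_def eq_commute)
  moreover have "(\<lambda>n. (if n = 0 then 1 else 0) + l ^ n *\<^sub>R riccati A 0 n T) = (\<lambda>n. l ^ n *\<^sub>R dyson A n T)"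
    by (auto simp: dyson_def)
  ultimately have "1 + Z 0 = (\<Sum>n. l ^ n *\<^sub>R dyson A n T)"
    by (simp only: sums_iff)
  with \<open>exp _ = 1 + Z 0\<close>
  show "exp (\<Sum>n. l ^ n *\<^sub>R log_coeff A T n) = (\<Sum>n. l ^ n *\<^sub>R dyson A n T)" by (simp only:)
qed

section \<open>The Dyson series and the evolution equation\<close>

lemma deriv_dyson_partial_sum:
  assumes "t \<in> {0<..<T} - S"
  shows "((\<lambda>t. \<Sum>n<Suc N. l ^ n *\<^sub>R dyson A n t) has_vector_derivative
     l *\<^sub>R (A t * (\<Sum>n<N. l ^ n *\<^sub>R dyson A n t))) (at t)"
proof -
  have "((\<lambda>t. \<Sum>n<Suc N. l ^ n *\<^sub>R dyson A n t) has_vector_derivative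
     (\<Sum>n<N. l ^ Suc n *\<^sub>R (A t * dyson A n t))) (at t)"
    unfolding sum.lessThan_Suc_shift
    using deriv_riccati_Suc[OF assms, of 0] by (auto intro!: derivative_eq_intros
      bounded_linear.has_vector_derivative[OF bounded_linear_scaleR_right]
      simp: dyson_def[abs_def] riccati_deriv_0)
  then show ?thesis
    by (simp add: sum_distrib_left scaleR_sum_right)
qed

text \<open>Every solution is the limit of its Picard iterates, the error bound shrinking by the
  factor |l| e T at each order. As \<open>U\<close> is arbitrary, this also shows that all solutions
  share the final value.\<close>

lemma dyson_sums_solution:
  assumes l: "\<bar>l\<bar> * e * T \<le> 1/2"
    and U: "U 0 = 1" "continuous_on {0..T} U" "finite F"
    and dU: "\<And>t. t \<in> {0<..<T} - F \<Longrightarrow> (U has_vector_derivative l *\<^sub>R (A t * U t)) (at t)"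
  shows "(\<lambda>n. l ^ n *\<^sub>R dyson A n T) sums U T"
proof -
  have "compact (U ` {0..T})" using U(2) by (intro compact_continuous_image) auto
  then obtain C where C: "\<And>t. t \<in> {0..T} \<Longrightarrow> norm (U t) \<le> C"
    using compact_imp_bounded bounded_iff by (metis imageI)
  then have "0 \<le> C" using norm_ge_zero[of "U 0"] C[of 0] T by (simp add: U)
  define q where "q = \<bar>l\<bar> * e * T"
  have q: "0 \<le> q" "q \<le> 1/2" using l e_nonneg T by (auto simp: q_def)
  have bound: "norm (U t - (\<Sum>n<N. l ^ n *\<^sub>R dyson A n t)) \<le> C * q ^ N" if "t \<in> {0..T}" for t N
    using that
  proof (induction N arbitrary: t)
    case (Suc N)
    let ?D = "\<lambda>t. U t - (\<Sum>n<Suc N. l ^ n *\<^sub>R dyson A n t)"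
    let ?g = "\<bar>l\<bar> * (e * (C * q ^ N))"
    have "norm (?D t - ?D 0) \<le> ?g * t - ?g * 0"
    \<comment> \<open>\<open>U\<close> may fail to be differentiable at points of its own:
      \<open>evolves\<close> grants every solution some finite exceptional set.\<close>
    proof (rule norm_diff_le_if_derivative_le[where S = "S \<union> F"])
      show "continuous_on {0..t} ?D"
        using Suc.prems by (intro continuous_intros continuous_on_subset[OF cont_dyson]
            continuous_on_subset[OF U(2)]) auto
      fix x assume x: "x \<in> {0<..<t} - (S \<union> F)"
      then have x': "x \<in> {0<..<T} - S" "x \<in> {0<..<T} - F" "x \<in> {0..T}" using Suc.prems by auto
      show "(?D has_vector_derivative l *\<^sub>R (A x * U x) - l *\<^sub>R (A x * (\<Sum>n<N. l ^ n *\<^sub>R dyson A n x))) (at x)"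
        by (intro has_vector_derivative_diff dU deriv_dyson_partial_sum x')
      have "l *\<^sub>R (A x * U x) - l *\<^sub>R (A x * (\<Sum>n<N. l ^ n *\<^sub>R dyson A n x))
          = l *\<^sub>R (A x * (U x - (\<Sum>n<N. l ^ n *\<^sub>R dyson A n x)))"
        by (simp add: algebra_simps)
      also have "norm \<dots> \<le> ?g"
        unfolding norm_scaleR using x' Suc.IH[OF x'(3)] norm_A[OF x'(3)] e_nonneg
        by (intro mult_left_mono order_trans[OF norm_mult_ineq] mult_mono) auto
      finally show "norm (l *\<^sub>R (A x * U x) - l *\<^sub>R (A x * (\<Sum>n<N. l ^ n *\<^sub>R dyson A n x))) \<le> ?g" .
    qed (use Suc.prems finite_S U in \<open>auto intro!: continuous_intros derivative_eq_intros\<close>)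
    moreover have "?D 0 = 0"
      by (simp add: sum.lessThan_Suc_shift dyson_def riccati_at_0 U del: sum.lessThan_Suc)
    ultimately have "norm (?D t) \<le> ?g * t" by simp
    also have "\<dots> \<le> ?g * T" using Suc.prems e_nonneg \<open>0 \<le> C\<close> q by (intro mult_left_mono) auto
    also have "\<dots> = C * q ^ Suc N" by (simp add: q_def)
    finally show ?case .
  qed (use C in simp)
  have "(\<lambda>N. U T - (\<Sum>n<N. l ^ n *\<^sub>R dyson A n T)) \<longlonglongrightarrow> 0"
  proof (rule Lim_null_comparison)
    show "\<forall>\<^sub>F N in sequentially. norm (U T - (\<Sum>n<N. l ^ n *\<^sub>R dyson A n T)) \<le> C * q ^ N"
      using bound T by (intro always_eventually) auto
    show "(\<lambda>N. C * q ^ N) \<longlonglongrightarrow> 0"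
      using q by (intro tendsto_mult_right_zero LIMSEQ_power_zero) auto
  qed
  from tendsto_diff[OF tendsto_const[of "U T"] this] show ?thesis by (simp add: sums_def)
qed

text \<open>The sum \<open>U\<close> of the Dyson series comes only as a uniform limit. Its
  integrated equation defines a \<open>V\<close> that is differentiable off \<open>S\<close>, and
  comparing the partial sums with \<open>V\<close> shows V = U.\<close>

lemma dyson_solution_exists:
  assumes l: "\<bar>l\<bar> * e * T \<le> 1/2"
  obtains U where "U 0 = 1" "continuous_on {0..T} U"
    "\<And>t. t \<in> {0<..<T} - S \<Longrightarrow> (U has_vector_derivative l *\<^sub>R (A t * U t)) (at t)"
proof -
  define U where "U t = (\<Sum>n. l ^ n *\<^sub>R dyson A n t)" for t
  have bound: "norm (l ^ n *\<^sub>R dyson A n t) \<le> 2 * (1/4) ^ n" if "t \<in> {0..T}" for n t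
    using summable_riccati(1)[OF l _ _ that, of 0 n] by (cases n) (auto simp: dyson_def)
  have geo: "summable (\<lambda>n. 2 * (1/4::real) ^ n)" by (intro summable_mult summable_geometric) simp
  have unif: "uniform_limit {0..T} (\<lambda>N t. \<Sum>n<N. l ^ n *\<^sub>R dyson A n t) U sequentially"
    unfolding U_def by (rule Weierstrass_m_test[OF bound geo])
  have cU: "continuous_on {0..T} U"
    by (rule uniform_limit_theorem[OF _ unif])
      (auto intro!: always_eventually continuous_intros cont_dyson)
  define V where "V t = 1 + l *\<^sub>R integral {0..t} (\<lambda>r. 1 * A r * U r)" for t
  have cV: "continuous_on {0..T} V" unfolding V_def
    by (intro continuous_intros cont_primitive cU)
  have dV: "(V has_vector_derivative l *\<^sub>R (A t * U t)) (at t)" if "t \<in> {0<..<T} - S" for t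
  proof -
    have "((\<lambda>t. integral {0..t} (\<lambda>r. 1 * A r * U r)) has_vector_derivative 1 * A t * U t) (at t)"
      by (rule deriv_primitive[OF continuous_on_const cU that])
    then show ?thesis unfolding V_def
      by (auto intro!: derivative_eq_intros bounded_linear.has_vector_derivative[OF bounded_linear_scaleR_right])
  qed
  have "V t = U t" if t: "t \<in> {0..T}" for t
  proof -
    have "(\<lambda>N. \<Sum>n<Suc N. l ^ n *\<^sub>R dyson A n t) \<longlonglongrightarrow> V t"
    proof (rule LIMSEQ_I)
      fix \<epsilon> :: real assume "0 < \<epsilon>"
      from uniform_limitD[OF unif this] obtain N0 where
        N0: "\<And>N x. N \<ge> N0 \<Longrightarrow> x \<in> {0..T} \<Longrightarrow> dist (\<Sum>n<N. l ^ n *\<^sub>R dyson A n x) (U x) < \<epsilon>"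
        unfolding eventually_sequentially by blast
      have "norm ((\<Sum>n<Suc N. l ^ n *\<^sub>R dyson A n t) - V t) < \<epsilon>" if N: "N \<ge> N0" for N
      proof -
        let ?D = "\<lambda>t. (\<Sum>n<Suc N. l ^ n *\<^sub>R dyson A n t) - V t"
        have "norm (?D t - ?D 0) \<le> \<bar>l\<bar> * (e * \<epsilon>) * t - \<bar>l\<bar> * (e * \<epsilon>) * 0"
        proof (rule norm_diff_le_if_derivative_le[OF _ finite_S])
          show "continuous_on {0..t} ?D"
            using t by (intro continuous_intros continuous_on_subset[OF cont_dyson]
                continuous_on_subset[OF cV]) auto
          fix x assume x: "x \<in> {0<..<t} - S"
          then have x': "x \<in> {0<..<T} - S" "x \<in> {0..T}" using t by auto
          show "(?D has_vector_derivative l *\<^sub>R (A x * (\<Sum>n<N. l ^ n *\<^sub>R dyson A n x)) - l *\<^sub>R (A x * U x)) (at x)"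
            by (intro has_vector_derivative_diff dV deriv_dyson_partial_sum x')
          have "l *\<^sub>R (A x * (\<Sum>n<N. l ^ n *\<^sub>R dyson A n x)) - l *\<^sub>R (A x * U x)
              = l *\<^sub>R (A x * ((\<Sum>n<N. l ^ n *\<^sub>R dyson A n x) - U x))"
            by (simp add: algebra_simps)
          also have "norm \<dots> \<le> \<bar>l\<bar> * (e * \<epsilon>)"
            unfolding norm_scaleR using N0[OF N x'(2)] norm_A[OF x'(2)] e_nonneg
            by (intro mult_left_mono order_trans[OF norm_mult_ineq] mult_mono) (auto simp: dist_norm)
          finally show "norm (l *\<^sub>R (A x * (\<Sum>n<N. l ^ n *\<^sub>R dyson A n x)) - l *\<^sub>R (A x * U x)) \<le> \<bar>l\<bar> * (e * \<epsilon>)" .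
        qed (use t in \<open>auto intro!: continuous_intros derivative_eq_intros\<close>)
        moreover have "?D 0 = 0"
          by (simp add: sum.lessThan_Suc_shift dyson_def riccati_at_0 V_def del: sum.lessThan_Suc)
        ultimately have "norm (?D t) \<le> \<bar>l\<bar> * (e * \<epsilon>) * t" by simp
        also have "\<dots> \<le> \<bar>l\<bar> * (e * \<epsilon>) * T"
          using t e_nonneg \<open>0 < \<epsilon>\<close> by (intro mult_left_mono) auto
        also have "\<dots> = (\<bar>l\<bar> * e * T) * \<epsilon>" by simp
        also have "\<dots> \<le> 1/2 * \<epsilon>" using l \<open>0 < \<epsilon>\<close> by (intro mult_right_mono) auto
        finally show ?thesis using \<open>0 < \<epsilon>\<close> by simp
      qed
      then show "\<exists>no. \<forall>n\<ge>no. norm ((\<Sum>n<Suc n. l ^ n *\<^sub>R dyson A n t) - V t) < \<epsilon>" by blast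
    qed
    moreover have "(\<lambda>N. \<Sum>n<Suc N. l ^ n *\<^sub>R dyson A n t) \<longlonglongrightarrow> U t"
      using LIMSEQ_Suc[OF tendsto_uniform_limitI[OF unif t]] .
    ultimately show ?thesis by (rule LIMSEQ_unique)
  qed
  then have "V 0 = 1 \<and> continuous_on {0..T} V \<and>
     (\<forall>t\<in>{0<..<T} - S. (V has_vector_derivative l *\<^sub>R (A t * V t)) (at t))"
    using cV dV by (auto simp: V_def[of 0])
  then show thesis using that by blast
qed

end

section \<open>Magnus terms of low and high order\<close>

text \<open>Neither series has a constant term, so near l = 0 both are small enough for
  \<open>exp_inj_near_zero\<close>. The sums then agree as functions, and the identity theorem
  compares the coefficients.\<close>

lemma exp_powser_unique:
  fixes a b :: "nat \<Rightarrow> 'a::{real_normed_algebra_1,banach}"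
  assumes "r > 0" "a 0 = 0" "b 0 = 0"
    and "\<And>l. \<bar>l\<bar> < r \<Longrightarrow> summable (\<lambda>n. l ^ n *\<^sub>R a n)"
    and "\<And>l. \<bar>l\<bar> < r \<Longrightarrow> summable (\<lambda>n. l ^ n *\<^sub>R b n)"
    and eq: "\<And>l. \<bar>l\<bar> < r \<Longrightarrow> exp (\<Sum>n. l ^ n *\<^sub>R a n) = exp (\<Sum>n. l ^ n *\<^sub>R b n)"
  shows "a = b"
proof
  fix n
  have small: "\<exists>d>0. d \<le> r \<and> (\<forall>l. \<bar>l\<bar> < d \<longrightarrow> norm (\<Sum>n. l ^ n *\<^sub>R c n) \<le> 1/4)"
    if c: "c 0 = 0" "\<And>l. \<bar>l\<bar> < r \<Longrightarrow> summable (\<lambda>n. l ^ n *\<^sub>R c n)" for c :: "nat \<Rightarrow> 'a"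
  proof -
    obtain M where M: "\<And>l. \<bar>l\<bar> \<le> r/2/2 \<Longrightarrow> norm (\<Sum>n. l ^ n *\<^sub>R c n) \<le> M * \<bar>l\<bar> ^ 1"
    proof (rule powser_bound_of_order[of "r/2" c 1])
      show "r/2 > 0" "summable (\<lambda>n. (r/2) ^ n *\<^sub>R c n)" using c(2)[of "r/2"] assms(1) by auto
      show "c i = 0" if "i < 1" for i using c(1) that by simp
    qed blast
    let ?d = "min (r/4) (1 / (4 * (\<bar>M\<bar> + 1)))"
    have "norm (\<Sum>n. l ^ n *\<^sub>R c n) \<le> 1/4" if "\<bar>l\<bar> < ?d" for l
    proof -
      have "norm (\<Sum>n. l ^ n *\<^sub>R c n) \<le> M * \<bar>l\<bar>" using M[of l] that by simp
      also have "\<dots> \<le> (\<bar>M\<bar> + 1) * \<bar>l\<bar>" by (intro mult_right_mono) auto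
      also have "\<dots> \<le> (\<bar>M\<bar> + 1) * (1 / (4 * (\<bar>M\<bar> + 1)))"
        using that by (intro mult_left_mono) auto
      also have "\<dots> = 1/4" by (simp add: field_simps)
      finally show ?thesis .
    qed
    moreover have "0 < ?d" "?d \<le> r" using assms(1) by auto
    ultimately show ?thesis by blast
  qed
  obtain d where d: "d > 0" "d \<le> r" "\<And>l. \<bar>l\<bar> < d \<Longrightarrow> norm (\<Sum>n. l ^ n *\<^sub>R a n) \<le> 1/4"
    using small[OF assms(2,4)] by auto
  obtain d' where d': "d' > 0" "\<And>l. \<bar>l\<bar> < d' \<Longrightarrow> norm (\<Sum>n. l ^ n *\<^sub>R b n) \<le> 1/4"
    using small[OF assms(3,5)] by auto
  have sums0: "(\<lambda>n. l ^ n *\<^sub>R (a n - b n)) sums 0" if l: "\<bar>l\<bar> < min d d'" for l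
  proof -
    have l': "\<bar>l\<bar> < r" "\<bar>l\<bar> < d" "\<bar>l\<bar> < d'" using l d(2) by auto
    have "(\<Sum>n. l ^ n *\<^sub>R a n) = (\<Sum>n. l ^ n *\<^sub>R b n)"
      by (rule exp_inj_near_zero[OF d(3)[OF l'(2)] d'(2)[OF l'(3)] eq[OF l'(1)]])
    moreover have "(\<lambda>n. l ^ n *\<^sub>R a n - l ^ n *\<^sub>R b n) sums ((\<Sum>n. l ^ n *\<^sub>R a n) - (\<Sum>n. l ^ n *\<^sub>R b n))"
      using assms(4,5)[OF l'(1)] by (intro sums_diff summable_sums)
    ultimately show ?thesis by (simp add: scaleR_diff_right)
  qed
  have "a n - b n = 0"
    by (rule powser_coeffs_eq_0[of "min d d'" "\<lambda>n. a n - b n", OF _ sums0]) (use d d' in auto)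
  then show "a n = b n" by simp
qed

text \<open>Collects the weights 1, 1/2, 1/3 that \<open>integral_quadratic\<close> leaves at orders
  2 and 3.\<close>

lemma scaleR_combine:
  fixes u v y :: "'a::real_vector"
  shows "u + (1/2) *\<^sub>R (- u - v) = (1/2) *\<^sub>R (u - v)"
    and "u + (1/2) *\<^sub>R (v - u - y) + (1/3) *\<^sub>R y = (1/2) *\<^sub>R (u + v) - (1/6) *\<^sub>R y"
proof -
  define h k where "h = (1/2) *\<^sub>R u" and "k = (1/6) *\<^sub>R y"
  have u: "u = h + h" and y: "y = 6 *\<^sub>R k"
    by (simp_all add: h_def k_def flip: scaleR_add_left)
  have "3 *\<^sub>R k = k + 2 *\<^sub>R k" by (metis one_plus_numeral scaleR_add_left scaleR_one semiring_norm(3))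
  then show "u + (1/2) *\<^sub>R (- u - v) = (1/2) *\<^sub>R (u - v)"
    and "u + (1/2) *\<^sub>R (v - u - y) + (1/3) *\<^sub>R y = (1/2) *\<^sub>R (u + v) - (1/6) *\<^sub>R y"
    unfolding u y by (simp_all add: algebra_simps flip: scaleR_2)
qed

lemma integral_quadratic:
  fixes u v w :: "'a::banach"
  shows "integral {0..1} (\<lambda>s. u + s *\<^sub>R v + (s ^ 2) *\<^sub>R w) = u + (1/2) *\<^sub>R v + (1/3) *\<^sub>R w"
proof -
  have "((\<lambda>s. u + s *\<^sub>R v + (s ^ 2) *\<^sub>R w) has_integral
      ((\<lambda>s. s *\<^sub>R u + (s ^ 2 / 2) *\<^sub>R v + (s ^ 3 / 3) *\<^sub>R w) 1
       - (\<lambda>s. s *\<^sub>R u + (s ^ 2 / 2) *\<^sub>R v + (s ^ 3 / 3) *\<^sub>R w) 0)) {0..1}"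
    by (rule fundamental_theorem_of_calculus) (auto intro!: derivative_eq_intros)
  then show ?thesis by (simp add: integral_unique)
qed

context generator
begin

section \<open>Iterated integrals and the terms of order 1, 2 and 3\<close>

lemma log_coeff_0: "log_coeff A T 0 = 0"
  by (simp add: log_coeff_def)

lemma riccati_1: "riccati A s (Suc 0) t = integral {0..t} A"
  by (simp add: riccati_Suc left_factor_def right_factor_def)

lemma log_coeff_1: "log_coeff A T (Suc 0) = integral {0..T} A"
  by (simp add: log_coeff_def riccati_1)

text \<open>The factors \<open>1\<close> give the integrands the form \<open>g A h\<close> of \<open>deriv_primitive\<close>.\<close>

definition "Y1 t = integral {0..t} A"
definition "P t = integral {0..t} (\<lambda>r. 1 * A r * Y1 r)"
definition "Q t = integral {0..t} (\<lambda>r. Y1 r * A r * 1)"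
definition "AP t = integral {0..t} (\<lambda>r. 1 * A r * P r)"
definition "QA t = integral {0..t} (\<lambda>r. Q r * A r * 1)"

lemma iterated_at_0: "Y1 0 = 0" "P 0 = 0" "Q 0 = 0" "AP 0 = 0" "QA 0 = 0"
  by (simp_all add: Y1_def P_def Q_def AP_def QA_def)

lemma cont_iterated:
  "continuous_on {0..T} Y1" "continuous_on {0..T} P" "continuous_on {0..T} Q"
  "continuous_on {0..T} AP" "continuous_on {0..T} QA"
proof -
  show 1: "continuous_on {0..T} Y1"
    using cont_primitive[OF continuous_on_const continuous_on_const, of 1 1] by (simp add: Y1_def[abs_def])
  show 2: "continuous_on {0..T} P" "continuous_on {0..T} Q"
    unfolding P_def[abs_def] Q_def[abs_def] by (intro cont_primitive 1 continuous_on_const)+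
  show "continuous_on {0..T} AP" "continuous_on {0..T} QA"
    unfolding AP_def[abs_def] QA_def[abs_def] by (intro cont_primitive 2 continuous_on_const)+
qed

lemma deriv_iterated:
  assumes "t \<in> {0<..<T} - S"
  shows "(Y1 has_vector_derivative A t) (at t)" "(P has_vector_derivative A t * Y1 t) (at t)"
    "(Q has_vector_derivative Y1 t * A t) (at t)" "(AP has_vector_derivative A t * P t) (at t)"
    "(QA has_vector_derivative Q t * A t) (at t)"
  using deriv_primitive[OF continuous_on_const continuous_on_const assms, of 1 1]
    deriv_primitive[OF continuous_on_const cont_iterated(1) assms, of 1]
    deriv_primitive[OF cont_iterated(1) continuous_on_const assms, of 1]
    deriv_primitive[OF continuous_on_const cont_iterated(2) assms, of 1]
    deriv_primitive[OF cont_iterated(3) continuous_on_const assms, of 1]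
  by (simp_all add: Y1_def[abs_def] P_def[abs_def] Q_def[abs_def] AP_def[abs_def] QA_def[abs_def])

lemma eq_on_interval:
  assumes "continuous_on {0..T} f" "continuous_on {0..T} g"
    and "\<And>x. x \<in> {0<..<T} - S \<Longrightarrow> (f has_vector_derivative h x) (at x)"
    and "\<And>x. x \<in> {0<..<T} - S \<Longrightarrow> (g has_vector_derivative h x) (at x)"
    and "f 0 = g 0" and t: "t \<in> {0..T}"
  shows "f t = (g t :: 'b::banach)"
  by (rule eq_if_derivative_eq[OF _ finite_S, where u = 0 and h = h])
    (use assms in \<open>auto elim: continuous_on_subset\<close>)

text \<open>Integration by parts. At order 3 this relation turns everything of weight s (1 - s) into
  the derivative of Y1^3.\<close>

lemma Y1_squared: "t \<in> {0..T} \<Longrightarrow> Y1 t * Y1 t = P t + Q t"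
  by (rule eq_on_interval[where h = "\<lambda>t. A t * Y1 t + Y1 t * A t"])
    (auto intro!: continuous_intros cont_iterated has_vector_derivative_add deriv_iterated
      has_vector_derivative_mult[THEN has_vector_derivative_eq_rhs] simp: iterated_at_0)

lemma riccati_2:
  assumes "t \<in> {0..T}"
  shows "riccati A s (Suc (Suc 0)) t = (1 - s) *\<^sub>R P t - s *\<^sub>R Q t"
proof (rule eq_on_interval[where h = "riccati_deriv A s (Suc 0)", OF cont_riccati _ deriv_riccati_Suc _ _ assms])
  show "continuous_on {0..T} (\<lambda>t. (1 - s) *\<^sub>R P t - s *\<^sub>R Q t)"
    by (intro continuous_intros cont_iterated)
  fix x assume x: "x \<in> {0<..<T} - S"
  have "((\<lambda>t. (1 - s) *\<^sub>R P t - s *\<^sub>R Q t) has_vector_derivative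
     (1 - s) *\<^sub>R (A x * Y1 x) - s *\<^sub>R (Y1 x * A x)) (at x)"
    by (intro has_vector_derivative_diff deriv_iterated x
       bounded_linear.has_vector_derivative[OF bounded_linear_scaleR_right])
  moreover have "riccati_deriv A s (Suc 0) x = (1 - s) *\<^sub>R (A x * Y1 x) - s *\<^sub>R (Y1 x * A x)"
    by (simp add: riccati_deriv_def left_factor_def right_factor_def riccati_1 Y1_def)
  ultimately show "((\<lambda>t. (1 - s) *\<^sub>R P t - s *\<^sub>R Q t) has_vector_derivative riccati_deriv A s (Suc 0) x) (at x)"
    by simp
qed (auto simp: riccati_at_0 iterated_at_0)

lemma riccati_3:
  assumes "t \<in> {0..T}"
  shows "riccati A s (Suc (Suc (Suc 0))) t
     = (1 - s) *\<^sub>R AP t + s *\<^sub>R QA t - (s * (1 - s)) *\<^sub>R (Y1 t * Y1 t * Y1 t)"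
proof (rule eq_on_interval[where h = "riccati_deriv A s (Suc (Suc 0))", OF cont_riccati _ deriv_riccati_Suc _ _ assms])
  show "continuous_on {0..T} (\<lambda>t. (1 - s) *\<^sub>R AP t + s *\<^sub>R QA t - (s * (1 - s)) *\<^sub>R (Y1 t * Y1 t * Y1 t))"
    by (intro continuous_intros cont_iterated)
  fix x assume x: "x \<in> {0<..<T} - S"
  then have x': "x \<in> {0..T}" by auto
  let ?d = "(1 - s) *\<^sub>R (A x * P x) + s *\<^sub>R (Q x * A x)
     - (s * (1 - s)) *\<^sub>R (Y1 x * Y1 x * A x + (Y1 x * A x + A x * Y1 x) * Y1 x)"
  have "((\<lambda>t. (1 - s) *\<^sub>R AP t + s *\<^sub>R QA t - (s * (1 - s)) *\<^sub>R (Y1 t * Y1 t * Y1 t))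
      has_vector_derivative ?d) (at x)"
    by (intro has_vector_derivative_diff has_vector_derivative_add has_vector_derivative_mult deriv_iterated x
       bounded_linear.has_vector_derivative[OF bounded_linear_scaleR_right])
  moreover have "riccati_deriv A s (Suc (Suc 0)) x = (1 - s) *\<^sub>R (A x * ((1 - s) *\<^sub>R P x - s *\<^sub>R Q x))
      - (s * (1 - s)) *\<^sub>R (Y1 x * A x * Y1 x) - s *\<^sub>R (((1 - s) *\<^sub>R P x - s *\<^sub>R Q x) * A x)"
    by (simp add: riccati_deriv_def left_factor_def right_factor_def riccati_1 riccati_2[OF x'] flip: Y1_def)
  moreover have "\<dots> = (1 - s) *\<^sub>R (A x * P x) + s *\<^sub>R (Q x * A x)
     - (s * (1 - s)) *\<^sub>R ((P x + Q x) * A x + Y1 x * A x * Y1 x + A x * (P x + Q x))"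
    by (simp add: algebra_simps)
  moreover have "\<dots> = ?d"
    unfolding Y1_squared[OF x', symmetric] by (simp add: algebra_simps)
  ultimately show "((\<lambda>t. (1 - s) *\<^sub>R AP t + s *\<^sub>R QA t - (s * (1 - s)) *\<^sub>R (Y1 t * Y1 t * Y1 t))
      has_vector_derivative riccati_deriv A s (Suc (Suc 0)) x) (at x)"
    by simp
qed (auto simp: riccati_at_0 iterated_at_0)

text \<open>The classical commutator formula: P - Q is the integral of A Y1 - Y1 A.\<close>

lemma log_coeff_2: "log_coeff A T 2 = (1/2) *\<^sub>R (P T - Q T)"
proof -
  have "log_coeff A T 2 = integral {0..1} (\<lambda>s. P T + s *\<^sub>R (- P T - Q T) + s\<^sup>2 *\<^sub>R 0)"
    unfolding log_coeff_def numeral_2_eq_2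
    by (intro integral_cong) (simp add: riccati_2 T algebra_simps)
  then show ?thesis unfolding integral_quadratic by (simp only: scaleR_combine(1) scaleR_zero_right add_0_right)
qed

text \<open>The weights are the integrals of 1 - s, of s and of s (1 - s) over [0, 1].\<close>

lemma log_coeff_3:
  "log_coeff A T 3 = (1/2) *\<^sub>R (AP T + QA T) - (1/6) *\<^sub>R (Y1 T * Y1 T * Y1 T)"
proof -
  let ?Y = "Y1 T * Y1 T * Y1 T"
  have "log_coeff A T 3 = integral {0..1} (\<lambda>s. AP T + s *\<^sub>R (QA T - AP T - ?Y) + s\<^sup>2 *\<^sub>R ?Y)"
    unfolding log_coeff_def numeral_3_eq_3
    by (intro integral_cong) (simp add: riccati_3 T algebra_simps power2_eq_square)
  then show ?thesis unfolding integral_quadratic scaleR_combine(2) .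
qed

end

lemma generator_const:
  fixes B :: "'a::{real_normed_algebra_1,banach}"
  assumes "0 \<le> T" "finite S" "norm B \<le> b"
  shows "generator (\<lambda>_. B) T b S"
  by unfold_locales (use assms in \<open>auto intro!: integrable_continuous_real continuous_intros\<close>)

text \<open>The evolution is exp (l T B), so the single term of order 1 is already a logarithm
  series, and \<open>exp_powser_unique\<close> excludes any other.\<close>

lemma log_coeff_const:
  fixes B :: "'a::{real_normed_algebra_1,banach}"
  assumes T: "0 \<le> T" and n: "n \<ge> 2"
  shows "log_coeff (\<lambda>_. B) T n = 0"
proof -
  interpret generator "\<lambda>_. B" T "norm B" "{}" by (rule generator_const) (use T in auto)
  let ?b = "\<lambda>n. if n = 1 then T *\<^sub>R B else 0"
  have sb: "(\<lambda>n. l ^ n *\<^sub>R ?b n) sums (l *\<^sub>R T *\<^sub>R B)" for l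
    using sums_single[of 1 "\<lambda>n. l ^ n *\<^sub>R T *\<^sub>R B"] by (simp add: if_distrib cong: if_cong)
  define r where "r = 1 / (2 * (norm B * T + 1))"
  have "log_coeff (\<lambda>_. B) T = ?b"
  proof (rule exp_powser_unique)
    show "r > 0" using T by (simp add: r_def add_nonneg_pos)
    fix l assume "\<bar>l\<bar> < r"
    then have "\<bar>l\<bar> * (norm B * T) \<le> r * (norm B * T)" using T by (intro mult_right_mono) auto
    also have "\<dots> \<le> 1/2" using T by (simp add: r_def divide_le_eq add_nonneg_pos)
    finally have l: "\<bar>l\<bar> * norm B * T \<le> 1/2" by (simp add: mult.assoc)
    show "summable (\<lambda>n. l ^ n *\<^sub>R log_coeff (\<lambda>_. B) T n)" by (rule exp_log_coeff[OF l])
    show "summable (\<lambda>n. l ^ n *\<^sub>R ?b n)" using sb by (rule sums_summable)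
    have "(\<lambda>n. l ^ n *\<^sub>R dyson (\<lambda>_. B) n T) sums exp (T *\<^sub>R (l *\<^sub>R B))"
    proof (rule dyson_sums_solution[OF l _ _ finite.emptyI])
      show "((\<lambda>t. exp (t *\<^sub>R (l *\<^sub>R B))) has_vector_derivative l *\<^sub>R (B * exp (t *\<^sub>R (l *\<^sub>R B)))) (at t)" for t
        using exp_scaleR_has_vector_derivative_left[of "l *\<^sub>R B" t] by simp
      show "continuous_on {0..T} (\<lambda>t. exp (t *\<^sub>R (l *\<^sub>R B)))"
        by (intro continuous_at_imp_continuous_on ballI
            has_vector_derivative_continuous[OF exp_scaleR_has_vector_derivative_left])
    qed simp
    then show "exp (\<Sum>n. l ^ n *\<^sub>R log_coeff (\<lambda>_. B) T n) = exp (\<Sum>n. l ^ n *\<^sub>R ?b n)"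
      using exp_log_coeff(2)[OF l] sb[of l] by (simp add: sums_iff mult.commute)
  qed (simp_all add: log_coeff_0)
  then show ?thesis using n by simp
qed

lemma power_diff_le:
  fixes b J :: real
  assumes "0 \<le> b" "0 \<le> J"
  shows "(b + J) ^ n - b ^ n \<le> n * J * (b + J) ^ (n - 1)"
  using norm_power_diff_le[of "b + J" "b + J" b n] assms by (simp add: mult_ac)

text \<open>First-order decoupling puts the toggling-frame Hamiltonian in this form, with \<open>B\<close> its bath part.\<close>

locale split_generator = generator A T "b + J" S
  for A :: "real \<Rightarrow> 'a::{real_normed_algebra_1,banach}" and T b J :: real and S :: "real set" +
  fixes B :: 'a
  assumes norm_B: "norm B \<le> b"
    and norm_E: "\<And>t. t \<in> {0..T} \<Longrightarrow> norm (A t - B) \<le> J"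
    and average: "integral {0..T} A = T *\<^sub>R B"
begin

lemma b_nonneg: "0 \<le> b"
  using norm_B norm_ge_zero[of B] by linarith

lemma J_nonneg: "0 \<le> J"
proof -
  have "norm (A 0 - B) \<le> J" using T by (intro norm_E) simp
  then show ?thesis using norm_ge_zero[of "A 0 - B"] by linarith
qed

section \<open>Splitting a generator into its mean and an error\<close>

definition "E t = A t - B"

lemma norm_E': "t \<in> {0..T} \<Longrightarrow> norm (E t) \<le> J"
  using norm_E by (simp add: E_def)

definition "F t = Y1 t - t *\<^sub>R B"
definition "\<Phi> t = integral {0..t} F"
definition "\<Psi> t = integral {0..t} \<Phi>"
text \<open>After inserting A = B + E and Y1 = t B + F, \<open>N\<close> and \<open>M\<close> are
  the parts of \<open>P\<close> and \<open>Q\<close> quadratic in E, with derivatives E F and F E.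
  What is subtracted are the terms of degree 0 and 1, where t F - \<Phi> is the integral of t
  E.\<close>

definition "N t = P t - ((t\<^sup>2 / 2) *\<^sub>R (B * B) + B * \<Phi> t + (t *\<^sub>R F t - \<Phi> t) * B)"
definition "M t = Q t - ((t\<^sup>2 / 2) *\<^sub>R (B * B) + \<Phi> t * B + B * (t *\<^sub>R F t - \<Phi> t))"

lemma cont_F: "continuous_on {0..T} F"
  unfolding F_def[abs_def] by (intro continuous_intros cont_iterated)

lemma cont_\<Phi>: "continuous_on {0..T} \<Phi>"
  using indefinite_integral_continuous_1[OF integrable_continuous_real[OF cont_F]]
  by (simp only: \<Phi>_def[abs_def])

lemma cont_\<Psi>: "continuous_on {0..T} \<Psi>"
  using indefinite_integral_continuous_1[OF integrable_continuous_real[OF cont_\<Phi>]]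
  by (simp only: \<Psi>_def[abs_def])

lemma cont_NM: "continuous_on {0..T} N" "continuous_on {0..T} M"
  unfolding N_def[abs_def] M_def[abs_def]
  by (intro continuous_intros cont_iterated cont_F cont_\<Phi>; simp)+

lemmas cont_split = cont_F cont_\<Phi> cont_\<Psi> cont_NM

lemma split_at_0: "F 0 = 0" "\<Phi> 0 = 0" "\<Psi> 0 = 0" "N 0 = 0" "M 0 = 0"
  by (simp_all add: F_def \<Phi>_def \<Psi>_def N_def M_def iterated_at_0)

lemma F_T: "F T = 0"
  using average by (simp add: F_def Y1_def)

lemma deriv_integral_cont:
  assumes f: "continuous_on {0..T} f" and t: "t \<in> {0<..<T} - S"
  shows "((\<lambda>u. integral {0..u} f) has_vector_derivative (f t :: 'a)) (at t)"
proof -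
  have "((\<lambda>u. integral {0..u} f) has_vector_derivative f t) (at t within {0..T})"
    by (rule integral_has_vector_derivative[OF f]) (use t in auto)
  moreover have "at t within {0..T} = at t"
    by (rule at_within_nhd[of _ "{0<..<T}"]) (use t in auto)
  ultimately show ?thesis by simp
qed

lemma deriv_split:
  assumes t: "t \<in> {0<..<T} - S"
  shows "(F has_vector_derivative E t) (at t)" "(\<Phi> has_vector_derivative F t) (at t)"
    "(\<Psi> has_vector_derivative \<Phi> t) (at t)"
proof -
  show "(F has_vector_derivative E t) (at t)"
    unfolding F_def[abs_def] E_def
    by (rule has_vector_derivative_diff[OF deriv_iterated(1)[OF t]]) (auto intro!: derivative_eq_intros)
  show "(\<Phi> has_vector_derivative F t) (at t)" "(\<Psi> has_vector_derivative \<Phi> t) (at t)"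
    using deriv_integral_cont[OF cont_F t] deriv_integral_cont[OF cont_\<Phi> t]
    by (simp_all only: \<Phi>_def[abs_def] \<Psi>_def[abs_def])
qed

lemma deriv_tF:
  assumes t: "t \<in> {0<..<T} - S"
  shows "((\<lambda>t. t *\<^sub>R F t - \<Phi> t) has_vector_derivative t *\<^sub>R E t) (at t)"
proof -
  have "((\<lambda>t. t *\<^sub>R F t) has_vector_derivative t *\<^sub>R E t + 1 *\<^sub>R F t) (at t)"
    by (rule has_vector_derivative_scaleR) (auto intro!: deriv_split t derivative_eq_intros)
  from has_vector_derivative_diff[OF this deriv_split(2)[OF t]] show ?thesis by simp
qed

lemma deriv_NM:
  assumes t: "t \<in> {0<..<T} - S"
  shows "(N has_vector_derivative E t * F t) (at t)" "(M has_vector_derivative F t * E t) (at t)"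
proof -
  have sq: "((\<lambda>t. (t\<^sup>2 / 2) *\<^sub>R (B * B)) has_vector_derivative t *\<^sub>R (B * B)) (at t)"
    by (auto intro!: derivative_eq_intros)
  note l = has_vector_derivative_const_mult
  have "(N has_vector_derivative A t * Y1 t - (t *\<^sub>R (B * B) + B * F t + (t *\<^sub>R E t) * B)) (at t)"
    unfolding N_def[abs_def]
    by (intro has_vector_derivative_diff has_vector_derivative_add l sq deriv_tF deriv_split deriv_iterated t)
  moreover have "A t * Y1 t - (t *\<^sub>R (B * B) + B * F t + (t *\<^sub>R E t) * B) = E t * F t"
    by (simp add: E_def F_def algebra_simps)
  ultimately show "(N has_vector_derivative E t * F t) (at t)" by simp
  have "(M has_vector_derivative Y1 t * A t - (t *\<^sub>R (B * B) + F t * B + B * (t *\<^sub>R E t))) (at t)"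
    unfolding M_def[abs_def]
    by (intro has_vector_derivative_diff has_vector_derivative_add l sq deriv_tF deriv_split deriv_iterated t)
  moreover have "Y1 t * A t - (t *\<^sub>R (B * B) + F t * B + B * (t *\<^sub>R E t)) = F t * E t"
    by (simp add: E_def F_def algebra_simps)
  ultimately show "(M has_vector_derivative F t * E t) (at t)" by simp
qed

lemma norm_bound_on:
  fixes f :: "real \<Rightarrow> 'b::banach"
  assumes "0 \<le> u" "u \<le> v" "v \<le> T" "continuous_on {0..T} f"
    and f: "\<And>x. x \<in> {0<..<T} - S \<Longrightarrow> (f has_vector_derivative f' x) (at x)"
    and g: "\<And>x. (g has_real_derivative g' x) (at x)"
    and le: "\<And>x. x \<in> {u..v} \<Longrightarrow> x \<in> {0..T} \<Longrightarrow> norm (f' x) \<le> g' x"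
  shows "norm (f v - f u) \<le> g v - g u"
proof (rule norm_diff_le_if_derivative_le[OF \<open>u \<le> v\<close> finite_S, where f' = f' and g' = g'])
  show "continuous_on {u..v} f" using assms(4) by (rule continuous_on_subset) (use assms in auto)
  show "continuous_on {u..v} g"
    by (meson g DERIV_isCont continuous_at_imp_continuous_on)
qed (use assms in auto)

lemma norm_F:
  assumes t: "t \<in> {0..T}"
  shows "norm (F t) \<le> J * t" "norm (F t) \<le> J * (T - t)"
proof -
  have "norm (F t - F 0) \<le> J * t - J * 0"
    by (rule norm_bound_on[where f' = E and g' = "\<lambda>_. J"])
      (use t in \<open>auto intro!: cont_split deriv_split derivative_eq_intros norm_E'\<close>)
  then show "norm (F t) \<le> J * t" by (simp add: split_at_0)
  have "norm (F T - F t) \<le> J * T - J * t"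
    by (rule norm_bound_on[where f' = E and g' = "\<lambda>_. J"])
      (use t in \<open>auto intro!: cont_split deriv_split derivative_eq_intros norm_E'\<close>)
  then show "norm (F t) \<le> J * (T - t)" by (simp add: F_T algebra_simps)
qed

lemma norm_split:
  assumes t: "t \<in> {0..T}"
  shows "norm (\<Phi> t) \<le> J * t\<^sup>2 / 2" "norm (t *\<^sub>R F t - \<Phi> t) \<le> J * t\<^sup>2 / 2"
    "norm (N t) \<le> J\<^sup>2 * t\<^sup>2 / 2" "norm (M t) \<le> J\<^sup>2 * t\<^sup>2 / 2"
proof -
  have g: "((\<lambda>x. c * x\<^sup>2 / 2) has_real_derivative c * x) (at x)" for c x :: real
    by (auto intro!: derivative_eq_intros)
  have b: "norm (f t) \<le> c * t\<^sup>2 / 2"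
    if "continuous_on {0..T} f" "\<And>x. x \<in> {0<..<T} - S \<Longrightarrow> (f has_vector_derivative f' x) (at x)"
      "\<And>x. x \<in> {0..T} \<Longrightarrow> norm (f' x) \<le> c * x" "f 0 = 0" for f f' :: "real \<Rightarrow> 'a" and c
    using norm_bound_on[of 0 t f f' "\<lambda>x. c * x\<^sup>2 / 2", OF _ _ _ that(1,2) g that(3)] t that(4) by simp
  have E: "norm (E x) \<le> J" if "x \<in> {0..T}" for x using norm_E[OF that] by (simp add: E_def)
  show "norm (\<Phi> t) \<le> J * t\<^sup>2 / 2"
    by (rule b[OF cont_split(2) deriv_split(2) norm_F(1) split_at_0(2)])
  have "norm ((\<lambda>t. t *\<^sub>R F t - \<Phi> t) t) \<le> J * t\<^sup>2 / 2"
  proof (rule b[OF _ deriv_tF])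
    show "continuous_on {0..T} (\<lambda>t. t *\<^sub>R F t - \<Phi> t)" by (intro continuous_intros cont_split)
    show "norm (x *\<^sub>R E x) \<le> J * x" if "x \<in> {0..T}" for x
      using mult_left_mono[OF E[OF that], of x] that by (simp add: mult.commute)
    show "0 *\<^sub>R F 0 - \<Phi> 0 = 0" by (simp add: split_at_0)
  qed
  then show "norm (t *\<^sub>R F t - \<Phi> t) \<le> J * t\<^sup>2 / 2" .
  have EF: "norm (E x * F x) \<le> J\<^sup>2 * x" "norm (F x * E x) \<le> J\<^sup>2 * x" if x: "x \<in> {0..T}" for x
  proof -
    have "norm (E x) * norm (F x) \<le> J * (J * x)"
      using E[OF x] norm_F(1)[OF x] J_nonneg by (intro mult_mono) auto
    then show "norm (E x * F x) \<le> J\<^sup>2 * x" "norm (F x * E x) \<le> J\<^sup>2 * x"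
      using norm_mult_ineq[of "E x" "F x"] norm_mult_ineq[of "F x" "E x"]
      by (auto simp: power2_eq_square mult_ac)
  qed
  show "norm (N t) \<le> J\<^sup>2 * t\<^sup>2 / 2"
    by (rule b[OF cont_split(4) deriv_NM(1) EF(1) split_at_0(4)])
  show "norm (M t) \<le> J\<^sup>2 * t\<^sup>2 / 2"
    by (rule b[OF cont_split(5) deriv_NM(2) EF(2) split_at_0(5)])
qed

text \<open>\<open>F\<close> vanishes at both ends, so it is bounded by \<open>J min(t, T - t)\<close>; this is what makes the
  constants small, and is why the interval is cut in the middle.\<close>

lemma norm_bound_halves:
  fixes f :: "real \<Rightarrow> 'b::banach"
  assumes "continuous_on {0..T} f"
    and f: "\<And>x. x \<in> {0<..<T} - S \<Longrightarrow> (f has_vector_derivative f' x) (at x)"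
    and g: "\<And>x. (g has_real_derivative g' x) (at x)" "\<And>x. (h has_real_derivative h' x) (at x)"
    and le: "\<And>x. x \<in> {0..T} \<Longrightarrow> x \<le> T/2 \<Longrightarrow> norm (f' x) \<le> g' x"
      "\<And>x. x \<in> {0..T} \<Longrightarrow> T/2 \<le> x \<Longrightarrow> norm (f' x) \<le> h' x"
    and "f 0 = 0"
  shows "norm (f T) \<le> (g (T/2) - g 0) + (h T - h (T/2))"
proof -
  have "norm (f (T/2) - f 0) \<le> g (T/2) - g 0"
    by (rule norm_bound_on[OF _ _ _ assms(1) f g(1)]) (use T le in auto)
  moreover have "norm (f T - f (T/2)) \<le> h T - h (T/2)"
    by (rule norm_bound_on[OF _ _ _ assms(1) f g(2)]) (use T le in auto)
  ultimately show ?thesis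
    using norm_triangle_ineq[of "f (T/2)" "f T - f (T/2)"] \<open>f 0 = 0\<close> by simp
qed

text \<open>The tent min(t, T - t) has area T^2 / 4, half of what the bound t alone would give. The
  quantified \<open>m\<close> stands for either flank.\<close>

lemma norm_bound_tent:
  fixes f :: "real \<Rightarrow> 'b::banach"
  assumes "continuous_on {0..T} f"
    and f: "\<And>x. x \<in> {0<..<T} - S \<Longrightarrow> (f has_vector_derivative f' x) (at x)"
    and le: "\<And>x m. x \<in> {0..T} \<Longrightarrow> norm (F x) \<le> J * m \<Longrightarrow> norm (f' x) \<le> c * m"
    and "f 0 = 0"
  shows "norm (f T) \<le> c * T\<^sup>2 / 4"
proof -
  have "norm (f T) \<le> (c * (T/2)\<^sup>2 / 2 - c * 0\<^sup>2 / 2) + (- (c * (T - T)\<^sup>2 / 2) - - (c * (T - T/2)\<^sup>2 / 2))"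
  proof (rule norm_bound_halves[OF assms(1,2)])
    show "((\<lambda>x. c * x\<^sup>2 / 2) has_real_derivative c * x) (at x)" for x
      by (auto intro!: derivative_eq_intros)
    show "((\<lambda>x. - (c * (T - x)\<^sup>2 / 2)) has_real_derivative c * (T - x)) (at x)" for x
      by (auto intro!: derivative_eq_intros simp: field_simps)
  qed (use assms norm_F in auto)
  then show ?thesis by (simp add: power2_eq_square field_simps)
qed

lemma norm_\<Phi>_T: "norm (\<Phi> T) \<le> J * T\<^sup>2 / 4"
  by (rule norm_bound_tent[OF cont_split(2) deriv_split(2) _ split_at_0(2)])

lemma norm_NM_T: "norm (N T - M T) \<le> J\<^sup>2 * T\<^sup>2 / 2"
proof -
  have "norm ((\<lambda>t. N t - M t) T) \<le> (2 * J\<^sup>2) * T\<^sup>2 / 4"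
  proof (rule norm_bound_tent[OF _ has_vector_derivative_diff[OF deriv_NM]])
    fix x m assume x: "x \<in> {0..T}" "norm (F x) \<le> J * m"
    have "norm (E x) * norm (F x) \<le> J * (J * m)"
      using norm_E'[OF x(1)] x(2) J_nonneg by (intro mult_mono) auto
    then show "norm (E x * F x - F x * E x) \<le> 2 * J\<^sup>2 * m"
      using norm_mult_ineq[of "E x" "F x"] norm_mult_ineq[of "F x" "E x"]
        norm_triangle_ineq4[of "E x * F x" "F x * E x"] by (simp add: mult_ac power2_eq_square)
  qed (auto intro: continuous_on_diff cont_split simp: split_at_0)
  then show ?thesis by simp
qed

text \<open>F T = 0 leaves only \<open>\<Phi> T\<close> of the linear parts, and \<open>P\<close>
  and \<open>Q\<close> contribute the same commutator, which cancels the factor 1/2.\<close>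

lemma log_coeff_2_eq: "log_coeff A T 2 = (B * \<Phi> T - \<Phi> T * B) + (1/2) *\<^sub>R (N T - M T)"
proof -
  have "P T - Q T = 2 *\<^sub>R (B * \<Phi> T - \<Phi> T * B) + (N T - M T)"
    by (simp add: N_def M_def F_T scaleR_2 algebra_simps)
  then show ?thesis unfolding log_coeff_2 by (simp add: scaleR_add_right)
qed

text \<open>The commutator costs b J T^2 / 2 thanks to the tent bound for \<open>\<Phi> T\<close>;
  the bound from one side only would give b J T^2.\<close>

lemma norm_log_coeff_2: "norm (log_coeff A T 2) \<le> J * (b + J) * T\<^sup>2 / 2"
proof -
  have "norm (B * \<Phi> T) \<le> b * (J * T\<^sup>2 / 4)" "norm (\<Phi> T * B) \<le> (J * T\<^sup>2 / 4) * b"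
    using norm_B norm_\<Phi>_T b_nonneg J_nonneg
    by (intro order_trans[OF norm_mult_ineq] mult_mono; simp)+
  then have "norm (B * \<Phi> T - \<Phi> T * B) \<le> 2 * (b * (J * T\<^sup>2 / 4))"
    using norm_triangle_ineq4[of "B * \<Phi> T" "\<Phi> T * B"] by (simp add: mult_ac)
  moreover have "norm ((1/2) *\<^sub>R (N T - M T)) \<le> J\<^sup>2 * T\<^sup>2 / 4" using norm_NM_T by simp
  ultimately have "norm (log_coeff A T 2) \<le> 2 * (b * (J * T\<^sup>2 / 4)) + J\<^sup>2 * T\<^sup>2 / 4"
    unfolding log_coeff_2_eq by (rule norm_triangle_mono)
  also have "\<dots> \<le> J * (b + J) * T\<^sup>2 / 2"
    using J_nonneg by (simp add: power2_eq_square algebra_simps)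
  finally show ?thesis .
qed

text \<open>Order 2 is built by integration from commutators of B with E and of E with E. A map that
  annihilates these annihilates the primitives too, so the vanishing climbs from E to F, \<Phi> and
  N - M. Later \<open>p\<close> is the bath projection.\<close>

lemma annihilate_log_coeff_2:
  fixes p :: "'a \<Rightarrow> 'b::banach"
  assumes p: "bounded_linear p"
    and EE: "\<And>t r. t \<in> {0..T} \<Longrightarrow> r \<in> {0..T} \<Longrightarrow> p ((A t - B) * (A r - B)) = p ((A r - B) * (A t - B))"
    and BE: "\<And>t. t \<in> {0..T} \<Longrightarrow> p (B * (A t - B)) = p ((A t - B) * B)"
  shows "p (log_coeff A T 2) = 0"
proof -
  interpret p: bounded_linear p by fact
  have EE': "p (E t * E r) = p (E r * E t)" if "t \<in> {0..T}" "r \<in> {0..T}" for t r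
    using EE[OF that] by (simp add: E_def)
  have BE': "p (B * E t) = p (E t * B)" if "t \<in> {0..T}" for t
    using BE[OF that] by (simp add: E_def)
  have zero: "p (f t) = 0"
    if "continuous_on {0..T} f" "\<And>x. x \<in> {0<..<T} - S \<Longrightarrow> (f has_vector_derivative f' x) (at x)"
     "\<And>x. x \<in> {0..T} \<Longrightarrow> p (f' x) = 0" "f 0 = 0" "t \<in> {0..T}" for f f' t
    by (rule eq_on_interval[where g = "\<lambda>_. 0" and h = "\<lambda>_. 0"])
      (use that p.has_vector_derivative[OF that(2)] p.zero p.continuous_on in auto)
  have comm: "((\<lambda>x. C * f x - f x * C) has_vector_derivative C * d - d * C) (at x)"
    if "(f has_vector_derivative d) (at x)" for f d x and C :: 'a
    using has_vector_derivative_diff[OF has_vector_derivative_const_mult[OF that]] .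
  have BF: "p (B * F t - F t * B) = 0" if "t \<in> {0..T}" for t
    by (rule zero[where f' = "\<lambda>x. B * E x - E x * B"])
      (use that BE' in \<open>auto intro!: continuous_intros cont_split comm deriv_split simp: p.diff split_at_0\<close>)
  have "p (B * \<Phi> T - \<Phi> T * B) = 0"
    by (rule zero[where f' = "\<lambda>x. B * F x - F x * B"])
      (use T BF in \<open>auto intro!: continuous_intros cont_split comm deriv_split simp: split_at_0\<close>)
  moreover have EF: "p (E r * F t - F t * E r) = 0" if "r \<in> {0..T}" "t \<in> {0..T}" for r t
    by (rule zero[where f' = "\<lambda>x. E r * E x - E x * E r"])
      (use that EE' in \<open>auto intro!: continuous_intros cont_split comm deriv_split simp: p.diff split_at_0\<close>)
  have "p (N T - M T) = 0"
    by (rule zero[where f' = "\<lambda>x. E x * F x - F x * E x"])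
      (use T EF in \<open>auto intro!: continuous_intros cont_split has_vector_derivative_diff deriv_NM simp: split_at_0\<close>)
  ultimately show ?thesis unfolding log_coeff_2_eq by (simp add: p.add p.scaleR)
qed

text \<open>With \<open>\<Theta> = t \<Phi> - 2 \<Psi>\<close> the primitive of \<open>t F - \<Phi>\<close>, this is the primitive of
  \<open>B (B \<Phi> + (t F - \<Phi>) B) + (\<Phi> B + B (t F - \<Phi>)) B + (t\<^sup>2 / 2) (E B\<^sup>2 + B\<^sup>2 E)\<close>, the part of
  \<open>A P + Q A\<close> linear in \<open>E\<close>.\<close>

definition "\<Theta> t = t *\<^sub>R \<Phi> t - 2 *\<^sub>R \<Psi> t"
definition "L t = (t\<^sup>2 / 2) *\<^sub>R F t - \<Theta> t"
definition "lin t = B * B * L t + L t * (B * B) + 2 *\<^sub>R (B * \<Theta> t * B)"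
definition "rest t = AP t + QA t - (t ^ 3 / 3) *\<^sub>R (B * B * B) - lin t"

lemma cont_rest: "continuous_on {0..T} \<Theta>" "continuous_on {0..T} L" "continuous_on {0..T} rest"
  unfolding \<Theta>_def[abs_def] L_def[abs_def] lin_def[abs_def] rest_def[abs_def]
  by (intro continuous_intros cont_split cont_iterated; simp)+

lemma deriv_rest:
  assumes t: "t \<in> {0<..<T} - S"
  shows "(\<Theta> has_vector_derivative t *\<^sub>R F t - \<Phi> t) (at t)"
    and "(rest has_vector_derivative B * N t + M t * B + E t * (B * \<Phi> t + (t *\<^sub>R F t - \<Phi> t) * B)
       + (\<Phi> t * B + B * (t *\<^sub>R F t - \<Phi> t)) * E t + E t * N t + M t * E t) (at t)"
proof -
  note sc = bounded_linear.has_vector_derivative[OF bounded_linear_scaleR_right]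
  note l = has_vector_derivative_const_mult
  have "((\<lambda>t. t *\<^sub>R \<Phi> t) has_vector_derivative t *\<^sub>R F t + 1 *\<^sub>R \<Phi> t) (at t)"
    by (rule has_vector_derivative_scaleR) (auto intro!: deriv_split t derivative_eq_intros)
  from has_vector_derivative_diff[OF this sc[OF deriv_split(3)[OF t], of 2]]
  show \<Theta>: "(\<Theta> has_vector_derivative t *\<^sub>R F t - \<Phi> t) (at t)"
    by (simp add: \<Theta>_def[abs_def] scaleR_2)
  have "((\<lambda>t. (t\<^sup>2 / 2) *\<^sub>R F t) has_vector_derivative (t\<^sup>2 / 2) *\<^sub>R E t + t *\<^sub>R F t) (at t)"
    by (rule has_vector_derivative_scaleR) (auto intro!: deriv_split t derivative_eq_intros)
  from has_vector_derivative_diff[OF this \<Theta>]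
  have L: "(L has_vector_derivative (t\<^sup>2 / 2) *\<^sub>R E t + \<Phi> t) (at t)"
    by (simp add: L_def[abs_def])
  have cube: "((\<lambda>t. (t ^ 3 / 3) *\<^sub>R (B * B * B)) has_vector_derivative t\<^sup>2 *\<^sub>R (B * B * B)) (at t)"
    by (auto intro!: derivative_eq_intros)
  let ?d = "A t * P t + Q t * A t - t\<^sup>2 *\<^sub>R (B * B * B)
     - (B * B * ((t\<^sup>2 / 2) *\<^sub>R E t + \<Phi> t) + ((t\<^sup>2 / 2) *\<^sub>R E t + \<Phi> t) * (B * B)
        + 2 *\<^sub>R (B * (t *\<^sub>R F t - \<Phi> t) * B))"
  have "(rest has_vector_derivative ?d) (at t)"
    unfolding rest_def[abs_def] lin_def
    by (intro has_vector_derivative_diff has_vector_derivative_add l L sc cube \<Theta> deriv_iterated t)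
  moreover have "?d = B * N t + M t * B + E t * (B * \<Phi> t + (t *\<^sub>R F t - \<Phi> t) * B)
       + (\<Phi> t * B + B * (t *\<^sub>R F t - \<Phi> t)) * E t + E t * N t + M t * E t"
  proof -
    have A: "A t = B + E t" by (simp add: E_def)
    have P: "P t = (t\<^sup>2 / 2) *\<^sub>R (B * B) + B * \<Phi> t + (t *\<^sub>R F t - \<Phi> t) * B + N t" by (simp add: N_def)
    have Q: "Q t = (t\<^sup>2 / 2) *\<^sub>R (B * B) + \<Phi> t * B + B * (t *\<^sub>R F t - \<Phi> t) + M t" by (simp add: M_def)
    have half: "t\<^sup>2 *\<^sub>R (B * B * B) = (t\<^sup>2 / 2) *\<^sub>R (B * B * B) + (t\<^sup>2 / 2) *\<^sub>R (B * B * B)"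
      by (simp flip: scaleR_add_left)
    show ?thesis unfolding half A P Q by (simp add: algebra_simps scaleR_2 flip: scaleR_scaleR)
  qed
  ultimately show "(rest has_vector_derivative B * N t + M t * B + E t * (B * \<Phi> t + (t *\<^sub>R F t - \<Phi> t) * B)
       + (\<Phi> t * B + B * (t *\<^sub>R F t - \<Phi> t)) * E t + E t * N t + M t * E t) (at t)" by simp
qed

text \<open>Each summand of the expanded derivative is at least quadratic in E, so the plain bounds
  suffice: six summands are at most b J^2 t^2 / 2 and two at most J^3 t^2 / 2.\<close>

lemma norm_rest: "norm (rest T) \<le> (b * J\<^sup>2 + J ^ 3 / 3) * T ^ 3"
proof -
  have "norm (rest T - rest 0) \<le> (b * J\<^sup>2 + J ^ 3 / 3) * T ^ 3 - (b * J\<^sup>2 + J ^ 3 / 3) * 0 ^ 3"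
  proof (rule norm_bound_on[OF _ T _ cont_rest(3) deriv_rest(2)])
    show "((\<lambda>x. (b * J\<^sup>2 + J ^ 3 / 3) * x ^ 3) has_real_derivative (3 * b * J\<^sup>2 + J ^ 3) * x\<^sup>2) (at x)" for x
      by (auto intro!: derivative_eq_intros simp: field_simps)
    fix t assume t: "t \<in> {0..T}"
    let ?q = "J * t\<^sup>2 / 2" and ?n = "J\<^sup>2 * t\<^sup>2 / 2"
    note n = norm_split[OF t] and E = norm_E'[OF t]
    have "norm (B * N t + M t * B + E t * (B * \<Phi> t + (t *\<^sub>R F t - \<Phi> t) * B)
       + (\<Phi> t * B + B * (t *\<^sub>R F t - \<Phi> t)) * E t + E t * N t + M t * E t)
      \<le> b * ?n + ?n * b + J * (b * ?q + ?q * b) + (?q * b + b * ?q) * J + J * ?n + ?n * J"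
      by (intro norm_triangle_mono norm_mult_mono n E norm_B)
    also have "\<dots> = (3 * b * J\<^sup>2 + J ^ 3) * t\<^sup>2"
      by (simp add: power2_eq_square power3_eq_cube field_simps)
    finally show "norm (B * N t + M t * B + E t * (B * \<Phi> t + (t *\<^sub>R F t - \<Phi> t) * B)
       + (\<Phi> t * B + B * (t *\<^sub>R F t - \<Phi> t)) * E t + E t * N t + M t * E t)
      \<le> (3 * b * J\<^sup>2 + J ^ 3) * t\<^sup>2" .
  qed auto
  then show ?thesis by (simp add: rest_def lin_def L_def \<Theta>_def iterated_at_0 split_at_0)
qed

text \<open>By parts, - \<Theta> T is the integral of (T - 2 t) F. The weight |T - 2 t| times the
  tent min(t, T - t) integrates to T^3 / 24 on each half.\<close>

lemma norm_\<Theta>_T: "norm (\<Theta> T) \<le> J * T ^ 3 / 12"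
proof -
  have deriv: "((\<lambda>t. (T - 2 * t) *\<^sub>R \<Phi> t + 2 *\<^sub>R \<Psi> t) has_vector_derivative (T - 2 * t) *\<^sub>R F t) (at t)"
    if t: "t \<in> {0<..<T} - S" for t
  proof -
    have "((\<lambda>t. (T - 2 * t) *\<^sub>R \<Phi> t) has_vector_derivative (T - 2 * t) *\<^sub>R F t + (- 2) *\<^sub>R \<Phi> t) (at t)"
      by (rule has_vector_derivative_scaleR) (auto intro!: deriv_split t derivative_eq_intros)
    from has_vector_derivative_add[OF this bounded_linear.has_vector_derivative[OF bounded_linear_scaleR_right
          deriv_split(3)[OF t], of 2]]
    show ?thesis by simp
  qed
  have "norm ((\<lambda>t. (T - 2 * t) *\<^sub>R \<Phi> t + 2 *\<^sub>R \<Psi> t) T)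
    \<le> (J * (T * (T/2)\<^sup>2 / 2 - 2 * (T/2) ^ 3 / 3) - J * (T * 0\<^sup>2 / 2 - 2 * 0 ^ 3 / 3))
     + (J * (- 2 * T ^ 3 / 3 + 3 * T * T\<^sup>2 / 2 - T\<^sup>2 * T)
        - J * (- 2 * (T/2) ^ 3 / 3 + 3 * T * (T/2)\<^sup>2 / 2 - T\<^sup>2 * (T/2)))"
  proof (rule norm_bound_halves[OF _ deriv])
    show "continuous_on {0..T} (\<lambda>t. (T - 2 * t) *\<^sub>R \<Phi> t + 2 *\<^sub>R \<Psi> t)"
      by (intro continuous_intros cont_split)
    show "((\<lambda>x. J * (T * x\<^sup>2 / 2 - 2 * x ^ 3 / 3)) has_real_derivative (T - 2 * x) * (J * x)) (at x)" for x
      by (auto intro!: derivative_eq_intros simp: field_simps power2_eq_square)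
    show "((\<lambda>x. J * (- 2 * x ^ 3 / 3 + 3 * T * x\<^sup>2 / 2 - T\<^sup>2 * x))
        has_real_derivative (2 * x - T) * (J * (T - x))) (at x)" for x
      by (auto intro!: derivative_eq_intros simp: field_simps power2_eq_square)
    show "(T - 2 * 0) *\<^sub>R \<Phi> 0 + 2 *\<^sub>R \<Psi> 0 = 0" by (simp add: split_at_0)
    fix x assume x: "x \<in> {0..T}"
    show "norm ((T - 2 * x) *\<^sub>R F x) \<le> (T - 2 * x) * (J * x)" if "x \<le> T/2"
      using that norm_F(1)[OF x] by (simp add: mult_left_mono)
    have "norm ((T - 2 * x) *\<^sub>R F x) \<le> \<bar>T - 2 * x\<bar> * (J * (T - x))"
      using norm_F(2)[OF x] by (simp add: mult_left_mono)
    then show "norm ((T - 2 * x) *\<^sub>R F x) \<le> (2 * x - T) * (J * (T - x))" if "T/2 \<le> x"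
      using that by simp
  qed
  also have "\<dots> = J * T ^ 3 / 12" by (simp add: power2_eq_square power3_eq_cube field_simps)
  also have "(T - 2 * T) *\<^sub>R \<Phi> T + 2 *\<^sub>R \<Psi> T = - \<Theta> T" by (simp add: \<Theta>_def)
  finally show ?thesis by simp
qed

text \<open>Since Y1 T = T B, the terms in B^3 cancel, and F T = 0 reduces the linear part to
  \<open>\<Theta> T\<close>.\<close>

lemma norm_log_coeff_3: "norm (log_coeff A T 3) \<le> 2/9 * J * (b + J)\<^sup>2 * T ^ 3"
proof -
  have YT: "Y1 T = T *\<^sub>R B" using F_T by (simp add: F_def)
  have lin: "lin T = 2 *\<^sub>R (B * \<Theta> T * B) - (B * B * \<Theta> T + \<Theta> T * (B * B))"
    by (simp add: lin_def L_def F_T)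
  have sum: "AP T + QA T = rest T + (T ^ 3 / 3) *\<^sub>R (B * B * B) + lin T"
    by (simp add: rest_def)
  have "log_coeff A T 3 = (1/2) *\<^sub>R (rest T + lin T)"
    unfolding log_coeff_3 YT sum by (simp add: scaleR_add_right power3_eq_cube mult.assoc)
  also have "norm \<dots> \<le> (1/2) * ((b * J\<^sup>2 + J ^ 3 / 3) * T ^ 3 + 4 * (b * b * (J * T ^ 3 / 12)))"
  proof -
    let ?\<theta> = "J * T ^ 3 / 12"
    have "norm (2 *\<^sub>R (B * \<Theta> T * B)) \<le> 2 * (b * ?\<theta> * b)"
      unfolding norm_scaleR using norm_mult_mono[OF norm_mult_mono[OF norm_B norm_\<Theta>_T] norm_B] by (intro mult_mono) auto
    moreover have "norm (B * B * \<Theta> T + \<Theta> T * (B * B)) \<le> b * b * ?\<theta> + ?\<theta> * (b * b)"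
      by (intro norm_triangle_mono norm_mult_mono norm_B norm_\<Theta>_T)
    ultimately have "norm (lin T) \<le> 4 * (b * b * ?\<theta>)"
      unfolding lin using norm_triangle_ineq4[of "2 *\<^sub>R (B * \<Theta> T * B)" "B * B * \<Theta> T + \<Theta> T * (B * B)"]
      by (simp add: mult_ac)
    from norm_triangle_mono[OF norm_rest this] show ?thesis by simp
  qed
  also have "\<dots> = (b\<^sup>2 / 6 + b * J / 2 + J\<^sup>2 / 6) * (J * T ^ 3)"
    by (simp add: power2_eq_square power3_eq_cube field_simps)
  also have "\<dots> \<le> (2/9 * (b + J)\<^sup>2) * (J * T ^ 3)"
  proof (rule mult_right_mono)
    \<comment> \<open>The difference of the two sides of the claim is ((b - J)^2 + b J) /
      18.\<close>
    have "0 \<le> (b - J)\<^sup>2 + b * J" using b_nonneg J_nonneg by simp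
    then show "b\<^sup>2 / 6 + b * J / 2 + J\<^sup>2 / 6 \<le> 2/9 * (b + J)\<^sup>2"
      by (simp add: power2_eq_square field_simps)
  qed (use J_nonneg T in simp)
  finally show ?thesis by (simp add: mult_ac)
qed

text \<open>The constant generator \<open>B\<close> has no terms of order n \<ge> 2, so subtracting
  its coefficients changes nothing and makes the difference bound applicable: e^n becomes e^n - b^n,
  which carries a factor J.\<close>

lemma norm_log_coeff_le:
  assumes n: "n \<ge> 2"
  shows "norm (log_coeff A T n) \<le> J * T * (n * ((b + J) * T / 2) ^ (n - 1))"
proof -
  have T': "T \<in> {0..T}" using T by simp
  have gB: "generator (\<lambda>_. B) T b S"
    by (rule generator_const) (use T finite_S norm_B in auto)
  then interpret B: generator "\<lambda>_. B" T b S .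
  have "log_coeff A T n = integral {0..1} (\<lambda>s. riccati A s n T - riccati (\<lambda>_. B) s n T)"
    unfolding log_coeff_def using log_coeff_const[OF T n, of B]
    by (subst integral_diff)
      (auto intro!: integrable_continuous_real cont_riccati_param B.cont_riccati_param T' simp: log_coeff_def)
  also have "norm \<dots> \<le> (2 * (((b + J) * T / 2) ^ n - (b * T / 2) ^ n)) * (1 - 0)"
  proof (rule integral_bound)
    show "continuous_on {0..1} (\<lambda>s. riccati A s n T - riccati (\<lambda>_. B) s n T)"
      by (intro continuous_on_diff cont_riccati_param B.cont_riccati_param T')
    show "norm (riccati A s n T - riccati (\<lambda>_. B) s n T) \<le> 2 * (((b + J) * T / 2) ^ n - (b * T / 2) ^ n)"
      if "s \<in> {0..1}" for s
      by (rule norm_riccati_diff_le(2)[OF gB]) (use that T' norm_E J_nonneg in auto)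
  qed simp
  also have "\<dots> = 2 * ((T / 2) ^ n * ((b + J) ^ n - b ^ n))"
    by (simp only: times_divide_eq_right[symmetric] power_mult_distrib) (simp add: algebra_simps)
  also have "\<dots> \<le> 2 * ((T / 2) ^ n * (n * J * (b + J) ^ (n - 1)))"
    using T by (intro mult_left_mono power_diff_le b_nonneg J_nonneg) auto
  also have "\<dots> = J * T * (n * ((b + J) * T / 2) ^ (n - 1))"
    using n by (cases n) (simp_all add: power_mult_distrib power_divide)
  finally show ?thesis .
qed

lemma log_coeff_tail:
  assumes x: "x = (b + J) * T" "x \<le> 0.54"
  shows "summable (\<lambda>n. log_coeff A T (n + 4))"
    and "norm (\<Sum>n. log_coeff A T (n + 4)) \<le> J * T * (11/9 * x ^ 3)"
proof -
  have x0: "0 \<le> x" using b_nonneg J_nonneg T by (simp add: x)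
  \<comment> \<open>The ratio x/2 is enlarged by 5/4 to absorb the linear factor, through n + 4
    \<le> 4 (5/4)^n.\<close>
  define q where "q = 5/4 * (x/2)"
  have q: "0 \<le> q" "q \<le> 27/80" using x(2) x0 by (auto simp: q_def)
  have le: "norm (log_coeff A T (n + 4)) \<le> (J * T * (x/2) ^ 3 * 4) * q ^ n" for n
  proof -
    have growth: "real (n + 4) \<le> 4 * (5/4) ^ n"
    proof (induction n)
      case (Suc n)
      have "real (Suc n + 4) \<le> 5/4 * real (n + 4)" by simp
      then show ?case using Suc by simp
    qed simp
    have "norm (log_coeff A T (n + 4)) \<le> J * T * (real (n + 4) * (x/2) ^ (n + 3))"
      using norm_log_coeff_le[of "n + 4"] by (simp add: x(1) eval_nat_numeral)
    also have "\<dots> \<le> J * T * (4 * (5/4) ^ n * (x/2) ^ (n + 3))"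
      using J_nonneg T x0 by (intro mult_left_mono mult_right_mono growth) auto
    also have "\<dots> = (J * T * (x/2) ^ 3 * 4) * q ^ n"
      unfolding q_def power_mult_distrib[of "5/4"] by (simp add: power_add)
    finally show ?thesis .
  qed
  have s: "summable (\<lambda>n. (J * T * (x/2) ^ 3 * 4) * q ^ n)"
    using q by (intro summable_mult summable_geometric) auto
  then show "summable (\<lambda>n. log_coeff A T (n + 4))"
    by (rule summable_comparison_test'[where N = 0]) (rule le)
  have "norm (\<Sum>n. log_coeff A T (n + 4)) \<le> (\<Sum>n. (J * T * (x/2) ^ 3 * 4) * q ^ n)"
    by (rule norm_suminf_le[OF le s])
  also have "\<dots> = (J * T * (x/2) ^ 3 * 4) * (1 / (1 - q))"
    using q by (subst suminf_mult) (auto simp: suminf_geometric summable_geometric)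
  \<comment> \<open>88/36 is the bound for 1 / (1 - q) that brings the total to 4/8 * 88/36 = 11/9;
    by q \<le> 27/80 the true value is at most 80/53.\<close>
  also have "\<dots> \<le> (J * T * (x/2) ^ 3 * 4) * (88/36)"
    using q J_nonneg T x0 by (intro mult_left_mono) (auto simp: divide_le_eq)
  also have "\<dots> = J * T * (11/9 * x ^ 3)" by (simp add: power_divide)
  finally show "norm (\<Sum>n. log_coeff A T (n + 4)) \<le> J * T * (11/9 * x ^ 3)" .
qed

text \<open>The estimates are collected at \<lambda> = 1. Order 1 is exactly T B by
  \<open>average\<close> and contributes no error.\<close>

theorem log_series_bounds:
  assumes x: "x = (b + J) * T" "x \<le> 0.54"
  shows "(\<Sum>n. log_coeff A T n) = T *\<^sub>R B + log_coeff A T 2 + (\<Sum>n. log_coeff A T (n + 3))"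
    and "norm (log_coeff A T 2) \<le> J * T * (x / 2)"
    and "norm (\<Sum>n. log_coeff A T (n + 3)) \<le> J * T * (2/9 * x\<^sup>2 + 11/9 * x ^ 3)"
proof -
  note tail = log_coeff_tail[OF x]
  have s3: "summable (\<lambda>n. log_coeff A T (n + 3))"
    using tail(1) summable_iff_shift[of "\<lambda>n. log_coeff A T (n + 3)" 1] by (simp add: add.commute)
  have s: "summable (log_coeff A T)"
    using s3 summable_iff_shift[of "log_coeff A T" 3] by simp
  show "(\<Sum>n. log_coeff A T n) = T *\<^sub>R B + log_coeff A T 2 + (\<Sum>n. log_coeff A T (n + 3))"
    using suminf_split_initial_segment[OF s, of 3]
    by (simp add: eval_nat_numeral log_coeff_0 log_coeff_1 average[simplified])
  show "norm (log_coeff A T 2) \<le> J * T * (x / 2)"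
    using norm_log_coeff_2 by (simp add: x(1) power2_eq_square mult_ac)
  have "(\<Sum>n. log_coeff A T (n + 3)) = (\<Sum>n. log_coeff A T (n + 4)) + log_coeff A T 3"
    using suminf_split_initial_segment[OF s3, of 1] by (simp add: add.commute)
  also have "norm \<dots> \<le> J * T * (11/9 * x ^ 3) + 2/9 * J * (b + J)\<^sup>2 * T ^ 3"
    by (rule norm_triangle_mono[OF tail(2) norm_log_coeff_3])
  also have "\<dots> = J * T * (2/9 * x\<^sup>2 + 11/9 * x ^ 3)"
    by (simp add: x(1) power2_eq_square power3_eq_cube algebra_simps)
  finally show "norm (\<Sum>n. log_coeff A T (n + 3)) \<le> J * T * (2/9 * x\<^sup>2 + 11/9 * x ^ 3)" .
qed

end

section \<open>The Magnus expansion of a piecewise constant Hamiltonian\<close>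

lemma bop_eqI:
  "(\<And>v. blinfun_apply (blinfun_of_bop X) v = blinfun_apply (blinfun_of_bop Y) v) \<Longrightarrow> X = Y"
  by (metis blinfun_eqI blinfun_of_bop_inject)

lemma bop_apply_scaleC_arg:
  "blinfun_apply (blinfun_of_bop X) (c *\<^sub>C v) = c *\<^sub>C blinfun_apply (blinfun_of_bop X) v"
  using blinfun_of_bop[of X] by simp

lemma bop_apply_times:
  "blinfun_apply (blinfun_of_bop (X * Y)) v
     = blinfun_apply (blinfun_of_bop X) (blinfun_apply (blinfun_of_bop Y) v)"
  by (simp add: times_bop.rep_eq)

lemma scaleC_mult_left: "(c *\<^sub>C X) * Y = c *\<^sub>C (X * (Y :: 'a::complex_hilbert bop))"
  by (rule bop_eqI) (simp add: bop_apply_times bop_apply_scaleC)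

lemma scaleC_mult_right: "X * (c *\<^sub>C Y) = c *\<^sub>C (X * (Y :: 'a::complex_hilbert bop))"
  by (rule bop_eqI) (simp add: bop_apply_times bop_apply_scaleC bop_apply_scaleC_arg)

lemma norm_scaleC_bop_le: "norm (c *\<^sub>C X) \<le> cmod c * norm (X :: 'a::complex_hilbert bop)"
  unfolding norm_bop.rep_eq
proof (rule norm_blinfun_bound)
  fix v
  have "norm (blinfun_apply (blinfun_of_bop (c *\<^sub>C X)) v)
      = cmod c * norm (blinfun_apply (blinfun_of_bop X) v)"
    by (simp add: bop_apply_scaleC norm_scaleC)
  also have "\<dots> \<le> cmod c * (norm (blinfun_of_bop X) * norm v)"
    by (intro mult_left_mono norm_blinfun) simp
  finally show "norm (blinfun_apply (blinfun_of_bop (c *\<^sub>C X)) v)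
      \<le> cmod c * norm (blinfun_of_bop X) * norm v" by (simp add: mult.assoc)
qed simp

lemma norm_scaleC_bop: "norm (c *\<^sub>C X) = cmod c * norm (X :: 'a::complex_hilbert bop)"
proof (cases "c = 0")
  case False
  have "X = inverse c *\<^sub>C (c *\<^sub>C X)"
    using False complex_vector.scale_one[of X] by (simp add: scaleC_scaleC)
  then have "norm X \<le> cmod (inverse c) * norm (c *\<^sub>C X)" by (metis norm_scaleC_bop_le)
  then have "cmod c * norm X \<le> norm (c *\<^sub>C X)"
    using False by (simp add: norm_inverse pos_le_divide_eq divide_inverse_commute[symmetric] mult.commute)
  then show ?thesis using norm_scaleC_bop_le[of c X] by simp
qed simp

lemma scaleR_scaleC_commute: "c *\<^sub>C (r *\<^sub>R X) = r *\<^sub>R (c *\<^sub>C (X :: 'a::complex_vector))"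
  by (simp add: scaleR_scaleC scaleC_scaleC mult.commute)

text \<open>Moves the factor -i into the generator, so that the theory over real Banach algebras
  applies with the real parameter l.\<close>

lemma evolves_iff:
  "evolves (\<lambda>t. l *\<^sub>R K t) T U \<longleftrightarrow> U 0 = 1 \<and> continuous_on {0..T} U \<and>
     (\<exists>F. finite F \<and> (\<forall>t\<in>{0<..<T} - F.
        (U has_vector_derivative l *\<^sub>R (((- \<i>) *\<^sub>C K t) * U t)) (at t)))"
  unfolding evolves_def by (simp add: scaleC_mult_left scaleR_scaleC_commute)

lemma magnus_coeffs_unique:
  assumes "magnus_coeffs K T \<Omega>" "magnus_coeffs K T \<Omega>'"
  shows "\<Omega> = \<Omega>'"
proof -
  obtain r where r: "r > 0" "\<And>l. \<bar>l\<bar> < r \<Longrightarrow> summable (\<lambda>n. l ^ n *\<^sub>R \<Omega> n)"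
    "\<And>l. \<bar>l\<bar> < r \<Longrightarrow> evolution_op (\<lambda>t. l *\<^sub>R K t) T = exp (\<Sum>n. l ^ n *\<^sub>R \<Omega> n)"
    using assms(1) unfolding magnus_coeffs_def by auto
  obtain r' where r': "r' > 0" "\<And>l. \<bar>l\<bar> < r' \<Longrightarrow> summable (\<lambda>n. l ^ n *\<^sub>R \<Omega>' n)"
    "\<And>l. \<bar>l\<bar> < r' \<Longrightarrow> evolution_op (\<lambda>t. l *\<^sub>R K t) T = exp (\<Sum>n. l ^ n *\<^sub>R \<Omega>' n)"
    using assms(2) unfolding magnus_coeffs_def by auto
  show ?thesis
  proof (rule exp_powser_unique[where r = "min r r'"])
    show "\<Omega> 0 = 0" "\<Omega>' 0 = 0" using assms by (simp_all add: magnus_coeffs_def)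
  next
    fix l :: real assume l: "\<bar>l\<bar> < min r r'"
    then have "\<bar>l\<bar> < r" "\<bar>l\<bar> < r'" by simp_all
    then show "summable (\<lambda>n. l ^ n *\<^sub>R \<Omega> n)" "summable (\<lambda>n. l ^ n *\<^sub>R \<Omega>' n)"
      "exp (\<Sum>n. l ^ n *\<^sub>R \<Omega> n) = exp (\<Sum>n. l ^ n *\<^sub>R \<Omega>' n)"
      using r(2,3)[of l] r'(2,3)[of l] by simp_all
  qed (use r r' in simp)
qed

text \<open>Two definite descriptions have to be resolved. For small l a solution exists and every
  solution ends in the Dyson sum, which fixes \<open>evolution_op\<close>; that sum is the
  exponential of the \<open>log_coeff\<close> series, whose uniqueness fixes
  \<open>magnus_term\<close>.\<close>

lemma magnus_term_eq_log_coeff: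
  fixes K :: "real \<Rightarrow> 'a::complex_hilbert bop"
  assumes "generator (\<lambda>t. (- \<i>) *\<^sub>C K t) T e S"
  shows "magnus_term K T = log_coeff (\<lambda>t. (- \<i>) *\<^sub>C K t) T"
proof -
  let ?A = "\<lambda>t. (- \<i>) *\<^sub>C K t"
  interpret generator ?A T e S by fact
  have ev: "evolution_op (\<lambda>t. l *\<^sub>R K t) T = (\<Sum>n. l ^ n *\<^sub>R dyson ?A n T)"
    if l: "\<bar>l\<bar> * e * T \<le> 1/2" for l
    unfolding evolution_op_def
  proof (rule the_equality)
    have uniq: "V = (\<Sum>n. l ^ n *\<^sub>R dyson ?A n T)" if V: "\<exists>U. evolves (\<lambda>t. l *\<^sub>R K t) T U \<and> V = U T" for V
    proof -
      obtain U F where U: "U 0 = 1" "continuous_on {0..T} U" "finite F" "V = U T"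
        "\<And>t. t \<in> {0<..<T} - F \<Longrightarrow> (U has_vector_derivative l *\<^sub>R (?A t * U t)) (at t)"
        using V unfolding evolves_iff by blast
      show ?thesis using dyson_sums_solution[OF l U(1-3,5)] U(4) by (simp add: sums_iff)
    qed
    then show "V = (\<Sum>n. l ^ n *\<^sub>R dyson ?A n T)" if "\<exists>U. evolves (\<lambda>t. l *\<^sub>R K t) T U \<and> V = U T" for V
      using that .
    obtain U where "evolves (\<lambda>t. l *\<^sub>R K t) T U"
    proof -
      obtain U where U: "U 0 = 1" "continuous_on {0..T} U"
        "\<And>t. t \<in> {0<..<T} - S \<Longrightarrow> (U has_vector_derivative l *\<^sub>R (?A t * U t)) (at t)"
        using dyson_solution_exists[OF l] by blast
      then have "evolves (\<lambda>t. l *\<^sub>R K t) T U" unfolding evolves_iff using finite_S by blast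
      then show thesis by (rule that)
    qed
    moreover from this have "U T = (\<Sum>n. l ^ n *\<^sub>R dyson ?A n T)" using uniq by blast
    ultimately show "\<exists>U. evolves (\<lambda>t. l *\<^sub>R K t) T U \<and> (\<Sum>n. l ^ n *\<^sub>R dyson ?A n T) = U T"
      by metis
  qed
  have "magnus_coeffs K T (log_coeff ?A T)"
    unfolding magnus_coeffs_def
  proof (intro conjI exI[of _ "1 / (2 * (e * T + 1))"] allI impI)
    show "log_coeff ?A T 0 = 0" by (rule log_coeff_0)
    have eT: "0 \<le> e * T" using e_nonneg T by simp
    then show "0 < 1 / (2 * (e * T + 1))" by (intro divide_pos_pos) auto
    fix l assume "\<bar>l\<bar> < 1 / (2 * (e * T + 1))"
    then have "\<bar>l\<bar> * (e * T) \<le> 1 / (2 * (e * T + 1)) * (e * T)" using eT by (intro mult_right_mono) auto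
    also have "\<dots> \<le> 1/2" using eT by (simp add: divide_le_eq)
    finally have l: "\<bar>l\<bar> * e * T \<le> 1/2" by (simp add: mult.assoc)
    show "summable (\<lambda>n. l ^ n *\<^sub>R log_coeff ?A T n)"
      "evolution_op (\<lambda>t. l *\<^sub>R K t) T = exp (\<Sum>n. l ^ n *\<^sub>R log_coeff ?A T n)"
      using exp_log_coeff[OF l] ev[OF l] by simp_all
  qed
  then show ?thesis
    unfolding magnus_term_def using magnus_coeffs_unique by (blast intro: the_equality)
qed

section \<open>Piecewise constant functions as generators\<close>

lemma integral_step:
  fixes f :: "real \<Rightarrow> 'a::banach"
  assumes \<tau>: "0 < \<tau>" and g: "\<And>j. j < m \<Longrightarrow> continuous_on {real j * \<tau>..real (Suc j) * \<tau>} (g j)"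
    and fg: "\<And>j t. j < m \<Longrightarrow> real j * \<tau> < t \<Longrightarrow> t < real (Suc j) * \<tau> \<Longrightarrow> f t = g j t"
  shows "(f has_integral (\<Sum>j<m. integral {real j * \<tau>..real (Suc j) * \<tau>} (g j))) {0..real m * \<tau>}"
  using assms(2,3)
proof (induction m)
  case (Suc m)
  have "(g m has_integral integral {real m * \<tau>..real (Suc m) * \<tau>} (g m)) {real m * \<tau>..real (Suc m) * \<tau>}"
    by (intro integrable_integral integrable_continuous_real Suc.prems) simp
  then have "(f has_integral integral {real m * \<tau>..real (Suc m) * \<tau>} (g m)) {real m * \<tau>..real (Suc m) * \<tau>}"
    \<comment> \<open>At the right end of a cell a step function already takes its next value, so
      both ends are exempted.\<close>
    by (rule has_integral_spike_finite[rotated 2, of _ _ _ "{real m * \<tau>, real (Suc m) * \<tau>}"])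
      (use Suc.prems(2)[of m] in auto)
  moreover have "(f has_integral (\<Sum>j<m. integral {real j * \<tau>..real (Suc j) * \<tau>} (g j))) {0..real m * \<tau>}"
    by (rule Suc.IH) (use Suc.prems in auto)
  ultimately show ?case
    using has_integral_combine[of 0 "real m * \<tau>" "real (Suc m) * \<tau>" f] \<tau>
    by (simp add: mult_right_mono)
qed (use has_integral_refl(2)[of f 0] in simp)

lemma floor_step:
  assumes "0 < \<tau>" "real j * \<tau> \<le> t" "t < real (Suc j) * \<tau>"
  shows "nat \<lfloor>t / \<tau>\<rfloor> = j"
proof -
  have "\<lfloor>t / \<tau>\<rfloor> = int j"
    using assms by (intro floor_unique) (auto simp: field_simps)
  then show ?thesis by simp
qed

text \<open>The bound is required up to j = R, one beyond the last interval, because the floor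
  equals \<open>R\<close> at the final time t = R \<tau>.\<close>

lemma
  fixes a :: "nat \<Rightarrow> 'a::{real_normed_algebra_1,banach}"
  assumes \<tau>: "0 < \<tau>" and a: "\<And>j. j \<le> R \<Longrightarrow> norm (a j) \<le> e"
  shows generator_step: "generator (\<lambda>t. a (nat \<lfloor>t / \<tau>\<rfloor>)) (real R * \<tau>) e ((\<lambda>j. real j * \<tau>) ` {..R})"
    and integral_step_const: "integral {0..real R * \<tau>} (\<lambda>t. a (nat \<lfloor>t / \<tau>\<rfloor>)) = \<tau> *\<^sub>R (\<Sum>j<R. a j)"
proof -
  let ?A = "\<lambda>t. a (nat \<lfloor>t / \<tau>\<rfloor>)"
  show "generator ?A (real R * \<tau>) e ((\<lambda>j. real j * \<tau>) ` {..R})"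
  proof
    show "0 \<le> real R * \<tau>" using \<tau> by simp
    fix t assume t: "t \<in> {0..real R * \<tau>}"
    have "t / \<tau> \<le> real R" using t \<tau> by (simp add: divide_le_eq)
    then have "nat \<lfloor>t / \<tau>\<rfloor> \<le> R" by linarith
    then show "norm (?A t) \<le> e" by (rule a)
  next
    fix t assume t: "t \<in> {0<..<real R * \<tau>} - (\<lambda>j. real j * \<tau>) ` {..R}"
    define j where "j = nat \<lfloor>t / \<tau>\<rfloor>"
    have "0 \<le> t / \<tau>" using t \<tau> by simp
    then have j: "real j \<le> t / \<tau>" "t / \<tau> < real (Suc j)" unfolding j_def by linarith+
    have "t / \<tau> < real R" using t \<tau> by (simp add: divide_less_eq)
    with j have "j \<in> {..R}" by simp
    with t have "t \<noteq> real j * \<tau>" by blast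
    with j \<tau> have t': "t \<in> {real j * \<tau><..<real (Suc j) * \<tau>}" by (auto simp: field_simps)
    have "\<forall>\<^sub>F x in nhds t. a j = ?A x"
      using eventually_nhds_in_open[OF open_greaterThanLessThan t']
    proof eventually_elim
      case (elim x)
      then have "nat \<lfloor>x / \<tau>\<rfloor> = j" by (intro floor_step[OF \<tau>]) auto
      then show ?case by simp
    qed
    then have "isCont (\<lambda>_. a j) t = isCont ?A t" by (rule isCont_cong)
    then show "isCont ?A t" by simp
  next
    fix g h :: "real \<Rightarrow> 'a"
    assume gh: "continuous_on {0..real R * \<tau>} g" "continuous_on {0..real R * \<tau>} h"
    have "((\<lambda>t. g t * ?A t * h t) has_integral (\<Sum>j<R. integral {real j * \<tau>..real (Suc j) * \<tau>}
        (\<lambda>t. g t * a j * h t))) {0..real R * \<tau>}"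
    proof (rule integral_step[OF \<tau>])
      fix j assume "j < R"
      then have "real (Suc j) * \<tau> \<le> real R * \<tau>" using \<tau> by (intro mult_right_mono) auto
      then have "{real j * \<tau>..real (Suc j) * \<tau>} \<subseteq> {0..real R * \<tau>}" using \<tau> by auto
      then show "continuous_on {real j * \<tau>..real (Suc j) * \<tau>} (\<lambda>t. g t * a j * h t)"
        by (intro continuous_intros continuous_on_subset[OF gh(1)] continuous_on_subset[OF gh(2)])
    next
      fix j t assume "real j * \<tau> < t" "t < real (Suc j) * \<tau>"
      then have "nat \<lfloor>t / \<tau>\<rfloor> = j" by (intro floor_step[OF \<tau>]) auto
      then show "g t * ?A t * h t = g t * a j * h t" by simp
    qed
    then show "(\<lambda>t. g t * ?A t * h t) integrable_on {0..real R * \<tau>}" by blast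
  qed simp
  have "(?A has_integral (\<Sum>j<R. integral {real j * \<tau>..real (Suc j) * \<tau>} (\<lambda>_. a j))) {0..real R * \<tau>}"
  proof (rule integral_step[OF \<tau>])
    fix j t assume "real j * \<tau> < t" "t < real (Suc j) * \<tau>"
    then have "nat \<lfloor>t / \<tau>\<rfloor> = j" by (intro floor_step[OF \<tau>]) auto
    then show "?A t = a j" by simp
  qed simp
  then have "integral {0..real R * \<tau>} ?A = (\<Sum>j<R. integral {real j * \<tau>..real (Suc j) * \<tau>} (\<lambda>_. a j))"
    by (rule integral_unique)
  also have "\<dots> = \<tau> *\<^sub>R (\<Sum>j<R. a j)"
    unfolding scaleR_sum_right using \<tau> by (intro sum.cong) (auto simp: algebra_simps)
  finally show "integral {0..real R * \<tau>} ?A = \<tau> *\<^sub>R (\<Sum>j<R. a j)" .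
qed

section \<open>Operators on the tensor product\<close>

abbreviation bop_apply :: "'a::complex_hilbert bop \<Rightarrow> 'a \<Rightarrow> 'a" where
  "bop_apply X \<equiv> blinfun_apply (blinfun_of_bop X)"

lemma bop_apply_linear:
  "bop_apply (X + Y) v = bop_apply X v + bop_apply Y v"
  "bop_apply (X - Y) v = bop_apply X v - bop_apply Y v"
  "bop_apply (r *\<^sub>R X) v = r *\<^sub>R bop_apply X v"
  "bop_apply 0 v = 0"
  "bop_apply 1 v = v"
  by (simp_all add: plus_bop.rep_eq minus_bop.rep_eq scaleR_bop.rep_eq zero_bop.rep_eq one_bop.rep_eq
      blinfun.add_left blinfun.diff_left blinfun.scaleR_left)

lemma bop_apply_sum: "bop_apply (\<Sum>i\<in>I. f i) v = (\<Sum>i\<in>I. bop_apply (f i) v)"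
  by (induction I rule: infinite_finite_induct) (simp_all add: bop_apply_linear)

lemma scaleC_nth [simp]: "(c *\<^sub>C v) $ i = c *\<^sub>C (v $ i)"
  by (simp add: scaleC_vec_def)

lemma tensor_op_nth:
  "bop_apply (M \<otimes>\<^sub>o B) v $ i = (\<Sum>j\<in>UNIV. M $ i $ j *\<^sub>C bop_apply B (v $ j))"
  by (simp add: tensor_op_apply)

lemma tensor_op_mult: "(M \<otimes>\<^sub>o B) * (N \<otimes>\<^sub>o C) = (M ** N) \<otimes>\<^sub>o (B * C)"
proof (rule bop_eqI)
  fix v
  have "bop_apply ((M \<otimes>\<^sub>o B) * (N \<otimes>\<^sub>o C)) v $ i = bop_apply ((M ** N) \<otimes>\<^sub>o (B * C)) v $ i" for i
  proof -
    have "bop_apply ((M \<otimes>\<^sub>o B) * (N \<otimes>\<^sub>o C)) v $ i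
       = (\<Sum>j\<in>UNIV. \<Sum>k\<in>UNIV. (M $ i $ j * N $ j $ k) *\<^sub>C bop_apply B (bop_apply C (v $ k)))"
      by (simp add: bop_apply_times tensor_op_nth blinfun.sum_right bop_apply_scaleC_arg
          complex_vector.scale_sum_right scaleC_scaleC)
    also have "\<dots> = (\<Sum>k\<in>UNIV. \<Sum>j\<in>UNIV. (M $ i $ j * N $ j $ k) *\<^sub>C bop_apply B (bop_apply C (v $ k)))"
      by (rule sum.swap)
    also have "\<dots> = bop_apply ((M ** N) \<otimes>\<^sub>o (B * C)) v $ i"
      by (simp add: bop_apply_times tensor_op_nth matrix_matrix_mult_def complex_vector.scale_sum_left)
    finally show ?thesis .
  qed
  then show "bop_apply ((M \<otimes>\<^sub>o B) * (N \<otimes>\<^sub>o C)) v = bop_apply ((M ** N) \<otimes>\<^sub>o (B * C)) v"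
    by (simp add: vec_eq_iff)
qed

lemma bop_vec_eqI:
  "(\<And>v i. bop_apply X v $ i = bop_apply Y v $ i) \<Longrightarrow> X = (Y :: ('b::complex_hilbert ^ 'n) bop)"
  by (rule bop_eqI) (simp add: vec_eq_iff)

lemma tensor_op_add_left: "(M + N) \<otimes>\<^sub>o B = M \<otimes>\<^sub>o B + N \<otimes>\<^sub>o B"
  by (rule bop_vec_eqI)
    (simp add: tensor_op_nth bop_apply_linear scaleC_add_left sum.distrib)

lemma tensor_op_add_right: "M \<otimes>\<^sub>o (B + C) = M \<otimes>\<^sub>o B + M \<otimes>\<^sub>o C"
  by (rule bop_vec_eqI)
    (simp add: tensor_op_nth bop_apply_linear scaleC_add_right sum.distrib)

lemma tensor_op_scaleC_left: "(c *\<^sub>C M) \<otimes>\<^sub>o B = c *\<^sub>C (M \<otimes>\<^sub>o B)"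
  by (rule bop_vec_eqI)
    (simp add: tensor_op_nth bop_apply_scaleC complex_vector.scale_sum_right scaleC_scaleC scaleC_complex_def)

lemma tensor_op_scaleC_right: "M \<otimes>\<^sub>o (c *\<^sub>C B) = c *\<^sub>C (M \<otimes>\<^sub>o B)"
  by (rule bop_vec_eqI)
    (simp add: tensor_op_nth bop_apply_scaleC complex_vector.scale_sum_right scaleC_scaleC mult.commute)

lemma tensor_op_zero_left: "0 \<otimes>\<^sub>o B = 0"
  by (rule bop_vec_eqI) (simp add: tensor_op_nth bop_apply_linear)

lemma tensor_op_zero_right: "M \<otimes>\<^sub>o 0 = 0"
  by (rule bop_vec_eqI) (simp add: tensor_op_nth bop_apply_linear)

lemma tensor_op_sum_left: "(\<Sum>i\<in>I. M i) \<otimes>\<^sub>o B = (\<Sum>i\<in>I. M i \<otimes>\<^sub>o B)"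
  by (induction I rule: infinite_finite_induct) (simp_all add: tensor_op_zero_left tensor_op_add_left)

lemma tensor_op_mat_1: "bop_apply (mat 1 \<otimes>\<^sub>o B) v $ i = bop_apply B (v $ i)"
proof -
  have "bop_apply (mat 1 \<otimes>\<^sub>o B) v $ i = (\<Sum>j\<in>UNIV. if i = j then bop_apply B (v $ j) else 0)"
    unfolding tensor_op_nth by (intro sum.cong) (auto simp: mat_def)
  then show ?thesis by simp
qed

lemma tensor_op_one: "mat 1 \<otimes>\<^sub>o 1 = 1"
  by (rule bop_vec_eqI) (simp add: tensor_op_mat_1 bop_apply_linear)

lemma norm_mat_1_tensor_le: "norm (mat 1 \<otimes>\<^sub>o B :: ('b::complex_hilbert ^ 'n) bop) \<le> norm B"
  unfolding norm_bop.rep_eq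
proof (rule norm_blinfun_bound)
  fix v :: "'b ^ 'n"
  have "norm (bop_apply (mat 1 \<otimes>\<^sub>o B) v) \<le> L2_set (\<lambda>i. norm (blinfun_of_bop B) * norm (v $ i)) UNIV"
    unfolding norm_vec_def by (intro L2_set_mono) (auto simp: tensor_op_mat_1 norm_blinfun)
  also have "\<dots> = norm (blinfun_of_bop B) * norm v"
    unfolding norm_vec_def by (rule L2_set_right_distrib[symmetric]) simp
  finally show "norm (bop_apply (mat 1 \<otimes>\<^sub>o B) v) \<le> norm (blinfun_of_bop B) * norm v" .
qed simp

section \<open>Adjoints and unitary conjugation on the tensor product\<close>

lemma cinner_scaleC_left: "cinner (c *\<^sub>C x) y = cnj c * cinner x (y::'a::complex_hilbert)"
  by (metis cinner_commute cinner_scaleC_right complex_cnj_cnj complex_cnj_mult)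

lemma cinner_sum_right: "cinner x (\<Sum>i\<in>I. f i) = (\<Sum>i\<in>I. cinner x (f i :: 'a::complex_hilbert))"
proof (induction I rule: infinite_finite_induct)
  have "cinner x (0 *\<^sub>C 0) = 0" by (simp only: cinner_scaleC_right mult_zero_left)
  then have z: "cinner x 0 = 0" by simp
  { case (infinite A) then show ?case using z by simp }
  { case empty then show ?case using z by simp }
  { case (insert a A) then show ?case by (simp add: cinner_add_right) }
qed

lemma cinner_sum_left: "cinner (\<Sum>i\<in>I. f i) x = (\<Sum>i\<in>I. cinner (f i) (x :: 'a::complex_hilbert))"
  by (subst cinner_commute) (simp add: cinner_sum_right cnj_sum flip: cinner_commute)

lemma cinner_tensor_adj:
  fixes v w :: "'b::complex_hilbert ^ 'n"
  shows "cinner (bop_apply (U \<otimes>\<^sub>o 1) v) w = cinner v (bop_apply (adj U \<otimes>\<^sub>o 1) w)"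
proof -
  have "cinner (bop_apply (U \<otimes>\<^sub>o 1) v) w
     = (\<Sum>i\<in>UNIV. \<Sum>j\<in>UNIV. cnj (U $ i $ j) * cinner (v $ j) (w $ i))"
    by (simp add: cinner_vec_def tensor_op_nth bop_apply_linear cinner_sum_left cinner_scaleC_left)
  also have "\<dots> = (\<Sum>j\<in>UNIV. \<Sum>i\<in>UNIV. cnj (U $ i $ j) * cinner (v $ j) (w $ i))"
    by (rule sum.swap)
  also have "\<dots> = cinner v (bop_apply (adj U \<otimes>\<^sub>o 1) w)"
    by (simp add: cinner_vec_def tensor_op_nth bop_apply_linear cinner_sum_right cinner_scaleC_right adj_def)
  finally show ?thesis .
qed

lemma norm_isometry_tensor_le:
  assumes "adj U ** U = mat 1"
  shows "norm (U \<otimes>\<^sub>o 1 :: ('b::complex_hilbert ^ 'n) bop) \<le> 1"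
  unfolding norm_bop.rep_eq
proof (rule norm_blinfun_bound)
  fix v :: "'b ^ 'n"
  have "bop_apply (adj U \<otimes>\<^sub>o 1) (bop_apply (U \<otimes>\<^sub>o 1) v) = v"
    by (simp add: tensor_op_mult assms tensor_op_one bop_apply_linear flip: bop_apply_times)
  then have "(norm (bop_apply (U \<otimes>\<^sub>o 1) v))\<^sup>2 = (norm v)\<^sup>2"
    by (simp add: power2_norm_eq_inner inner_Re_cinner cinner_tensor_adj)
  then show "norm (bop_apply (U \<otimes>\<^sub>o 1) v) \<le> 1 * norm v" by simp
qed simp

lemma norm_unitary_conj_le:
  assumes "unitary U"
  shows "norm ((adj U \<otimes>\<^sub>o 1) * X * (U \<otimes>\<^sub>o 1)) \<le> norm (X :: ('b::complex_hilbert ^ 'n) bop)"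
proof -
  have "adj (adj U) = U" by (simp add: adj_def vec_eq_iff)
  then have "norm (adj U \<otimes>\<^sub>o 1 :: ('b ^ 'n) bop) \<le> 1" "norm (U \<otimes>\<^sub>o 1 :: ('b ^ 'n) bop) \<le> 1"
    using assms by (auto intro!: norm_isometry_tensor_le simp: unitary_def)
  then have "norm (adj U \<otimes>\<^sub>o 1 :: ('b ^ 'n) bop) * norm X * norm (U \<otimes>\<^sub>o 1 :: ('b ^ 'n) bop) \<le> 1 * norm X * 1"
    by (intro mult_mono) auto
  moreover have "norm ((adj U \<otimes>\<^sub>o 1) * X * (U \<otimes>\<^sub>o 1))
      \<le> norm (adj U \<otimes>\<^sub>o 1 :: ('b ^ 'n) bop) * norm X * norm (U \<otimes>\<^sub>o 1 :: ('b ^ 'n) bop)"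
    by (intro order_trans[OF norm_mult_ineq] mult_right_mono norm_mult_ineq) simp
  ultimately show ?thesis by simp
qed

section \<open>Blocks, the partial trace and the bath projection\<close>

lemma norm_axis_vec: "norm (axis i v :: 'b::real_normed_vector ^ 'n) = norm v"
proof -
  have "(norm (axis i v :: 'b ^ 'n))\<^sup>2 = (\<Sum>j\<in>UNIV. (norm ((axis i v :: 'b ^ 'n) $ j))\<^sup>2)"
    unfolding norm_vec_def L2_set_def by (simp add: sum_nonneg)
  also have "\<dots> = (\<Sum>j\<in>UNIV. if j = i then (norm v)\<^sup>2 else 0)"
    by (intro sum.cong) (auto simp: axis_def)
  finally have "(norm (axis i v :: 'b ^ 'n))\<^sup>2 = (norm v)\<^sup>2" by simp
  then show ?thesis by simp
qed

lemma axis_linear: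
  "axis i (v + w) = axis i v + (axis i w :: 'b::real_vector ^ 'n)"
  "axis i (r *\<^sub>R v) = r *\<^sub>R (axis i v :: 'b::real_vector ^ 'n)"
  by (simp_all add: axis_def vec_eq_iff)

lemma axis_scaleC: "axis i (c *\<^sub>C v) = c *\<^sub>C (axis i v :: 'b::complex_vector ^ 'n)"
  by (simp add: axis_def vec_eq_iff)

lemma bounded_linear_block:
  fixes X :: "('b::complex_hilbert ^ 'n) \<Rightarrow>\<^sub>L ('b ^ 'n)"
  shows "bounded_linear (\<lambda>v. blinfun_apply X (axis j v) $ i)"
proof (rule bounded_linear_intro[where K = "norm X"])
  fix v
  have "norm (blinfun_apply X (axis j v) $ i) \<le> norm (blinfun_apply X (axis j v))"
    by (rule Finite_Cartesian_Product.norm_nth_le)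
  also have "\<dots> \<le> norm X * norm (axis j v)" by (rule norm_blinfun)
  finally show "norm (blinfun_apply X (axis j v) $ i) \<le> norm v * norm X"
    by (simp add: norm_axis_vec mult.commute)
qed (simp_all add: axis_linear blinfun.add_right blinfun.scaleR_right)

lift_definition block :: "('b::complex_hilbert ^ 'n) bop \<Rightarrow> 'n \<Rightarrow> 'n \<Rightarrow> 'b bop"
  is "\<lambda>X i j. Blinfun (\<lambda>v. blinfun_apply X (axis j v) $ i)"
  by (simp add: bounded_linear_Blinfun_apply[OF bounded_linear_block] axis_scaleC)

lemma block_apply: "bop_apply (block X i j) v = bop_apply X (axis j v) $ i"
  by (simp add: block.rep_eq bounded_linear_Blinfun_apply[OF bounded_linear_block])

lemma norm_block_le: "norm (block X i j) \<le> norm X"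
  unfolding norm_bop.rep_eq[of "block X i j"]
proof (rule norm_blinfun_bound)
  fix v
  have "norm (bop_apply (block X i j) v) \<le> norm (bop_apply X (axis j v))"
    unfolding block_apply by (rule Finite_Cartesian_Product.norm_nth_le)
  also have "\<dots> \<le> norm X * norm (axis j v)" unfolding norm_bop.rep_eq by (rule norm_blinfun)
  finally show "norm (bop_apply (block X i j) v) \<le> norm X * norm v"
    by (simp add: norm_axis_vec)
qed simp

definition normalized_ptrace :: "('b::complex_hilbert ^ 'n) bop \<Rightarrow> 'b bop" where
  "normalized_ptrace X = (1 / real CARD('n)) *\<^sub>R (\<Sum>i\<in>UNIV. block X i i)"

definition bath_proj :: "('b::complex_hilbert ^ 'n) bop \<Rightarrow> ('b ^ 'n) bop" where
  "bath_proj X = mat 1 \<otimes>\<^sub>o normalized_ptrace X"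

lemma normalized_ptrace_linear:
  "normalized_ptrace (X + Y) = normalized_ptrace X + normalized_ptrace Y"
  "normalized_ptrace (c *\<^sub>C X) = c *\<^sub>C normalized_ptrace X"
  by (rule bop_eqI, simp add: normalized_ptrace_def bop_apply_linear bop_apply_sum block_apply
      bop_apply_scaleC sum.distrib scaleR_add_right complex_vector.scale_sum_right
      scaleR_scaleC_commute)+

text \<open>A mean of diagonal blocks, each a compression of \<open>X\<close> and so of no larger
  norm; this is why the bath projection is a contraction.\<close>

lemma norm_normalized_ptrace_le: "norm (normalized_ptrace X) \<le> norm (X :: ('b::complex_hilbert ^ 'n) bop)"
proof -
  have "norm (\<Sum>i\<in>UNIV. block X i i) \<le> (\<Sum>i\<in>(UNIV::'n set). norm X)"
    by (intro sum_norm_le norm_block_le)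
  then show ?thesis by (simp add: normalized_ptrace_def divide_le_eq mult.commute)
qed

lemma normalized_ptrace_tensor:
  "normalized_ptrace (M \<otimes>\<^sub>o B :: ('b::complex_hilbert ^ 'n) bop) = (trace M / of_nat CARD('n)) *\<^sub>C B"
proof (rule bop_eqI)
  fix v
  have "bop_apply (block (M \<otimes>\<^sub>o B) i i) v = M $ i $ i *\<^sub>C bop_apply B v" for i
  proof -
    have "bop_apply (block (M \<otimes>\<^sub>o B) i i) v
       = (\<Sum>j\<in>UNIV. if j = i then M $ i $ i *\<^sub>C bop_apply B v else 0)"
      unfolding block_apply tensor_op_nth by (intro sum.cong) (auto simp: axis_def)
    then show ?thesis by simp
  qed
  then show "bop_apply (normalized_ptrace (M \<otimes>\<^sub>o B)) v = bop_apply ((trace M / of_nat CARD('n)) *\<^sub>C B) v"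
    by (simp add: normalized_ptrace_def bop_apply_linear bop_apply_sum bop_apply_scaleC trace_def
        scaleR_scaleC scaleC_scaleC divide_inverse mult.commute flip: complex_vector.scale_sum_left)
qed

lemma bath_proj_add: "bath_proj (X + Y) = bath_proj X + bath_proj Y"
  by (simp add: bath_proj_def normalized_ptrace_linear tensor_op_add_right)

lemma bath_proj_scaleC: "bath_proj (c *\<^sub>C X) = c *\<^sub>C bath_proj X"
  by (simp add: bath_proj_def normalized_ptrace_linear tensor_op_scaleC_right)

lemma norm_bath_proj_le: "norm (bath_proj X) \<le> norm X"
  unfolding bath_proj_def
  by (rule order_trans[OF norm_mat_1_tensor_le norm_normalized_ptrace_le])

lemma bounded_linear_bath_proj: "bounded_linear bath_proj"
  by (rule bounded_linear_intro[where K = 1])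
    (simp_all add: bath_proj_add bath_proj_scaleC scaleR_scaleC norm_bath_proj_le)

lemma bath_proj_sum: "bath_proj (\<Sum>i\<in>I. f i) = (\<Sum>i\<in>I. bath_proj (f i))"
  by (rule linear_sum[OF bounded_linear.linear[OF bounded_linear_bath_proj]])

lemma bath_proj_tensor:
  "bath_proj (M \<otimes>\<^sub>o B :: ('b::complex_hilbert ^ 'n) bop) = mat 1 \<otimes>\<^sub>o ((trace M / of_nat CARD('n)) *\<^sub>C B)"
  by (simp add: bath_proj_def normalized_ptrace_tensor)

lemma bath_proj_mat_1: "bath_proj (mat 1 \<otimes>\<^sub>o B) = mat 1 \<otimes>\<^sub>o B"
  using complex_vector.scale_one[of B] by (simp add: bath_proj_tensor trace_I)

lemma bath_proj_traceless: "trace M = 0 \<Longrightarrow> bath_proj (M \<otimes>\<^sub>o B) = 0"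
  by (simp add: bath_proj_tensor tensor_op_zero_right)

definition matrix_unit :: "'n \<Rightarrow> 'n \<Rightarrow> complex ^ 'n ^ 'n" where
  "matrix_unit i j = (\<chi> k l. if k = i \<and> l = j then 1 else 0)"

lemma bop_eq_sum_blocks:
  fixes X :: "('b::complex_hilbert ^ 'n) bop"
  shows "X = (\<Sum>i\<in>UNIV. \<Sum>j\<in>UNIV. matrix_unit i j \<otimes>\<^sub>o block X i j)"
proof (rule bop_vec_eqI)
  fix v :: "'b ^ 'n" and k
  have unit: "bop_apply (matrix_unit i j \<otimes>\<^sub>o B) v $ k = (if k = i then bop_apply B (v $ j) else 0)"
    for i j and B :: "'b bop"
  proof -
    have "bop_apply (matrix_unit i j \<otimes>\<^sub>o B) v $ k
       = (\<Sum>l\<in>UNIV. if l = j then (if k = i then bop_apply B (v $ j) else 0) else 0)"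
      unfolding tensor_op_nth by (intro sum.cong) (auto simp: matrix_unit_def)
    then show ?thesis by simp
  qed
  have "v = (\<Sum>j\<in>UNIV. axis j (v $ j))"
    by (simp add: vec_eq_iff axis_def)
  then have "bop_apply X v $ k = bop_apply X (\<Sum>j\<in>UNIV. axis j (v $ j)) $ k" by simp
  also have "\<dots> = (\<Sum>j\<in>UNIV. bop_apply (block X k j) (v $ j))"
    by (simp add: blinfun.sum_right block_apply)
  also have "\<dots> = (\<Sum>i\<in>UNIV. if k = i then \<Sum>j\<in>UNIV. bop_apply (block X i j) (v $ j) else 0)"
    by simp
  also have "\<dots> = (\<Sum>i\<in>UNIV. \<Sum>j\<in>UNIV. if k = i then bop_apply (block X i j) (v $ j) else 0)"
    by (intro sum.cong) auto
  also have "\<dots> = bop_apply (\<Sum>i\<in>UNIV. \<Sum>j\<in>UNIV. matrix_unit i j \<otimes>\<^sub>o block X i j) v $ k"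
    by (simp add: bop_apply_sum unit)
  finally show "bop_apply X v $ k
     = bop_apply (\<Sum>i\<in>UNIV. \<Sum>j\<in>UNIV. matrix_unit i j \<otimes>\<^sub>o block X i j) v $ k" .
qed

section \<open>Decomposition along a basis of the traceless operators\<close>

context
  fixes S :: "'a \<Rightarrow> complex ^ 'n ^ 'n" and A :: "'a set"
  assumes basis: "hermitian_traceless_basis S A"
begin

lemma finite_basis: "finite A"
  using basis by (simp add: hermitian_traceless_basis_def)

lemma trace_basis: "\<alpha> \<in> A \<Longrightarrow> trace (S \<alpha>) = 0"
  using basis complex_vector.span_base[of "S \<alpha>" "S ` A"]
  by (auto simp: hermitian_traceless_basis_def)

text \<open>Decomposable operators are closed under sums, and every operator is a finite sum of
  tensors of a matrix M with a bath operator. In each tensor the trace splits a multiple of the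
  identity off M, and the remainder lies in the span of the basis.\<close>

lemma decomposition_exists:
  fixes X :: "('b::complex_hilbert ^ 'n) bop"
  obtains B\<^sub>0 B where "X = mat 1 \<otimes>\<^sub>o B\<^sub>0 + (\<Sum>\<alpha>\<in>A. S \<alpha> \<otimes>\<^sub>o B \<alpha>)"
proof -
  define D where "D = {X :: ('b ^ 'n) bop. \<exists>B\<^sub>0 B. X = mat 1 \<otimes>\<^sub>o B\<^sub>0 + (\<Sum>\<alpha>\<in>A. S \<alpha> \<otimes>\<^sub>o B \<alpha>)}"
  have zero: "0 \<in> D"
    unfolding D_def by (auto intro!: exI[of _ 0] exI[of _ "\<lambda>_. 0"] simp: tensor_op_zero_right)
  have add: "X + Y \<in> D" if "X \<in> D" "Y \<in> D" for X Y
  proof -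
    obtain B\<^sub>0 B C\<^sub>0 C where "X = mat 1 \<otimes>\<^sub>o B\<^sub>0 + (\<Sum>\<alpha>\<in>A. S \<alpha> \<otimes>\<^sub>o B \<alpha>)"
      "Y = mat 1 \<otimes>\<^sub>o C\<^sub>0 + (\<Sum>\<alpha>\<in>A. S \<alpha> \<otimes>\<^sub>o C \<alpha>)" using \<open>X \<in> D\<close> \<open>Y \<in> D\<close> unfolding D_def by blast
    then have "X + Y = mat 1 \<otimes>\<^sub>o (B\<^sub>0 + C\<^sub>0) + (\<Sum>\<alpha>\<in>A. S \<alpha> \<otimes>\<^sub>o (B \<alpha> + C \<alpha>))"
      by (simp add: tensor_op_add_right sum.distrib)
    then show ?thesis
      unfolding D_def by (intro CollectI exI[of _ "B\<^sub>0 + C\<^sub>0"] exI[of _ "\<lambda>\<alpha>. B \<alpha> + C \<alpha>"])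
  qed
  have tensor: "M \<otimes>\<^sub>o C \<in> D" for M and C :: "'b bop"
  proof -
    let ?t = "trace M / of_nat CARD('n)"
    have "trace (M + (- ?t) *\<^sub>C mat 1) = 0"
      by (simp add: trace_def mat_def sum_subtractf scaleC_complex_def)
    then have "M + (- ?t) *\<^sub>C mat 1 \<in> complex_vector.span (S ` A)"
      using basis by (simp add: hermitian_traceless_basis_def)
    then obtain u where "M + (- ?t) *\<^sub>C mat 1 = (\<Sum>v\<in>S ` A. u v *\<^sub>C v)"
      using complex_vector.span_finite[OF finite_imageI[OF finite_basis]] by auto
    also have "\<dots> = (\<Sum>\<alpha>\<in>A. u (S \<alpha>) *\<^sub>C S \<alpha>)"
      using basis by (subst sum.reindex) (auto simp: hermitian_traceless_basis_def)
    finally have "M = ?t *\<^sub>C mat 1 + (\<Sum>\<alpha>\<in>A. u (S \<alpha>) *\<^sub>C S \<alpha>)" by (simp add: algebra_simps)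
    then have "M \<otimes>\<^sub>o C = (?t *\<^sub>C mat 1 + (\<Sum>\<alpha>\<in>A. u (S \<alpha>) *\<^sub>C S \<alpha>)) \<otimes>\<^sub>o C" by simp
    also have "\<dots> = mat 1 \<otimes>\<^sub>o (?t *\<^sub>C C) + (\<Sum>\<alpha>\<in>A. S \<alpha> \<otimes>\<^sub>o (u (S \<alpha>) *\<^sub>C C))"
      by (simp add: tensor_op_add_left tensor_op_sum_left tensor_op_scaleC_left tensor_op_scaleC_right)
    finally show ?thesis
      unfolding D_def by (intro CollectI exI[of _ "?t *\<^sub>C C"] exI[of _ "\<lambda>\<alpha>. u (S \<alpha>) *\<^sub>C C"])
  qed
  have sum: "(\<Sum>i\<in>I. f i) \<in> D" if "\<And>i. f i \<in> D" for I :: "'n set" and f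
    by (induction I rule: infinite_finite_induct) (auto intro: zero add that)
  have "X \<in> D"
    by (subst bop_eq_sum_blocks) (intro sum tensor)
  then show thesis using that unfolding D_def by blast
qed

lemma bath_proj_decomposition:
  "bath_proj (mat 1 \<otimes>\<^sub>o B\<^sub>0 + (\<Sum>\<alpha>\<in>A. S \<alpha> \<otimes>\<^sub>o B \<alpha>)) = mat 1 \<otimes>\<^sub>o B\<^sub>0"
  by (simp add: bath_proj_add bath_proj_mat_1 bath_proj_sum bath_proj_traceless trace_basis)

text \<open>Whatever decomposition is chosen, the partial trace annihilates the traceless
  \<open>S \<alpha>\<close> and returns the bath term. This resolves both definite
  descriptions.\<close>

lemma bath_part_eq: "bath_part S A X = bath_proj X"
  and err_part_eq: "err_part S A X = X - bath_proj X"
proof -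
  obtain B\<^sub>0 B where X: "X = mat 1 \<otimes>\<^sub>o B\<^sub>0 + (\<Sum>\<alpha>\<in>A. S \<alpha> \<otimes>\<^sub>o B \<alpha>)"
    using decomposition_exists by blast
  have p: "bath_proj X = mat 1 \<otimes>\<^sub>o C\<^sub>0"
    if "X = mat 1 \<otimes>\<^sub>o C\<^sub>0 + (\<Sum>\<alpha>\<in>A. S \<alpha> \<otimes>\<^sub>o C \<alpha>)" for C\<^sub>0 C
    unfolding that by (rule bath_proj_decomposition)
  show "bath_part S A X = bath_proj X"
    unfolding bath_part_def using X p by (intro the_equality) (metis, metis)
  have e: "X - bath_proj X = (\<Sum>\<alpha>\<in>A. S \<alpha> \<otimes>\<^sub>o C \<alpha>)"
    if "X = mat 1 \<otimes>\<^sub>o C\<^sub>0 + (\<Sum>\<alpha>\<in>A. S \<alpha> \<otimes>\<^sub>o C \<alpha>)" for C\<^sub>0 C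
    using p[OF that] that by simp
  show "err_part S A X = X - bath_proj X"
    unfolding err_part_def using X e by (intro the_equality) (metis, metis)
qed

end

section \<open>Concatenated decoupling\<close>

lemma adj_mult: "adj (M ** N) = adj N ** adj M"
  by (simp add: adj_def matrix_matrix_mult_def vec_eq_iff mult.commute)

lemma adj_mat_1: "adj (mat 1) = mat 1"
  by (auto simp: adj_def mat_def vec_eq_iff)

lemma matrix_mult_minus:
  fixes X Y :: "complex ^ 'n ^ 'n"
  shows "- X ** Y = - (X ** Y)" "X ** - Y = - (X ** Y)"
  by (simp_all add: matrix_matrix_mult_def vec_eq_iff sum_negf)

lemma unitary_mult:
  assumes "unitary U" "unitary V"
  shows "unitary (U ** V)"
proof -
  have "adj V ** adj U ** (U ** V) = adj V ** (adj U ** U) ** V"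
    "U ** V ** (adj V ** adj U) = U ** (V ** adj V) ** adj U"
    by (simp_all add: matrix_mul_assoc)
  then show ?thesis using assms by (simp add: unitary_def adj_mult matrix_mul_rid)
qed

lemma unitary_Q_op:
  assumes "\<And>j. j \<in> {1..R} \<Longrightarrow> unitary (P j)" "j \<le> R"
  shows "unitary (Q_op P j)"
  using assms(2)
proof (induction j)
  case 0
  show ?case by (simp add: unitary_def adj_mat_1)
next
  case (Suc j)
  then show ?case using assms(1)[of "Suc j"] by (simp add: unitary_mult)
qed

text \<open>Signs compose: conjugation with the last pulse turns \<open>M\<close> into M or -M, and
  the induction hypothesis treats conjugation with the earlier ones.\<close>

lemma conj_Q_op_sign:
  fixes M :: "complex ^ 'n ^ 'n"
  assumes "\<And>j. j \<in> {1..R} \<Longrightarrow> unitary (P j)"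
    and "\<And>j. j \<in> {1..R} \<Longrightarrow> P j ** M = M ** P j \<or> P j ** M = - (M ** P j)" and "j \<le> R"
  shows "adj (Q_op P j) ** M ** Q_op P j = M \<or> adj (Q_op P j) ** M ** Q_op P j = - M"
  using assms(3)
proof (induction j)
  case 0
  show ?case by (simp add: matrix_mul_rid adj_mat_1)
next
  case (Suc j)
  let ?P = "P (Suc j)" and ?Q = "Q_op P j"
  note neg = matrix_mult_minus
  have u: "adj ?P ** ?P = mat 1" using assms(1)[of "Suc j"] Suc.prems by (simp add: unitary_def)
  have "adj ?P ** (?P ** M) = M" by (simp add: matrix_mul_assoc u)
  moreover have "M ** ?P = ?P ** M \<or> M ** ?P = - (?P ** M)"
    using assms(2)[of "Suc j"] Suc.prems by auto
  ultimately have "adj ?P ** (M ** ?P) = M \<or> adj ?P ** (M ** ?P) = - M"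
    by (auto simp: neg)
  moreover have "adj (Q_op P (Suc j)) ** M ** Q_op P (Suc j) = adj ?Q ** (adj ?P ** (M ** ?P)) ** ?Q"
    by (simp add: adj_mult matrix_mul_assoc)
  ultimately show ?case using Suc.IH Suc.prems by (auto simp: neg)
qed

text \<open>One level of concatenation, with \<open>G\<close> for the Hamiltonian of the level
  below. For the generator -i times the toggling-frame Hamiltonian, -i times the bath part of
  \<open>G\<close> is the mean and the conjugated error parts average to zero, which is an instance
  of \<open>split_generator\<close>.\<close>

lemma effective_hamiltonian_step:
  fixes G :: "('b::complex_hilbert ^ 'n) bop" and S :: "'a \<Rightarrow> complex ^ 'n ^ 'n"
  assumes basis: "hermitian_traceless_basis S A"
    and orthogonal: "\<And>\<alpha> \<gamma>. \<alpha> \<in> A \<Longrightarrow> \<gamma> \<in> A \<Longrightarrow> \<alpha> \<noteq> \<gamma> \<Longrightarrow> trace (S \<alpha> ** S \<gamma>) = 0"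
    and unitary: "\<And>j. j \<in> {1..R} \<Longrightarrow> unitary (P j)"
    and decoupling: "first_order_decoupling P R S A"
    and commute: "\<And>j \<alpha>. j \<in> {1..R} \<Longrightarrow> \<alpha> \<in> A \<Longrightarrow>
      P j ** S \<alpha> = S \<alpha> ** P j \<or> P j ** S \<alpha> = - (S \<alpha> ** P j)"
    and \<tau>: "0 < \<tau>" and R: "0 < R" and T: "T = real R * \<tau>"
    and \<beta>: "norm (bath_proj G) \<le> \<beta>" and J: "norm (G - bath_proj G) \<le> J"
    and x: "x = (\<beta> + J) * T" "x \<le> 0.54"
  defines "H' \<equiv> (\<i> / complex_of_real T) *\<^sub>C magnus_sum (toggling P \<tau> G) T"
  shows "norm (bath_proj H') \<le> \<beta> + (2/9 + 11/9 * x) * J * x\<^sup>2"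
    and "norm (H' - bath_proj H') \<le> (1/2 + 2 * (2/9 * x + 11/9 * x\<^sup>2)) * J * x"
proof -
  obtain B\<^sub>0 B where G: "G = mat 1 \<otimes>\<^sub>o B\<^sub>0 + (\<Sum>\<alpha>\<in>A. S \<alpha> \<otimes>\<^sub>o B \<alpha>)"
    using decomposition_exists[OF basis] by blast
  define GB where "GB = (mat 1 \<otimes>\<^sub>o B\<^sub>0 :: ('b ^ 'n) bop)"
  define GE where "GE = (\<Sum>\<alpha>\<in>A. S \<alpha> \<otimes>\<^sub>o B \<alpha>)"
  have pG: "bath_proj G = GB" unfolding G GB_def by (rule bath_proj_decomposition[OF basis])
  have nB: "norm GB \<le> \<beta>" using \<beta> by (simp add: pG)
  have nE: "norm GE \<le> J" using J by (simp add: pG) (simp add: G GB_def GE_def)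
  have J0: "0 \<le> J" using nE norm_ge_zero[of GE] by linarith
  have \<beta>0: "0 \<le> \<beta>" using nB norm_ge_zero[of GB] by linarith
  have T0: "0 < T" using \<tau> R by (simp add: T)
  define Q where "Q = Q_op P"
  have uQ: "unitary (Q j)" if "j \<le> R" for j
    unfolding Q_def by (rule unitary_Q_op[OF unitary that])
  define M where "M j \<alpha> = adj (Q j) ** S \<alpha> ** Q j" for j \<alpha>
  define E where "E j = (\<Sum>\<alpha>\<in>A. M j \<alpha> \<otimes>\<^sub>o B \<alpha>)" for j
  have M: "M j \<alpha> = S \<alpha> \<or> M j \<alpha> = - S \<alpha>" if "j \<le> R" "\<alpha> \<in> A" for j \<alpha>
    unfolding M_def Q_def by (rule conj_Q_op_sign[OF unitary commute]) (use that in auto)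
  have E: "E j = (adj (Q j) \<otimes>\<^sub>o 1) * GE * (Q j \<otimes>\<^sub>o 1)" for j
    unfolding E_def M_def GE_def by (simp add: sum_distrib_left sum_distrib_right tensor_op_mult)
  define K where "K j = (adj (Q j) \<otimes>\<^sub>o 1) * G * (Q j \<otimes>\<^sub>o 1)" for j
  have K: "K j = GB + E j" if "j \<le> R" for j
  proof -
    have "(adj (Q j) \<otimes>\<^sub>o 1) * GB * (Q j \<otimes>\<^sub>o 1) = GB"
      using uQ[OF that] by (simp add: GB_def tensor_op_mult matrix_mul_rid unitary_def)
    moreover have "G = GB + GE" by (simp add: G GB_def GE_def)
    ultimately show ?thesis unfolding K_def E by (simp add: algebra_simps)
  qed
  have nEj: "norm (E j) \<le> J" if "j \<le> R" for j
    unfolding E using norm_unitary_conj_le[OF uQ[OF that]] nE by (rule order_trans)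
  have sumE: "(\<Sum>j<R. E j) = 0"
  proof -
    have "(\<Sum>j<R. E j) = (\<Sum>\<alpha>\<in>A. (\<Sum>j<R. M j \<alpha>) \<otimes>\<^sub>o B \<alpha>)"
      unfolding E_def tensor_op_sum_left by (rule sum.swap)
    also have "\<dots> = 0"
      using decoupling by (intro sum.neutral) (simp add: first_order_decoupling_def M_def Q_def tensor_op_zero_left)
    finally show ?thesis .
  qed
  have trM: "trace (M j \<alpha>) = 0" if "j \<le> R" "\<alpha> \<in> A" for j \<alpha>
    using M[OF that] trace_basis[OF basis that(2)] by (auto simp: trace_def sum_negf)
  have trMM: "trace (M j \<alpha> ** M k \<gamma>) = 0" if "j \<le> R" "k \<le> R" "\<alpha> \<in> A" "\<gamma> \<in> A" "\<alpha> \<noteq> \<gamma>" for j k \<alpha> \<gamma>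
    using M[OF that(1,3)] M[OF that(2,4)] orthogonal[OF that(3-5)]
    by (auto simp: matrix_mult_minus) (auto simp: trace_def sum_negf)
  \<comment> \<open>Orthogonality removes the mixed terms \<alpha> \<noteq> \<gamma>. In the
    diagonal ones the bath factor is \<open>B \<alpha> * B \<alpha>\<close> in either order, so that
    cyclicity of the system trace suffices.\<close>
  have EE: "bath_proj (E j * E k) = bath_proj (E k * E j)" if "j \<le> R" "k \<le> R" for j k
  proof -
    have *: "bath_proj (E j * E k) = (\<Sum>\<alpha>\<in>A. bath_proj ((M j \<alpha> ** M k \<alpha>) \<otimes>\<^sub>o (B \<alpha> * B \<alpha>)))"
      if jk: "j \<le> R" "k \<le> R" for j k
    proof -
      have "bath_proj (E j * E k) = (\<Sum>\<alpha>\<in>A. \<Sum>\<gamma>\<in>A. bath_proj ((M j \<alpha> ** M k \<gamma>) \<otimes>\<^sub>o (B \<alpha> * B \<gamma>)))"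
        by (simp add: E_def sum_product bath_proj_sum tensor_op_mult)
      also have "\<dots> = (\<Sum>\<alpha>\<in>A. \<Sum>\<gamma>\<in>A. if \<gamma> = \<alpha> then bath_proj ((M j \<alpha> ** M k \<alpha>) \<otimes>\<^sub>o (B \<alpha> * B \<alpha>)) else 0)"
        using trMM[OF jk] by (intro sum.cong) (auto simp: bath_proj_traceless)
      finally show ?thesis using finite_basis[OF basis] by simp
    qed
    show ?thesis
      unfolding *[OF that] *[OF that(2,1)] bath_proj_tensor
      by (intro sum.cong refl arg_cong[where f = "\<lambda>t. mat 1 \<otimes>\<^sub>o ((t / of_nat CARD('n)) *\<^sub>C _)"] trace_mul_sym)
  qed
  have BE: "bath_proj (GB * E j) = 0" "bath_proj (E j * GB) = 0" if "j \<le> R" for j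
    unfolding E_def GB_def using trM[OF that]
    by (simp_all add: sum_distrib_left sum_distrib_right tensor_op_mult matrix_mul_rid bath_proj_sum
        bath_proj_traceless)
  let ?A = "\<lambda>t. (- \<i>) *\<^sub>C toggling P \<tau> G t"
  let ?a = "\<lambda>j. (- \<i>) *\<^sub>C K j"
  have A: "?A = (\<lambda>t. ?a (nat \<lfloor>t / \<tau>\<rfloor>))"
    by (simp add: toggling_def K_def Q_def Let_def)
  have na: "norm (?a j) \<le> \<beta> + J" if "j \<le> R" for j
    unfolding norm_scaleC_bop using norm_triangle_mono[OF nB nEj[OF that]] K[OF that] by simp
  let ?S = "(\<lambda>j. real j * \<tau>) ` {..R}" and ?B = "(- \<i>) *\<^sub>C GB"
  have gen: "generator ?A T (\<beta> + J) ?S"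
    unfolding A T by (rule generator_step[OF \<tau> na])
  have idx: "nat \<lfloor>t / \<tau>\<rfloor> \<le> R" if "t \<in> {0..T}" for t
  proof -
    have "t / \<tau> \<le> real R" using that \<tau> by (simp add: T divide_le_eq)
    then show ?thesis by linarith
  qed
  have AB: "?A t - ?B = (- \<i>) *\<^sub>C E (nat \<lfloor>t / \<tau>\<rfloor>)" if "t \<in> {0..T}" for t
    using fun_cong[OF A, of t] K[OF idx[OF that]] by (simp add: scaleC_add_right)
  have avg: "integral {0..T} ?A = T *\<^sub>R ?B"
  proof -
    have "integral {0..T} ?A = \<tau> *\<^sub>R (\<Sum>j<R. ?a j)"
      unfolding A T by (rule integral_step_const[OF \<tau> na])
    also have "(\<Sum>j<R. ?a j) = (- \<i>) *\<^sub>C (\<Sum>j<R. GB + E j)"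
      unfolding complex_vector.scale_sum_right by (intro sum.cong) (simp_all add: K)
    also have "(\<Sum>j<R. GB + E j) = real R *\<^sub>R GB"
      by (simp add: sum.distrib sumE scaleR_conv_of_real sum_constant_scaleR)
    finally show ?thesis by (simp add: T scaleR_scaleC_commute mult.commute)
  qed
  interpret split_generator ?A T \<beta> J ?S ?B
  proof (intro split_generator.intro split_generator_axioms.intro gen)
    show "norm ?B \<le> \<beta>" using nB by (simp add: norm_scaleC_bop)
    show "norm (?A t - ?B) \<le> J" if "t \<in> {0..T}" for t
      unfolding AB[OF that] norm_scaleC_bop using nEj[OF idx[OF that]] by simp
    show "integral {0..T} ?A = T *\<^sub>R ?B" by (rule avg)
  qed
  define Z where "Z = (\<Sum>n. log_coeff ?A T (n + 3))"
  note series = log_series_bounds[OF x, folded Z_def]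
  have "magnus_sum (toggling P \<tau> G) T = T *\<^sub>R ?B + log_coeff ?A T 2 + Z"
    unfolding magnus_sum_def magnus_term_eq_log_coeff[OF gen] by (rule series(1))
  moreover define c where "c = \<i> / complex_of_real T"
  ultimately have H': "H' = GB + c *\<^sub>C log_coeff ?A T 2 + c *\<^sub>C Z"
  proof -
    assume eq: "magnus_sum (toggling P \<tau> G) T = T *\<^sub>R ?B + log_coeff ?A T 2 + Z"
    have "c *\<^sub>C T *\<^sub>R ?B = GB"
      using T0 complex_vector.scale_one[of GB] by (simp add: c_def scaleR_scaleC scaleC_scaleC)
    then show ?thesis unfolding H'_def eq c_def[symmetric] by (simp only: scaleC_add_right)
  qed
  have nc: "norm (c *\<^sub>C X) = norm X / T" for X :: "('b ^ 'n) bop"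
    using T0 by (simp add: norm_scaleC_bop c_def norm_divide)
  have p2: "bath_proj (log_coeff ?A T 2) = 0"
  proof (rule annihilate_log_coeff_2[OF bounded_linear_bath_proj])
    fix t r assume t: "t \<in> {0..T}" and r: "r \<in> {0..T}"
    show "bath_proj ((?A t - ?B) * (?A r - ?B)) = bath_proj ((?A r - ?B) * (?A t - ?B))"
      unfolding AB[OF t] AB[OF r] scaleC_mult_left scaleC_mult_right bath_proj_scaleC
      by (simp only: EE[OF idx[OF t] idx[OF r]])
  next
    fix t assume t: "t \<in> {0..T}"
    show "bath_proj (?B * (?A t - ?B)) = bath_proj ((?A t - ?B) * ?B)"
      unfolding AB[OF t] scaleC_mult_left scaleC_mult_right bath_proj_scaleC
      by (simp only: BE[OF idx[OF t]])
  qed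
  have nZ: "norm (c *\<^sub>C Z) \<le> J * (2/9 * x\<^sup>2 + 11/9 * x ^ 3)"
    unfolding nc using series(3) T0 by (simp add: divide_le_eq mult_ac)
  have n2: "norm (c *\<^sub>C log_coeff ?A T 2) \<le> J * (x / 2)"
    unfolding nc using series(2) T0 by (simp add: divide_le_eq mult_ac)
  have pH': "bath_proj H' = GB + bath_proj (c *\<^sub>C Z)"
    unfolding H' bath_proj_add using p2 bath_proj_scaleC[of c "log_coeff ?A T 2"] pG
    by (simp add: GB_def bath_proj_mat_1)
  have npZ: "norm (bath_proj (c *\<^sub>C Z)) \<le> J * (2/9 * x\<^sup>2 + 11/9 * x ^ 3)"
    by (rule order_trans[OF norm_bath_proj_le nZ])
  have "norm (bath_proj H') \<le> \<beta> + J * (2/9 * x\<^sup>2 + 11/9 * x ^ 3)"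
    unfolding pH' by (rule norm_triangle_mono[OF nB npZ])
  then show "norm (bath_proj H') \<le> \<beta> + (2/9 + 11/9 * x) * J * x\<^sup>2"
    by (simp add: power2_eq_square power3_eq_cube algebra_simps)
  \<comment> \<open>Only \<open>Z\<close> is counted twice, by itself and by its bath part; order 2
    has no bath part and counts once. Hence the shape of \<open>c2\<close>, with 1/2 outside the
    factor 2.\<close>
  have "H' - bath_proj H' = c *\<^sub>C log_coeff ?A T 2 + (c *\<^sub>C Z - bath_proj (c *\<^sub>C Z))"
    unfolding pH' by (simp add: H')
  also have "norm \<dots> \<le> J * (x / 2) + (J * (2/9 * x\<^sup>2 + 11/9 * x ^ 3) + J * (2/9 * x\<^sup>2 + 11/9 * x ^ 3))"
    using norm_triangle_ineq4[of "c *\<^sub>C Z" "bath_proj (c *\<^sub>C Z)"] nZ npZ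
    by (intro norm_triangle_mono n2) linarith
  finally show "norm (H' - bath_proj H') \<le> (1/2 + 2 * (2/9 * x + 11/9 * x\<^sup>2)) * J * x"
    by (simp add: power2_eq_square power3_eq_cube algebra_simps)
qed

text \<open>With L = log_R (1/q) both sides become powers of \<open>R\<close>. Writing k = L - 1 -
  \<delta>, where the floor puts \<delta> in [0, 1], the two exponents differ by \<delta> (1 -
  \<delta>) / 2 \<ge> 0.\<close>

lemma suppression_exponent_bound:
  fixes q \<eta> w :: real
  assumes R: "2 \<le> (R::nat)" and q: "0 < q" and w: "0 \<le> w"
    and k: "int k = \<lfloor>log (real R) (1 / q) - 1\<rfloor>"
    and \<eta>: "\<eta> \<le> real R powr (real k * (real k + 3) / 2) * q ^ k * w"
  shows "\<eta> / w \<le> 1 / real R * q powr (1/2 * log (real R) (1 / q) - 3/2)"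
proof (cases "w = 0")
  case False
  define L where "L = log (real R) (1 / q)"
  have R0: "1 < real R" using R by simp
  have qL: "q = real R powr (- L)"
    using q R0 by (simp add: L_def log_divide powr_log_cancel)
  define \<delta> where "\<delta> = L - 1 - real k"
  have \<delta>: "0 \<le> \<delta>" "\<delta> \<le> 1"
    using k[folded L_def] unfolding \<delta>_def by linarith+
  have "\<eta> / w \<le> real R powr (real k * (real k + 3) / 2) * q ^ k"
    using \<eta> w False by (simp add: divide_le_eq)
  also have "q ^ k = real R powr (- L * real k)"
    using q by (simp add: qL powr_powr powr_realpow[symmetric] del: powr_realpow)
  also have "real R powr (real k * (real k + 3) / 2) * \<dots> = real R powr (real k * (real k + 3) / 2 - L * real k)"
    by (simp flip: powr_add)
  also have "\<dots> \<le> real R powr (- 1 - L * (1/2 * L - 3/2))"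
  proof (rule powr_mono)
    have "0 \<le> \<delta> * (1 - \<delta>)" using \<delta> by simp
    also have "\<delta> * (1 - \<delta>) = 2 * (- 1 - L * (1/2 * L - 3/2)) - 2 * (real k * (real k + 3) / 2 - L * real k)"
      by (simp add: \<delta>_def field_simps)
    finally show "real k * (real k + 3) / 2 - L * real k \<le> - 1 - L * (1/2 * L - 3/2)" by simp
  qed (use R0 in simp)
  also have "\<dots> = 1 / real R * q powr (1/2 * L - 3/2)"
  proof -
    have "q powr (1/2 * L - 3/2) = real R powr (- L * (1/2 * L - 3/2))"
      by (subst qL) (rule powr_powr)
    moreover have "1 / real R = real R powr (- 1)" using R0 by (simp add: powr_minus_divide)
    ultimately show ?thesis by (simp only: powr_add[symmetric]) simp
  qed
  finally show ?thesis unfolding L_def .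
\<comment> \<open>For w = 0 the quotient is 0 by convention, and the right side is
  nonnegative.\<close>
qed (use R in simp)

text \<open>The natural number \<open>kmax\<close> is tied to an integer floor by
  \<open>int\<close>. Since c and \<epsilon> are positive, the condition that c \<epsilon> times the
  pulse interval is at most 1/R makes the logarithm at least 1 and the floor nonnegative, so that
  such a number exists.\<close>

theorem mainTheorem5:
  fixes S :: "'a \<Rightarrow> complex ^ 'n ^ 'n" and A :: "'a set"
    and B\<^sub>0 :: "'b::complex_hilbert bop" and B :: "'a \<Rightarrow> 'b bop"
    and H H\<^sub>B H\<^sub>E :: "('b ^ 'n) bop"
    and P :: "nat \<Rightarrow> complex ^ 'n ^ 'n" and R :: nat
    and \<tau>\<^sub>0 \<beta> J \<epsilon> c :: real
    and T \<beta>s Js \<epsilon>s x c2 c3 \<eta> :: "nat \<Rightarrow> real"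
  assumes basis: "hermitian_traceless_basis S A"
    and orthogonal: "\<And>\<alpha> \<gamma>. \<alpha> \<in> A \<Longrightarrow> \<gamma> \<in> A \<Longrightarrow> \<alpha> \<noteq> \<gamma> \<Longrightarrow> trace (S \<alpha> ** S \<gamma>) = 0"
    and hamiltonian: "self_adjoint H" "H = H\<^sub>B + H\<^sub>E"
      "H\<^sub>B = mat 1 \<otimes>\<^sub>o B\<^sub>0" "H\<^sub>E = (\<Sum>\<alpha>\<in>A. S \<alpha> \<otimes>\<^sub>o B \<alpha>)"
    and noise_bounds: "norm H\<^sub>B \<le> \<beta>" "norm H\<^sub>E \<le> J" "\<epsilon> = \<beta> + J"
    and R: "R \<ge> 2"
    and interval: "\<tau>\<^sub>0 > 0"
    and pulses: "\<And>j. j \<in> {1..R} \<Longrightarrow> unitary (P j)" "cyclic P R"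
    and decoupling: "first_order_decoupling P R S A"
    and commute: "\<And>j \<alpha>. j \<in> {1..R} \<Longrightarrow> \<alpha> \<in> A \<Longrightarrow>
      P j ** S \<alpha> = S \<alpha> ** P j \<or> P j ** S \<alpha> = - (S \<alpha> ** P j)"
    and duration: "\<And>k. T k = cdd_time P R \<tau>\<^sub>0 k"
    and recursion_0: "\<beta>s 0 = \<beta>" "Js 0 = J"
    and recursion:
      "\<And>k. \<epsilon>s k = \<beta>s k + Js k"
      "\<And>k. k \<ge> 1 \<Longrightarrow> x k = \<epsilon>s (k - 1) * T k"
      "\<And>k. k \<ge> 1 \<Longrightarrow> c3 k = 2/9 + 11/9 * x k + 9.43 * x k ^ 2"
      "\<And>k. k \<ge> 1 \<Longrightarrow> c2 k = 1/2 + 2 * (2/9 * x k + 11/9 * x k ^ 2 + 9.43 * x k ^ 3)"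
      "\<And>k. k \<ge> 1 \<Longrightarrow> \<beta>s k = \<beta>s (k - 1) + c3 k * Js (k - 1) * x k ^ 2"
      "\<And>k. k \<ge> 1 \<Longrightarrow> Js k = c2 k * Js (k - 1) * x k"
    and c: "c > 0"
    and noise_strength: "\<And>k. \<eta> k = norm (err_part S A (H_eff P R \<tau>\<^sub>0 H k)) * T k"
  shows "(\<forall>l. (\<forall>k\<in>{1..l}. x k \<le> 0.54 \<and> c2 k * \<epsilon>s (k - 1) \<le> c * \<epsilon>) \<longrightarrow>
      (\<forall>k\<le>l.
        H_eff P R \<tau>\<^sub>0 H k
          = bath_part S A (H_eff P R \<tau>\<^sub>0 H k) + err_part S A (H_eff P R \<tau>\<^sub>0 H k) \<and>
        norm (bath_part S A (H_eff P R \<tau>\<^sub>0 H k)) \<le> \<beta>s k \<and>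
        norm (err_part S A (H_eff P R \<tau>\<^sub>0 H k)) \<le> Js k \<and>
        \<eta> k \<le> real R powr (real k * (real k + 3) / 2) * (c * \<epsilon> * \<tau>\<^sub>0) ^ k * (J * \<tau>\<^sub>0))) \<and>
    (\<forall>kmax. \<epsilon> > 0 \<longrightarrow> c * \<epsilon> * \<tau>\<^sub>0 \<le> 1 / real R \<longrightarrow>
      int kmax = \<lfloor>log (real R) (1 / (c * \<epsilon> * \<tau>\<^sub>0)) - 1\<rfloor> \<longrightarrow>
      (\<forall>k\<in>{1..kmax}. x k \<le> 0.54 \<and> c2 k * \<epsilon>s (k - 1) \<le> c * \<epsilon>) \<longrightarrow>
      \<eta> kmax / (J * \<tau>\<^sub>0) \<le>
        1 / real R * (c * \<epsilon> * \<tau>\<^sub>0) powr (1/2 * log (real R) (1 / (c * \<epsilon> * \<tau>\<^sub>0)) - 3/2))"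
proof -
  have T: "T k = real R ^ k * \<tau>\<^sub>0" for k by (simp add: duration cdd_time_eq)
  have T0: "0 < T k" for k using R interval by (simp add: T)
  note bath = bath_part_eq[OF basis] and err = err_part_eq[OF basis]
  let ?H = "H_eff P R \<tau>\<^sub>0 H"
  have nonneg: "0 \<le> \<beta>" "0 \<le> J"
    using noise_bounds(1,2) norm_ge_zero[of H\<^sub>B] norm_ge_zero[of H\<^sub>E] by linarith+
  have levels: "norm (bath_proj (?H k)) \<le> \<beta>s k \<and> norm (?H k - bath_proj (?H k)) \<le> Js k"
    if hyp: "\<forall>k\<in>{1..l}. x k \<le> 0.54 \<and> c2 k * \<epsilon>s (k - 1) \<le> c * \<epsilon>" and "k \<le> l" for k l
    using \<open>k \<le> l\<close>
  proof (induction k)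
    case 0
    have "bath_proj H = H\<^sub>B"
      unfolding hamiltonian(2-4) by (rule bath_proj_decomposition[OF basis])
    then show ?case using noise_bounds recursion_0 hamiltonian(2) by simp
  next
    case (Suc k)
    then have IH: "norm (bath_proj (?H k)) \<le> \<beta>s k" "norm (?H k - bath_proj (?H k)) \<le> Js k" by simp_all
    have J0: "0 \<le> Js k" using IH(2) norm_ge_zero[of "?H k - bath_proj (?H k)"] by linarith
    have \<beta>0: "0 \<le> \<beta>s k" using IH(1) norm_ge_zero[of "bath_proj (?H k)"] by linarith
    let ?x = "x (Suc k)"
    have x: "?x = (\<beta>s k + Js k) * T (Suc k)" "?x \<le> 0.54"
    proof -
      show "?x = (\<beta>s k + Js k) * T (Suc k)" using recursion(1)[of k] recursion(2)[of "Suc k"] by simp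
      show "?x \<le> 0.54" using hyp Suc.prems by auto
    qed
    have x0: "0 \<le> ?x" using x(1) J0 \<beta>0 T0[of "Suc k"] by simp
    have TS: "T (Suc k) = real R * T k" by (simp add: T)
    have "0 < R" using R by simp
    \<comment> \<open>Concatenation is self-similar: \<open>T k\<close> and the level-k Hamiltonian
      take the roles of the pulse interval \<tau> and of \<open>G\<close>.\<close>
    note step = effective_hamiltonian_step[OF basis orthogonal pulses(1) decoupling commute T0[of k]
        this TS IH x, folded duration]
    have H: "?H (Suc k) = (\<i> / complex_of_real (T (Suc k))) *\<^sub>C magnus_sum (toggling P (T k) (?H k)) (T (Suc k))"
      by (simp add: duration)
    have "norm (bath_proj (?H (Suc k))) \<le> \<beta>s k + (2/9 + 11/9 * ?x) * Js k * ?x\<^sup>2"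
      unfolding H by (rule step(1))
    \<comment> \<open>\<open>c3\<close> dominates the coefficient from the step because its further
      term 9.43 x^2 is nonnegative; for \<open>c2\<close> below the further term is a multiple of
      x^3, and x \<ge> 0 enters.\<close>
    also have "\<dots> \<le> \<beta>s k + c3 (Suc k) * Js k * ?x\<^sup>2"
      using J0 recursion(3)[of "Suc k"] by (intro add_left_mono mult_right_mono) auto
    finally have 1: "norm (bath_proj (?H (Suc k))) \<le> \<beta>s (Suc k)" using recursion(5)[of "Suc k"] by simp
    have "norm (?H (Suc k) - bath_proj (?H (Suc k))) \<le> (1/2 + 2 * (2/9 * ?x + 11/9 * ?x\<^sup>2)) * Js k * ?x"
      unfolding H by (rule step(2))
    also have "\<dots> \<le> c2 (Suc k) * Js k * ?x"
      using J0 x0 recursion(4)[of "Suc k"] by (intro mult_right_mono) auto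
    finally show ?case using 1 recursion(6)[of "Suc k"] by simp
  qed
  have growth: "Js k * T k \<le> real R powr (real k * (real k + 3) / 2) * (c * \<epsilon> * \<tau>\<^sub>0) ^ k * (J * \<tau>\<^sub>0)"
    if hyp: "\<forall>k\<in>{1..l}. x k \<le> 0.54 \<and> c2 k * \<epsilon>s (k - 1) \<le> c * \<epsilon>" and "k \<le> l" for k l
    using \<open>k \<le> l\<close>
  proof (induction k)
    case (Suc k)
    let ?b = "real R powr (real k * (real k + 3) / 2) * (c * \<epsilon> * \<tau>\<^sub>0) ^ k * (J * \<tau>\<^sub>0)"
    have "norm (?H k - bath_proj (?H k)) \<le> Js k" using levels[OF hyp, of k] Suc.prems by simp
    then have J0: "0 \<le> Js k" using norm_ge_zero[of "?H k - bath_proj (?H k)"] by linarith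
    \<comment> \<open>Since x (k + 1) is \<open>\<epsilon>s k * T (Suc k)\<close>, one level
      multiplies \<open>Js k * T k\<close> by (c2 (k + 1) \<epsilon>s k) R T (k + 1), at most c
      \<epsilon> \<open>\<tau>\<^sub>0\<close> R^(k + 2). The exponents 2, 3, ..., k + 1 collected
      up to level k add up to k (k + 3) / 2.\<close>
    have "Js (Suc k) * T (Suc k) = (c2 (Suc k) * \<epsilon>s k) * (T (Suc k) * (real R * (Js k * T k)))"
      using recursion(2,6)[of "Suc k"] by (simp add: T)
    also have "\<dots> \<le> (c * \<epsilon>) * (T (Suc k) * (real R * (Js k * T k)))"
    proof (rule mult_right_mono)
      show "c2 (Suc k) * \<epsilon>s k \<le> c * \<epsilon>" using bspec[OF hyp, of "Suc k"] Suc.prems by simp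
    qed (use J0 T0 in \<open>simp add: less_imp_le\<close>)
    also have "\<dots> \<le> (c * \<epsilon>) * (T (Suc k) * (real R * ?b))"
      using Suc.IH Suc.prems c nonneg noise_bounds(3) T0
      by (intro mult_left_mono) (auto simp: less_imp_le)
    also have "\<dots> = real R ^ (k + 2) * real R powr (real k * (real k + 3) / 2) * (c * \<epsilon> * \<tau>\<^sub>0) ^ Suc k * (J * \<tau>\<^sub>0)"
      by (simp add: T mult_ac)
    also have "real R ^ (k + 2) * real R powr (real k * (real k + 3) / 2)
        = real R powr (real (Suc k) * (real (Suc k) + 3) / 2)"
    proof -
      have "real R ^ (k + 2) = real R powr (real (k + 2))" using R by (subst powr_realpow) auto
      then have "real R ^ (k + 2) * real R powr (real k * (real k + 3) / 2)
         = real R powr (real (k + 2) + real k * (real k + 3) / 2)" by (simp only: powr_add)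
      also have "real (k + 2) + real k * (real k + 3) / 2 = real (Suc k) * (real (Suc k) + 3) / 2"
        by (simp add: field_simps)
      finally show ?thesis .
    qed
    finally show ?case .
  qed (use R in \<open>simp add: recursion_0 T\<close>)
  have \<eta>: "\<eta> k \<le> real R powr (real k * (real k + 3) / 2) * (c * \<epsilon> * \<tau>\<^sub>0) ^ k * (J * \<tau>\<^sub>0)"
    if "\<forall>k\<in>{1..l}. x k \<le> 0.54 \<and> c2 k * \<epsilon>s (k - 1) \<le> c * \<epsilon>" "k \<le> l" for k l
  proof -
    have "\<eta> k \<le> Js k * T k"
      unfolding noise_strength err using levels[OF that] T0[of k] by (intro mult_right_mono) auto
    then show ?thesis using growth[OF that] by linarith
  qed
  show ?thesis
  proof (intro conjI allI impI)
    fix l k assume hyp: "\<forall>k\<in>{1..l}. x k \<le> 0.54 \<and> c2 k * \<epsilon>s (k - 1) \<le> c * \<epsilon>" and k: "k \<le> l"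
    show "?H k = bath_part S A (?H k) + err_part S A (?H k)" by (simp add: bath err)
    show "norm (bath_part S A (?H k)) \<le> \<beta>s k" "norm (err_part S A (?H k)) \<le> Js k"
      using levels[OF hyp k] by (simp_all add: bath err)
    show "\<eta> k \<le> real R powr (real k * (real k + 3) / 2) * (c * \<epsilon> * \<tau>\<^sub>0) ^ k * (J * \<tau>\<^sub>0)"
      by (rule \<eta>[OF hyp k])
  next
    fix k
    assume "0 < \<epsilon>" "int k = \<lfloor>log (real R) (1 / (c * \<epsilon> * \<tau>\<^sub>0)) - 1\<rfloor>"
      and hyp: "\<forall>k\<in>{1..k}. x k \<le> 0.54 \<and> c2 k * \<epsilon>s (k - 1) \<le> c * \<epsilon>"
    then show "\<eta> k / (J * \<tau>\<^sub>0)
        \<le> 1 / real R * (c * \<epsilon> * \<tau>\<^sub>0) powr (1/2 * log (real R) (1 / (c * \<epsilon> * \<tau>\<^sub>0)) - 3/2)"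
      using c interval nonneg \<eta>[OF hyp order_refl] by (intro suppression_exponent_bound R) auto
  qed
qed

end
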